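(* Let $j,\ell$ be integers with $1\le j\le\ell$ and $\gcd(j,\ell)=1$. Then, as $x\to\infty$, $$\sum_{\substack{2\le n\le x\\ p_1(n)\equiv j\ (\mathrm{mod}\ \ell)}}\mu(n)\omega(n)^2\left\{\frac{x}{n}\right\}\ll\frac{x(\log\log x)^{7/2}}{\sqrt{\log x}}.$$
   Context: $\mu$ is the Möbius function, $\omega(n)$ the number of distinct prime factors of $n$, $p_1(n)$ the smallest prime factor of $n\ge2$, and $\{w\}=w-\lfloor w\rfloor$ the fractional part of $w$. Implied constants may depend on $\ell$. *)

theory Defs
  imports "HOL-Library.Landau_Symbols" "HOL-Computational_Algebra.Squarefree" "HOL-Number_Theory.Cong"
begin

definition omega :: "nat \<Rightarrow> nat" where
  "omega n = card (prime_factors n)"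

definition moebius_mu :: "nat \<Rightarrow> int" where
  "moebius_mu n = (if squarefree n then (-1) ^ omega n else 0)"

(* Only meaningful for n >= 2, where prime_factors n is nonempty. *)
definition least_prime_factor :: "nat \<Rightarrow> nat" where
  "least_prime_factor n = Min (prime_factors n)"

definition weighted_moebius_sum :: "nat \<Rightarrow> nat \<Rightarrow> real \<Rightarrow> real" where
  "weighted_moebius_sum l j x =
     (\<Sum>n | 2 \<le> n \<and> real n \<le> x \<and> [least_prime_factor n = j] (mod l).
        real_of_int (moebius_mu n) * real (omega n) ^ 2 * frac (x / real n))"

end

theory Submission
  imports Defs "HOL-Complex_Analysis.Complex_Analysis" "HOL-Probability.Probability"
    "HOL-Number_Theory.Prime_Powers" "HOL-Real_Asymp.Real_Asymp"
begin

text \<open>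
  The congruence condition on the least prime factor is harmless: writing \<open>n = p m\<close> with \<open>p\<close> the least
  prime factor, it suffices to bound \<open>\<mu>\<close>-sums over \<open>p\<close>-rough numbers uniformly in \<open>p\<close> and then to sum
  absolute values over \<open>p\<close>. For the sum \<open>M(v)\<close> of \<open>\<mu>(m)\<close> over \<open>m \<le> v\<close> with all prime factors in a set
  \<open>P\<close> of primes \<open>q > p\<close>, the identity \<open>\<mu>(m) log m = -\<Sum>\<close> of \<open>\<mu>(m/q) log q\<close> over the primes \<open>q\<close>
  dividing \<open>m\<close> turns \<open>M(v) log v\<close> into \<open>\<Sum> \<mu>(m) \<theta>(v/m)\<close> up to \<open>O(v)\<close>. Replacing \<open>\<theta>(w)\<close> by \<open>w\<close> leaves
  \<open>v \<Sum> \<mu>(m)/m = O(v)\<close>, and the total error is \<open>O(v)\<close> as soon as \<open>|\<psi>(w) - w| / w\<^sup>2\<close> is integrable, so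
  \<open>M(v) = O(v / log v)\<close> uniformly. The factor \<open>\<omega>(n)\<^sup>2\<close> and the sum over \<open>p\<close> cost three factors
  \<open>log log v\<close>, and Axer's summation by parts against the fractional part costs one more.

  The integrability is the quantitative prime number theorem needed here. Plancherel's inequality on the line
  \<open>Re s = 1 + \<delta>\<close> bounds the \<open>L\<^sup>2\<close> norm of \<open>\<psi>(e\<^sup>\<tau>) e\<^sup>-\<^sup>\<tau> - 1\<close> against the weight
  \<open>exp(-\<delta>\<tau>) - exp(-2\<delta>\<tau>)\<close> by differences of \<open>-\<zeta>'/(s \<zeta>) - 1/(s - 1)\<close>, whose derivative is
  square integrable by the inequality \<open>3 + 4 cos x + cos 2x \<ge> 0\<close>; Cauchy-Schwarz finishes.
\<close>

section \<open>A Plancherel inequality\<close>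

text \<open>The aim is a saving of one full logarithm. The target asks only for its square root, so
  the powers of \<open>log log x\<close> lost on the way are absorbed at the end. The exponents on
  the analytic side are fixed by square integrability. For \<open>1 \<le> Re s \<le> 3\<close> the
  function \<open>reg_zeta\<close> and its first two derivatives grow at most like |t|^(41/40),
  while just right of \<open>Re s = 1\<close> its modulus is at least of order |t|^(9/10). A
  logarithmic derivative then costs |t|^(1/8), its square |t|^(1/4), and division by
  \<open>s\<close> leaves |t|^(-3/4), whose square is integrable at infinity. On the arithmetic side
  the obstacle is that the Moebius function vanishes on repeated primes: extracting a prime q leaves
  a cofactor prime to q, so the set of allowed primes changes with every extraction. Estimates are
  therefore stated for the sets \<open>rough_primes p F\<close>, uniformly in \<open>p\<close> and
  in the exceptional set \<open>F\<close>; the two factors omega cause two extractions, hence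
  \<open>card F \<le> 2\<close>. The congruence enters only as an arbitrary predicate
  \<open>J\<close> on primes, which makes uniformity in \<open>j\<close> automatic.\<close>

lemma integrable_product_bounded_kernel:
  fixes f g :: "real \<Rightarrow> complex"
  assumes f: "integrable lborel f" and g: "integrable lborel g"
    and h: "(\<lambda>(x, y). h x y) \<in> borel_measurable (lborel \<Otimes>\<^sub>M lborel)"
    and hb: "\<And>x y. norm (h x y :: complex) \<le> C"
  shows "integrable (lborel \<Otimes>\<^sub>M lborel) (\<lambda>(x, y). f x * g y * h x y)"
proof -
  have [measurable]: "f \<in> borel_measurable lborel" "g \<in> borel_measurable lborel" using f g by auto
  have "integrable (lborel \<Otimes>\<^sub>M lborel) (\<lambda>(x, y). f x * g y)"
  proof (rule lborel_pair.Fubini_integrable)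
    show "(\<lambda>(x, y). f x * g y) \<in> borel_measurable (lborel \<Otimes>\<^sub>M lborel)" by measurable
    show "integrable lborel (\<lambda>x. LBINT y. norm (case (x, y) of (x, y) \<Rightarrow> f x * g y))"
      using f by (simp add: norm_mult)
    show "AE x in lborel. integrable lborel (\<lambda>y. case (x, y) of (x, y) \<Rightarrow> f x * g y)"
      using g by simp
  qed
  then have I: "integrable (lborel \<Otimes>\<^sub>M lborel) (\<lambda>z. of_real C * (case z of (x, y) \<Rightarrow> f x * g y))"
    by simp
  have C0: "0 \<le> C" using order_trans[OF norm_ge_zero hb] .
  show ?thesis
  proof (rule Bochner_Integration.integrable_bound[OF I])
    have "(\<lambda>z. (case z of (x, y) \<Rightarrow> f x * g y) * (case z of (x, y) \<Rightarrow> h x y)) \<in> borel_measurable (lborel \<Otimes>\<^sub>M lborel)"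
      using h by measurable
    then show "(\<lambda>(x, y). f x * g y * h x y) \<in> borel_measurable (lborel \<Otimes>\<^sub>M lborel)"
      by (simp add: case_prod_beta')
    show "AE z in lborel \<Otimes>\<^sub>M lborel. norm (case z of (x, y) \<Rightarrow> f x * g y * h x y)
           \<le> norm (of_real C * (case z of (x, y) \<Rightarrow> f x * g y))"
    proof (intro AE_I2, clarsimp simp: norm_mult)
      fix a b
      have "(cmod (f a) * cmod (g b)) * cmod (h a b) \<le> (cmod (f a) * cmod (g b)) * C"
        by (intro mult_left_mono hb) auto
      then show "cmod (f a) * cmod (g b) * cmod (h a b) \<le> \<bar>C\<bar> * (cmod (f a) * cmod (g b))"
        using C0 by (simp add: mult_ac)
    qed
  qed
qed

text \<open>The characteristic function of the normal law, rewritten as a Lebesgue integral. It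
  evaluates the frequency integral once both copies of \<open>f\<close> have been pulled
  out.\<close>

lemma integral_std_normal_cis:
  "integrable lborel (\<lambda>t. complex_of_real (std_normal_density t) * cis (y * t))"
  "(LBINT t. complex_of_real (std_normal_density t) * cis (y * t)) = complex_of_real (exp (- y\<^sup>2 / 2))"
proof -
  show I: "integrable lborel (\<lambda>t. complex_of_real (std_normal_density t) * cis (y * t))"
  proof (rule Bochner_Integration.integrable_bound)
    show "integrable lborel std_normal_density" by (simp add: integrable_normal_density)
    show "(\<lambda>t. complex_of_real (std_normal_density t) * cis (y * t)) \<in> borel_measurable lborel"
      unfolding cis_conv_exp by measurable
  qed (auto simp: norm_mult)
  have "complex_of_real (exp (- y\<^sup>2 / 2)) = char std_normal_distribution y"
    by (simp add: char_std_normal_distribution)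
  also have "\<dots> = (LBINT t. std_normal_density t *\<^sub>R iexp (y * t))"
    unfolding char_def by (subst integral_density) (auto)
  finally show "(LBINT t. complex_of_real (std_normal_density t) * cis (y * t)) = complex_of_real (exp (- y\<^sup>2 / 2))"
    by (simp add: scaleR_conv_of_real cis_conv_exp)
qed

lemma mult_right_left_commute: "(a * b) * c = a * (c * b)" for a b c :: complex
  by (simp add: mult.assoc mult.commute)

text \<open>The Gaussian weight makes the triple integral over \<open>t\<close>, \<open>a\<close>,
  \<open>b\<close> absolutely convergent, so the frequency integral can be done first. It yields a
  Gaussian in \<open>b - a\<close> of width \<open>e\<close>, and the substitution
  \<open>b = a + e * z\<close> normalises it.\<close>

lemma gaussian_fourier_energy:
  fixes f :: "real \<Rightarrow> real" and e :: real
  assumes f: "integrable lborel f" and e: "e > 0"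
  defines "ft \<equiv> \<lambda>t. LBINT x. complex_of_real (f x) * cis (- t * x)"
  shows "(LBINT t. complex_of_real (std_normal_density t * (cmod (ft (t / e)))\<^sup>2))
       = of_real (sqrt (2 * pi) * e * (LBINT a. f a * (LBINT z. f (a + e * z) * std_normal_density z)))"
proof -
  have [measurable]: "f \<in> borel_measurable lborel" using f by auto
  have fc: "integrable lborel (\<lambda>x. complex_of_real (f x))" using f by simp
  have nc: "integrable lborel (\<lambda>x. complex_of_real (std_normal_density x))"
    by (simp add: integrable_normal_density)
  \<comment> \<open>The conjugate of \<open>ft (t / e)\<close>. It stays packed as a bounded kernel
    during the first interchange, so that the triple integral is swapped one pair of variables at a
    time.\<close>
  define C where "C = (\<lambda>t. LBINT b. complex_of_real (f b) * cis (t / e * b))"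
  have cism[measurable]: "(\<lambda>(x, y). cis (c * (x * y))) \<in> borel_measurable (lborel \<Otimes>\<^sub>M lborel)" for c :: real
    unfolding cis_conv_exp by measurable
  have Cm[measurable]: "C \<in> borel_measurable lborel"
    unfolding C_def cis_conv_exp by measurable
  have Cb: "cmod (C t) \<le> (LBINT b. \<bar>f b\<bar>)" for t
  proof -
    have "cmod (C t) \<le> (LBINT b. cmod (complex_of_real (f b) * cis (t / e * b)))"
      unfolding C_def by (rule integral_norm_bound)
    then show ?thesis by (simp add: norm_mult)
  qed
  have sq: "complex_of_real ((cmod (ft (t / e)))\<^sup>2) = ft (t / e) * C t" for t
  proof -
    have "cnj (ft (t / e)) = C t"
      unfolding ft_def C_def Bochner_Integration.integral_cnj[symmetric] by (simp add: cis_cnj)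
    then show ?thesis by (simp only: complex_norm_square)
  qed
  have "(LBINT t. complex_of_real (std_normal_density t * (cmod (ft (t / e)))\<^sup>2))
      = (LBINT t. LBINT a. complex_of_real (f a) * complex_of_real (std_normal_density t) * (cis (- (t / e * a)) * C t))"
  proof (rule Bochner_Integration.integral_cong[OF refl])
    fix t
    have "(LBINT a. complex_of_real (f a) * complex_of_real (std_normal_density t) * (cis (- (t / e * a)) * C t))
        = (LBINT a. (complex_of_real (std_normal_density t) * C t) * (complex_of_real (f a) * cis (- (t / e) * a)))"
      by (rule Bochner_Integration.integral_cong) (auto simp: mult_ac)
    also have "\<dots> = complex_of_real (std_normal_density t) * (ft (t / e) * C t)"
      unfolding ft_def by (subst Bochner_Integration.integral_mult_right_zero) (rule mult_right_left_commute)
    finally show "complex_of_real (std_normal_density t * (cmod (ft (t / e)))\<^sup>2)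
      = (LBINT a. complex_of_real (f a) * complex_of_real (std_normal_density t) * (cis (- (t / e * a)) * C t))"
      unfolding of_real_mult sq by (rule sym)
  qed
  also have "\<dots> = (LBINT a. LBINT t. complex_of_real (f a) * complex_of_real (std_normal_density t) * (cis (- (t / e * a)) * C t))"
  proof (rule lborel_pair.Fubini_integral, rule integrable_product_bounded_kernel[OF fc nc])
    have "(\<lambda>z. (case z of (x, y) \<Rightarrow> cis (- (1 / e) * (x * y))) * C (snd z)) \<in> borel_measurable (lborel \<Otimes>\<^sub>M lborel)"
      by measurable
    then show "(\<lambda>(a, t). cis (- (t / e * a)) * C t) \<in> borel_measurable (lborel \<Otimes>\<^sub>M lborel)"
      by (simp add: case_prod_beta' mult_ac)
    show "cmod (cis (- (t / e * a)) * C t) \<le> (LBINT b. \<bar>f b\<bar>)" for a t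
      using Cb by (simp add: norm_mult)
  qed
  also have "\<dots> = (LBINT a. complex_of_real (f a) * (LBINT b. complex_of_real (f b) * complex_of_real (exp (- ((b - a) / e)\<^sup>2 / 2))))"
  proof (rule Bochner_Integration.integral_cong[OF refl])
    fix a
    have "(LBINT t. complex_of_real (std_normal_density t) * (cis (- (t / e * a)) * C t))
        = (LBINT t. LBINT b. complex_of_real (f b) * complex_of_real (std_normal_density t) * cis ((b - a) / e * t))"
      unfolding C_def
    proof (rule Bochner_Integration.integral_cong[OF refl])
      fix t
      have c: "cis ((b - a) / e * t) = cis (- (t / e * a)) * cis (t / e * b)" for b
        unfolding cis_mult using e by (intro arg_cong[where f = cis]) (simp add: field_simps)
      have "(LBINT b. complex_of_real (f b) * complex_of_real (std_normal_density t) * cis ((b - a) / e * t))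
         = (LBINT b. (complex_of_real (std_normal_density t) * cis (- (t / e * a))) * (complex_of_real (f b) * cis (t / e * b)))"
        unfolding c by (rule Bochner_Integration.integral_cong) (simp_all add: mult.assoc mult.left_commute)
      also have "\<dots> = (complex_of_real (std_normal_density t) * cis (- (t / e * a))) * (LBINT b. complex_of_real (f b) * cis (t / e * b))"
        by (rule Bochner_Integration.integral_mult_right_zero)
      finally show "complex_of_real (std_normal_density t) * (cis (- (t / e * a)) * (LBINT b. complex_of_real (f b) * cis (t / e * b)))
        = (LBINT b. complex_of_real (f b) * complex_of_real (std_normal_density t) * cis ((b - a) / e * t))"
        by (simp only: mult.assoc)
    qed
    also have "\<dots> = (LBINT b. LBINT t. complex_of_real (f b) * complex_of_real (std_normal_density t) * cis ((b - a) / e * t))"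
    proof (rule lborel_pair.Fubini_integral, rule integrable_product_bounded_kernel[OF fc nc])
      show "(\<lambda>(b, t). cis ((b - a) / e * t)) \<in> borel_measurable (lborel \<Otimes>\<^sub>M lborel)"
        unfolding cis_conv_exp by measurable
      show "cmod (cis ((b - a) / e * t)) \<le> 1" for b t by simp
    qed
    also have "\<dots> = (LBINT b. complex_of_real (f b) * complex_of_real (exp (- ((b - a) / e)\<^sup>2 / 2)))"
      by (simp only: mult.assoc Bochner_Integration.integral_mult_right_zero integral_std_normal_cis)
    finally show "(LBINT t. complex_of_real (f a) * complex_of_real (std_normal_density t) * (cis (- (t / e * a)) * C t))
       = complex_of_real (f a) * (LBINT b. complex_of_real (f b) * complex_of_real (exp (- ((b - a) / e)\<^sup>2 / 2)))"
      by (simp add: mult.assoc)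
  qed
  also have "\<dots> = of_real (LBINT a. f a * (LBINT b. f b * exp (- ((b - a) / e)\<^sup>2 / 2)))"
    unfolding of_real_mult[symmetric] by (simp only: integral_complex_of_real of_real_mult[symmetric])
  also have "(LBINT a. f a * (LBINT b. f b * exp (- ((b - a) / e)\<^sup>2 / 2)))
     = (LBINT a. f a * (sqrt (2 * pi) * e * (LBINT z. f (a + e * z) * std_normal_density z)))"
  proof (rule Bochner_Integration.integral_cong[OF refl])
    fix a
    have "(LBINT b. f b * exp (- ((b - a) / e)\<^sup>2 / 2)) = \<bar>e\<bar> *\<^sub>R (LBINT z. f (a + e * z) * exp (- ((a + e * z - a) / e)\<^sup>2 / 2))"
      using e by (intro lborel_integral_real_affine) auto
    also have "\<dots> = e * (LBINT z. sqrt (2 * pi) * (f (a + e * z) * std_normal_density z))"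
      using e by (simp add: std_normal_density_def)
    also have "\<dots> = sqrt (2 * pi) * e * (LBINT z. f (a + e * z) * std_normal_density z)"
      by (simp only: Bochner_Integration.integral_mult_right_zero mult.assoc mult.left_commute)
    finally show "f a * (LBINT b. f b * exp (- ((b - a) / e)\<^sup>2 / 2)) = f a * (sqrt (2 * pi) * e * (LBINT z. f (a + e * z) * std_normal_density z))"
      by simp
  qed
  also have "\<dots> = sqrt (2 * pi) * e * (LBINT a. f a * (LBINT z. f (a + e * z) * std_normal_density z))"
    unfolding mult.left_commute[of "f _"] by simp
  finally show ?thesis .
qed

text \<open>In the Gaussian energy identity the density never exceeds its peak
  \<open>1 / sqrt (2 * pi)\<close>, so the frequency side is controlled by the majorant
  \<open>g\<close> at every scale. As the scale shrinks, the Gaussian averages of \<open>f\<close>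
  tend to \<open>f\<close> at its points of continuity, and the bound \<open>B\<close> supplies the
  domination.\<close>

lemma plancherel_le:
  fixes f g :: "real \<Rightarrow> real"
  assumes f: "integrable lborel f" and fB: "\<And>x. \<bar>f x\<bar> \<le> B"
    and cont: "AE x in lborel. isCont f x"
    and g: "integrable lborel g"
    and le: "\<And>t. (cmod (LBINT x. complex_of_real (f x) * cis (- t * x)))\<^sup>2 \<le> g t"
  shows "2 * pi * (LBINT x. (f x)\<^sup>2) \<le> (LBINT t. g t)"
proof -
  have [measurable]: "f \<in> borel_measurable lborel" "g \<in> borel_measurable lborel" using f g by auto
  have nc: "integrable lborel std_normal_density"
    by (simp add: integrable_normal_density)
  define ft where "ft = (\<lambda>t. LBINT x. complex_of_real (f x) * cis (- t * x))"
  have [measurable]: "ft \<in> borel_measurable lborel"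
    unfolding ft_def cis_conv_exp by measurable
  have g0: "0 \<le> g t" for t using order_trans[OF _ le[of t]] by simp
  have B0: "0 \<le> B" using order_trans[OF _ fB[of 0]] by simp
  define S where "S = (\<lambda>n::nat. LBINT a. f a * (LBINT z. f (a + 1 / real (Suc n) * z) * std_normal_density z))"
  have up: "2 * pi * S n \<le> (LBINT t. g t)" for n
  proof -
    define e where "e = 1 / real (Suc n)"
    have e: "e > 0" unfolding e_def by simp
    have "complex_of_real (LBINT t. std_normal_density t * (cmod (ft (t / e)))\<^sup>2)
       = of_real (sqrt (2 * pi) * e * S n)"
      using gaussian_fourier_energy[OF f e] unfolding integral_complex_of_real S_def ft_def e_def[symmetric]
      by simp
    then have "sqrt (2 * pi) * e * S n = (LBINT t. std_normal_density t * (cmod (ft (t / e)))\<^sup>2)"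
      using of_real_eq_iff by metis
    \<comment> \<open>Rescaling \<open>t\<close> by \<open>e\<close> moves the scale from the
      transform into the density, where the peak value removes it.\<close>
    also have "\<dots> = \<bar>e\<bar> *\<^sub>R (LBINT t. std_normal_density (0 + e * t) * (cmod (ft ((0 + e * t) / e)))\<^sup>2)"
      using e by (intro lborel_integral_real_affine) auto
    also have "\<dots> = e * (LBINT t. std_normal_density (e * t) * (cmod (ft t))\<^sup>2)"
      using e by simp
    also have "(LBINT t. std_normal_density (e * t) * (cmod (ft t))\<^sup>2) \<le> (LBINT t. 1 / sqrt (2 * pi) * g t)"
    proof (rule integral_mono_AE')
      show "integrable lborel (\<lambda>t. 1 / sqrt (2 * pi) * g t)" using g by simp
      show "AE x in lborel. std_normal_density (e * x) * (cmod (ft x))\<^sup>2 \<le> 1 / sqrt (2 * pi) * g x"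
      proof (rule AE_I2, rule mult_mono)
        fix x show "std_normal_density (e * x) \<le> 1 / sqrt (2 * pi)"
          unfolding std_normal_density_def by (intro mult_left_le) auto
        show "(cmod (ft x))\<^sup>2 \<le> g x" using le unfolding ft_def by simp
      qed auto
      show "AE x in lborel. 0 \<le> 1 / sqrt (2 * pi) * g x" using g0 by simp
    qed
    finally have "e * (sqrt (2 * pi) * S n) \<le> e * (1 / sqrt (2 * pi) * (LBINT t. g t))"
      using e by (simp add: mult_ac)
    then have "sqrt (2 * pi) * S n \<le> 1 / sqrt (2 * pi) * (LBINT t. g t)"
      using e by (rule mult_left_le_imp_le)
    then have "sqrt (2 * pi) * (sqrt (2 * pi) * S n) \<le> sqrt (2 * pi) * (1 / sqrt (2 * pi) * (LBINT t. g t))"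
      by (intro mult_left_mono) auto
    then show ?thesis by (simp add: mult.assoc[symmetric])
  qed
  have "S \<longlonglongrightarrow> (LBINT a. f a * f a)"
    unfolding S_def
  proof (rule integral_dominated_convergence)
    show "integrable lborel (\<lambda>a. B * \<bar>f a\<bar>)" using f by simp
    show "AE x in lborel. (\<lambda>n. f x * (LBINT z. f (x + 1 / real (Suc n) * z) * std_normal_density z)) \<longlonglongrightarrow> f x * f x"
      using cont
    proof eventually_elim
      case (elim x)
      have "(\<lambda>n. LBINT z. f (x + 1 / real (Suc n) * z) * std_normal_density z) \<longlonglongrightarrow> (LBINT z. f x * std_normal_density z)"
      proof (rule integral_dominated_convergence)
        show "integrable lborel (\<lambda>z. B * std_normal_density z)" using nc by simp
        show "AE z in lborel. (\<lambda>n. f (x + 1 / real (Suc n) * z) * std_normal_density z) \<longlonglongrightarrow> f x * std_normal_density z"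
        proof (rule AE_I2, rule tendsto_mult[OF _ tendsto_const])
          fix z
          have "(\<lambda>n. x + 1 / real (Suc n) * z) \<longlonglongrightarrow> x + 0 * z"
            by (intro tendsto_intros LIMSEQ_Suc[OF lim_1_over_n])
          then show "(\<lambda>n. f (x + 1 / real (Suc n) * z)) \<longlonglongrightarrow> f x"
            using isCont_tendsto_compose[OF elim] by simp
        qed
        show "AE z in lborel. norm (f (x + 1 / real (Suc n) * z) * std_normal_density z) \<le> B * std_normal_density z" for n
          using fB by (auto simp: abs_mult intro!: mult_right_mono)
      qed auto
      also have "(LBINT z. f x * std_normal_density z) = f x" by simp
      finally show ?case by (intro tendsto_intros)
    qed
    show "AE x in lborel. norm (f x * (LBINT z. f (x + 1 / real (Suc n) * z) * std_normal_density z)) \<le> B * \<bar>f x\<bar>" for n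
    proof (rule AE_I2)
      fix x
      have "norm (LBINT z. f (x + 1 / real (Suc n) * z) * std_normal_density z) \<le> (LBINT z. B * std_normal_density z)"
      proof (rule Bochner_Integration.integral_norm_bound_integral)
        show "integrable lborel (\<lambda>z. B * std_normal_density z)" using nc by simp
        then show "integrable lborel (\<lambda>z. f (x + 1 / real (Suc n) * z) * std_normal_density z)"
          by (rule Bochner_Integration.integrable_bound)
             (use fB B0 in \<open>auto simp: abs_mult intro!: mult_right_mono\<close>)
        show "norm (f (x + 1 / real (Suc n) * z) * std_normal_density z) \<le> B * std_normal_density z" for z
          using fB by (auto simp: abs_mult intro!: mult_right_mono)
      qed
      also have "\<dots> = B" by simp
      finally have "\<bar>f x\<bar> * \<bar>LBINT z. f (x + 1 / real (Suc n) * z) * std_normal_density z\<bar> \<le> \<bar>f x\<bar> * B"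
        by (intro mult_left_mono) auto
      then show "norm (f x * (LBINT z. f (x + 1 / real (Suc n) * z) * std_normal_density z)) \<le> B * \<bar>f x\<bar>"
        by (simp add: abs_mult mult_ac)
    qed
    show "(\<lambda>x. f x * (LBINT z. f (x + 1 / real (Suc n) * z) * std_normal_density z)) \<in> borel_measurable lborel" for n
      by measurable
  qed auto
  then have "(\<lambda>n. 2 * pi * S n) \<longlonglongrightarrow> 2 * pi * (LBINT a. f a * f a)" by (intro tendsto_intros)
  then have "2 * pi * (LBINT a. f a * f a) \<le> (LBINT t. g t)"
    by (rule LIMSEQ_le_const2) (use up in auto)
  then show ?thesis by (simp add: power2_eq_square)
qed

section \<open>The zeta function near the line of convergence\<close>

text \<open>The index is shifted: term \<open>n\<close> belongs to the integer \<open>Suc n\<close>,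
  so no power has base 0.\<close>

definition zeta_term :: "nat \<Rightarrow> complex \<Rightarrow> complex" where
  "zeta_term n s = (s - 1) * of_nat (Suc n) powr (- s)
     + (of_nat (Suc (Suc n)) powr (1 - s) - of_nat (Suc n) powr (1 - s))"

text \<open>\<open>reg_zeta s = (s - 1) \<zeta>(s)\<close>, continued to the left of the line \<open>Re s = 1\<close>: by telescoping, the series
  is \<open>(s - 1) \<Sum> (n\<^sup>-\<^sup>s - \<integral> u\<^sup>-\<^sup>s du)\<close> with \<open>u\<close> running over \<open>[n, n + 1]\<close>.\<close>
definition reg_zeta :: "complex \<Rightarrow> complex" where
  "reg_zeta s = 1 + (\<Sum>n. zeta_term n s)"

lemma norm_of_nat_powr: "cmod (of_nat (Suc n) powr s) = real (Suc n) powr Re s"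
  by (subst norm_powr_real_powr) auto

lemma norm_of_real_powr: "0 \<le> u \<Longrightarrow> cmod (of_real u powr s) = u powr Re s"
  by (subst norm_powr_real_powr) auto

text \<open>Mean value inequality along the real segment: the derivative of
  \<open>z powr (- s)\<close> is largest in modulus at the left end point. One power of
  \<open>a\<close> is gained at the price of \<open>cmod s\<close>.\<close>

lemma norm_powr_diff_le:
  fixes s :: complex
  assumes a: "0 < a" "a \<le> u" "u \<le> a + 1" and s: "0 \<le> Re s"
  shows "cmod (of_real a powr (- s) - of_real u powr (- s)) \<le> cmod s * a powr (- Re s - 1)"
proof -
  let ?S = "closed_segment (complex_of_real a) (of_real (a + 1))"
  have S: "?S = of_real ` {a..a+1}"
    by (simp only: closed_segment_of_real) (simp add: closed_segment_eq_real_ivl)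
  have "cmod (of_real a powr (- s) - of_real u powr (- s)) \<le> (cmod s * a powr (- Re s - 1)) * cmod (of_real a - of_real u)"
  proof (rule field_differentiable_bound[where S = ?S and f' = "\<lambda>z. - s * z powr (- s - 1)"])
    show "((\<lambda>z. z powr - s) has_field_derivative - s * z powr (- s - 1)) (at z within ?S)" if "z \<in> ?S" for z
    proof -
      have "z \<notin> \<real>\<^sub>\<le>\<^sub>0" using that a unfolding S by (auto simp: complex_nonpos_Reals_iff)
      then show ?thesis by (auto intro!: derivative_eq_intros)
    qed
    show "cmod (- s * z powr (- s - 1)) \<le> cmod s * a powr (- Re s - 1)" if z: "z \<in> ?S" for z
    proof -
      obtain w where w: "z = of_real w" "a \<le> w" using z unfolding S by auto
      have "w powr (- Re s - 1) \<le> a powr (- Re s - 1)"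
        using w a s by (intro powr_mono2') auto
      then show ?thesis using w a by (simp add: norm_mult norm_of_real_powr mult_left_mono)
    qed
    show "of_real a \<in> ?S" "of_real u \<in> ?S" unfolding S using a by auto
  qed simp
  also have "\<dots> \<le> (cmod s * a powr (- Re s - 1)) * 1"
    using a by (intro mult_left_mono) (auto simp: norm_of_real simp flip: of_real_diff)
  finally show ?thesis by simp
qed

text \<open>With \<open>N = Suc n\<close>, the term is the increment over \<open>[N, N + 1]\<close>
  of a function of \<open>u\<close> with derivative
  \<open>(s - 1) * (N powr (- s) - u powr (- s))\<close>. Any bound for the oscillation of the power
  therefore passes to the term.\<close>

lemma norm_zeta_term_le_mult:
  assumes s: "0 \<le> Re s"
    and B: "\<And>u. real (Suc n) \<le> u \<Longrightarrow> u \<le> real (Suc n) + 1 \<Longrightarrow>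
          cmod (of_real (real (Suc n)) powr (- s) - of_real u powr (- s)) \<le> B"
  shows "cmod (zeta_term n s) \<le> cmod (s - 1) * B"
proof -
  let ?N = "real (Suc n)"
  let ?S = "closed_segment (complex_of_real ?N) (of_real (?N + 1))"
  have S: "?S = of_real ` {?N..?N+1}"
    by (simp only: closed_segment_of_real) (simp add: closed_segment_eq_real_ivl)
  define \<phi> where "\<phi> = (\<lambda>u. (s - 1) * of_real ?N powr (- s) * u + u powr (1 - s))"
  have "cmod (\<phi> (of_real (?N + 1)) - \<phi> (of_real ?N)) \<le> (cmod (s - 1) * B) * cmod (complex_of_real (?N + 1) - of_real ?N)"
  proof (rule field_differentiable_bound[where S = ?S and f' = "\<lambda>z. (s - 1) * (of_real ?N powr (- s) - z powr (- s))"])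
    fix z assume z: "z \<in> ?S"
    then obtain w where w: "z = of_real w" "?N \<le> w" "w \<le> ?N + 1" unfolding S by auto
    have "z \<notin> \<real>\<^sub>\<le>\<^sub>0" using w by (auto simp: complex_nonpos_Reals_iff)
    then show "(\<phi> has_field_derivative (s - 1) * (of_real ?N powr (- s) - z powr (- s))) (at z within ?S)"
      unfolding \<phi>_def by (auto intro!: derivative_eq_intros simp: algebra_simps)
    show "cmod ((s - 1) * (of_real ?N powr (- s) - z powr (- s))) \<le> cmod (s - 1) * B"
      unfolding norm_mult w(1) by (intro mult_left_mono B w) auto
  qed auto
  moreover have "\<phi> (of_real (?N + 1)) - \<phi> (of_real ?N) = zeta_term n s"
    unfolding \<phi>_def zeta_term_def by (simp add: algebra_simps)
  ultimately show ?thesis by simp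
qed

text \<open>Interpolation between the trivial bound and the derivative bound: a small power of \<open>|s|\<close> is the price
  for convergence on a strip of fixed width, which makes Cauchy's estimates for derivatives immediate.\<close>
lemma norm_zeta_term_le:
  assumes k: "0 < k" "k < 1" and s: "1 - k / 2 \<le> Re s"
  shows "cmod (zeta_term n s) \<le> 2 * cmod (s - 1) * cmod s powr k * real (Suc n) powr (- 1 - k / 2)"
proof -
  let ?N = "real (Suc n)"
  have s0: "0 \<le> Re s" using s k by linarith
  have "cmod (of_real ?N powr (- s) - of_real u powr (- s)) \<le> 2 * cmod s powr k * ?N powr (- 1 - k / 2)"
    if u: "?N \<le> u" "u \<le> ?N + 1" for u
  proof -
    define X where "X = cmod (of_real ?N powr (- s) - of_real u powr (- s))"
    have X0: "0 \<le> X" unfolding X_def by simp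
    have X1: "X \<le> cmod s * ?N powr (- Re s - 1)"
      unfolding X_def by (rule norm_powr_diff_le) (use u s0 in auto)
    have "X \<le> cmod (of_real ?N powr (- s)) + cmod (of_real u powr (- s))"
      unfolding X_def by (rule norm_triangle_ineq4)
    also have "cmod (of_real ?N powr (- s)) = ?N powr (- Re s)"
      using norm_of_real_powr[of ?N "- s"] by simp
    also have "cmod (of_real u powr (- s)) = u powr (- Re s)"
      using norm_of_real_powr[of u "- s"] u by simp
    also have "u powr (- Re s) \<le> ?N powr (- Re s)" using u s0 by (intro powr_mono2') auto
    finally have X2: "X \<le> 2 * ?N powr (- Re s)" by simp
    \<comment> \<open>The trivial bound gets weight \<open>1 - k\<close> and the derivative bound
      weight \<open>k\<close>. The exponents of \<open>Suc n\<close> add up to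
      \<open>- Re s - k\<close>, which is at most \<open>- 1 - k / 2\<close> on the strip.\<close>
    have "X = X powr (1 - k) * X powr k" using X0 k by (cases "X = 0") (auto simp flip: powr_add)
    also have "\<dots> \<le> (2 * ?N powr (- Re s)) powr (1 - k) * (cmod s * ?N powr (- Re s - 1)) powr k"
      using X0 X1 X2 k by (intro mult_mono powr_mono2) auto
    also have "\<dots> = 2 powr (1 - k) * cmod s powr k * ?N powr (- Re s - k)"
      by (simp add: powr_mult powr_powr algebra_simps flip: powr_add)
    also have "\<dots> \<le> 2 powr 1 * cmod s powr k * ?N powr (- 1 - k / 2)"
      using k s by (intro mult_mono[OF mult_right_mono[OF powr_mono] powr_mono]) auto
    finally show ?thesis unfolding X_def by simp
  qed
  from norm_zeta_term_le_mult[OF s0 this] show ?thesis by (simp add: mult_ac)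
qed

text \<open>The half plane \<open>Re s > 1 - k / 2\<close> for the choice \<open>k = 1/40\<close>.
  The same \<open>k\<close> makes the growth exponent \<open>1 + k = 41/40\<close>.\<close>

definition zeta_dom :: "complex set" where "zeta_dom = {s. 79 / 80 < Re s}"

lemma open_zeta_dom: "open zeta_dom"
  unfolding zeta_dom_def by (rule open_halfspace_Re_gt)

lemma summable_Suc_powr: "e < - 1 \<Longrightarrow> summable (\<lambda>n. real (Suc n) powr e)"
  using summable_real_powr_iff[of e] by (subst summable_Suc_iff) auto

definition zeta_const :: real where "zeta_const = (\<Sum>n. real (Suc n) powr (- 1 - 1 / 80))"

lemma zeta_const_nonneg: "0 \<le> zeta_const"
  unfolding zeta_const_def by (intro suminf_nonneg summable_Suc_powr) auto

lemma norm_zeta_term_zeta_dom_le: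
  assumes "s \<in> zeta_dom"
  shows "cmod (zeta_term n s) \<le> 2 * cmod (s - 1) * cmod s powr (1 / 40) * real (Suc n) powr (- 1 - 1 / 80)"
  using norm_zeta_term_le[of "1/40" s n] assms unfolding zeta_dom_def by simp

lemma summable_zeta_term:
  assumes "s \<in> zeta_dom"
  shows "summable (\<lambda>n. zeta_term n s)"
  by (rule summable_comparison_test'[OF summable_mult[OF summable_Suc_powr] norm_zeta_term_zeta_dom_le[OF assms]]) auto

lemma norm_reg_zeta_le:
  assumes "s \<in> zeta_dom"
  shows "cmod (reg_zeta s) \<le> 1 + 2 * cmod (s - 1) * cmod s powr (1 / 40) * zeta_const"
proof -
  have "cmod (\<Sum>n. zeta_term n s) \<le> (\<Sum>n. 2 * cmod (s - 1) * cmod s powr (1 / 40) * real (Suc n) powr (- 1 - 1 / 80))"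
    by (rule norm_suminf_le[OF norm_zeta_term_zeta_dom_le[OF assms] summable_mult[OF summable_Suc_powr]]) auto
  also have "\<dots> = 2 * cmod (s - 1) * cmod s powr (1 / 40) * zeta_const"
    unfolding zeta_const_def by (rule suminf_mult) (rule summable_Suc_powr, simp)
  finally show ?thesis unfolding reg_zeta_def
    using norm_triangle_ineq[of 1 "\<Sum>n. zeta_term n s"] by simp
qed

lemma holomorphic_reg_zeta: "reg_zeta holomorphic_on zeta_dom"
  unfolding reg_zeta_def
proof (rule holomorphic_on_add[OF holomorphic_on_const], rule holomorphic_uniform_sequence[OF open_zeta_dom])
  show "(\<lambda>s. \<Sum>n<N. zeta_term n s) holomorphic_on zeta_dom" for N
    unfolding zeta_term_def by (intro holomorphic_intros)
  fix x assume "x \<in> zeta_dom"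
  then obtain d where d: "d > 0" "cball x d \<subseteq> zeta_dom" using open_zeta_dom open_contains_cball by blast
  define M where "M = cmod x + d + 1"
  have "uniform_limit (cball x d) (\<lambda>N s. \<Sum>n<N. zeta_term n s) (\<lambda>s. \<Sum>n. zeta_term n s) sequentially"
  proof (rule Weierstrass_m_test)
    show "summable (\<lambda>n. 2 * M * M powr (1/40) * real (Suc n) powr (- 1 - 1 / 80))"
      by (intro summable_mult summable_Suc_powr) auto
    fix n s assume s: "s \<in> cball x d"
    have "cmod s \<le> cmod x + cmod (s - x)" by (metis add.commute diff_add_cancel norm_triangle_ineq)
    then have n1: "cmod s \<le> M - 1" using s unfolding M_def by (simp add: dist_norm norm_minus_commute)
    have n2: "cmod (s - 1) \<le> M" using norm_triangle_ineq4[of s 1] n1 by simp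
    have "cmod (zeta_term n s) \<le> 2 * cmod (s - 1) * cmod s powr (1 / 40) * real (Suc n) powr (- 1 - 1 / 80)"
      using s d by (intro norm_zeta_term_zeta_dom_le) auto
    also have "\<dots> \<le> 2 * M * M powr (1/40) * real (Suc n) powr (- 1 - 1 / 80)"
      using n1 n2 d by (intro mult_right_mono mult_mono powr_mono2) (auto simp: M_def)
    finally show "norm (zeta_term n s) \<le> 2 * M * M powr (1/40) * real (Suc n) powr (- 1 - 1 / 80)" .
  qed
  then show "\<exists>d>0. cball x d \<subseteq> zeta_dom \<and>
        uniform_limit (cball x d) (\<lambda>N s. \<Sum>n<N. zeta_term n s) (\<lambda>s. \<Sum>n. zeta_term n s) sequentially"
    using d by blast
qed

lemma reg_zeta_1: "reg_zeta 1 = 1"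
  by (simp add: reg_zeta_def zeta_term_def del: of_nat_Suc)

lemma sum_zeta_term:
  "(\<Sum>n<N. zeta_term n s) = (s - 1) * (\<Sum>n<N. of_nat (Suc n) powr (- s)) + of_nat (Suc N) powr (1 - s) - 1"
  by (induction N) (simp_all add: zeta_term_def algebra_simps)

lemma zeta_sums:
  assumes s: "1 < Re s"
  shows "(\<lambda>n. of_nat (Suc n) powr (- s)) sums (reg_zeta s / (s - 1))"
  unfolding sums_def
proof -
  have s1: "s - 1 \<noteq> 0" using s by auto
  have dom: "s \<in> zeta_dom" using s by (simp add: zeta_dom_def)
  have "(\<lambda>N. real (Suc N) powr (1 - Re s)) \<longlonglongrightarrow> 0"
    using s by real_asymp
  then have "(\<lambda>N. of_nat (Suc N) powr (1 - s)) \<longlonglongrightarrow> (0::complex)"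
    by (subst tendsto_norm_zero_iff[symmetric]) (simp add: norm_of_nat_powr del: of_nat_Suc)
  moreover have "(\<lambda>N. \<Sum>n<N. zeta_term n s) \<longlonglongrightarrow> (\<Sum>n. zeta_term n s)"
    using summable_zeta_term[OF dom] by (rule summable_LIMSEQ)
  ultimately have "(\<lambda>N. ((\<Sum>n<N. zeta_term n s) - of_nat (Suc N) powr (1 - s) + 1) / (s - 1)) \<longlonglongrightarrow> ((\<Sum>n. zeta_term n s) - 0 + 1) / (s - 1)"
    using s1 by (intro tendsto_intros)
  moreover have "((\<Sum>n<N. zeta_term n s) - of_nat (Suc N) powr (1 - s) + 1) / (s - 1) = (\<Sum>n<N. of_nat (Suc n) powr (- s))" for N
    using s1 by (simp add: sum_zeta_term)
  ultimately show "(\<lambda>N. \<Sum>n<N. of_nat (Suc n) powr (- s)) \<longlonglongrightarrow> reg_zeta s / (s - 1)"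
    by (simp add: reg_zeta_def add.commute)
qed

text \<open>The strip is wider than the one in which derivatives are wanted: it leaves room for
  discs of radius 1/100 around all points with \<open>1 \<le> Re s \<le> 3\<close>.\<close>

lemma reg_zeta_bound_strip:
  obtains K where "K > 0"
    "\<And>s. 99 / 100 \<le> Re s \<Longrightarrow> Re s \<le> 4 \<Longrightarrow> cmod (reg_zeta s) \<le> K * (1 + \<bar>Im s\<bar>) powr (41 / 40)"
proof
  let ?K = "1 + 50 * zeta_const"
  show "?K > 0" using zeta_const_nonneg by simp
  fix s assume s: "99 / 100 \<le> Re s" "Re s \<le> 4"
  let ?t = "1 + \<bar>Im s\<bar>"
  have n1: "cmod s \<le> 4 * ?t" using cmod_le[of s] s by simp
  have n2: "cmod (s - 1) \<le> 4 * ?t" using cmod_le[of "s - 1"] s by simp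
  have "cmod s powr (1/40) \<le> (4 * ?t) powr (1/40)" using n1 by (intro powr_mono2) auto
  also have "\<dots> = 4 powr (1/40) * ?t powr (1/40)" by (rule powr_mult; simp)
  also have "\<dots> \<le> 4 powr 1 * ?t powr (1/40)" by (intro mult_right_mono powr_mono) auto
  finally have n3: "cmod s powr (1/40) \<le> 4 * ?t powr (1/40)" by simp
  have "cmod (reg_zeta s) \<le> 1 + 2 * cmod (s - 1) * cmod s powr (1 / 40) * zeta_const"
    using s by (intro norm_reg_zeta_le) (simp add: zeta_dom_def)
  also have "\<dots> \<le> 1 + 2 * (4 * ?t) * (4 * ?t powr (1/40)) * zeta_const"
    using n2 n3 zeta_const_nonneg by (intro add_left_mono mult_mono) auto
  also have "\<dots> = 1 + 32 * zeta_const * (?t powr 1 * ?t powr (1/40))" by simp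
  also have "?t powr 1 * ?t powr (1/40) = ?t powr (41 / 40)" by (subst powr_add[symmetric]) simp
  also have "1 + 32 * zeta_const * ?t powr (41 / 40) \<le> ?t powr (41/40) + 50 * zeta_const * ?t powr (41/40)"
    using zeta_const_nonneg by (intro add_mono mult_right_mono ge_one_powr_ge_zero) auto
  finally show "cmod (reg_zeta s) \<le> ?K * ?t powr (41/40)" by (simp add: algebra_simps)
qed

lemma reg_zeta_deriv_bounds:
  obtains K where "K > 0"
    "\<And>s n. n \<le> 2 \<Longrightarrow> 1 \<le> Re s \<Longrightarrow> Re s \<le> 3 \<Longrightarrow> cmod ((deriv ^^ n) reg_zeta s) \<le> K * (1 + \<bar>Im s\<bar>) powr (41 / 40)"
proof -
  obtain K where K: "K > 0" 
    "\<And>s. 99 / 100 \<le> Re s \<Longrightarrow> Re s \<le> 4 \<Longrightarrow> cmod (reg_zeta s) \<le> K * (1 + \<bar>Im s\<bar>) powr (41 / 40)"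
    by (rule reg_zeta_bound_strip) blast
  show ?thesis
  \<comment> \<open>80000 is 2! * 4 * 100^2: Cauchy's estimate for the second derivative at radius
    1/100, where the factor 4 pays for replacing the height on the circle by the height of its
    centre.\<close>
  proof (rule that[of "80000 * K"])
    show "80000 * K > 0" using K by simp
    fix s and n :: nat assume s: "1 \<le> Re s" "Re s \<le> 3" and n: "n \<le> 2"
    let ?t = "1 + \<bar>Im s\<bar>"
    have sub: "cball s (1/100) \<subseteq> zeta_dom"
    proof
      fix w assume "w \<in> cball s (1/100)"
      then have "Re s - Re w \<le> 1/100" using complex_Re_le_cmod[of "s - w"] by (simp add: dist_norm)
      then show "w \<in> zeta_dom" using s by (simp add: zeta_dom_def)
    qed
    have "cmod ((deriv ^^ n) reg_zeta s) \<le> fact n * (4 * K * ?t powr (41/40)) / (1/100)^n"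
    proof (rule Cauchy_inequality)
      show "reg_zeta holomorphic_on ball s (1/100)"
        using holomorphic_reg_zeta sub by (meson ball_subset_cball holomorphic_on_subset order_trans)
      show "continuous_on (cball s (1/100)) reg_zeta"
        using holomorphic_on_imp_continuous_on[OF holomorphic_reg_zeta] sub continuous_on_subset by blast
      fix x assume x: "cmod (s - x) = 1/100"
      have r: "Re s - Re x \<le> 1/100" "Re x - Re s \<le> 1/100"
        using complex_Re_le_cmod[of "s - x"] complex_Re_le_cmod[of "x - s"] x by (simp_all add: norm_minus_commute)
      have i: "\<bar>Im (s - x)\<bar> \<le> 1/100" using abs_Im_le_cmod[of "s - x"] x by simp
      have "cmod (reg_zeta x) \<le> K * (1 + \<bar>Im x\<bar>) powr (41 / 40)"
        using r s by (intro K(2)) auto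
      also have "\<dots> \<le> K * (2 * ?t) powr (41/40)"
      proof (intro mult_left_mono powr_mono2)
        have "\<bar>Im x\<bar> \<le> \<bar>Im s\<bar> + \<bar>Im (s - x)\<bar>"
          using abs_triangle_ineq4[of "Im s" "Im (s - x)"] by simp
        moreover have "1 + a \<le> 2 * (1 + b)" if "a \<le> b + c" "c \<le> 1/100" "0 \<le> b" for a b c :: real
          using that by simp
        ultimately show "1 + \<bar>Im x\<bar> \<le> 2 * ?t" using i abs_ge_zero by blast
      qed (use K(1) in auto)
      also have "\<dots> = K * (2 powr (41/40) * ?t powr (41/40))" by (subst powr_mult) auto
      also have "\<dots> \<le> K * (2 powr 2 * ?t powr (41/40))"
        using K(1) by (intro mult_left_mono mult_right_mono powr_mono) auto
      finally show "cmod (reg_zeta x) \<le> 4 * K * ?t powr (41/40)" by simp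
    qed auto
    also have "\<dots> \<le> 80000 * K * ?t powr (41/40)"
    proof -
      have "n = 0 \<or> n = 1 \<or> n = 2" using n by auto
      then have "fact n * 4 / (1/100)^n \<le> (80000 :: real)" by (auto simp: power2_eq_square)
      then have "(fact n * 4 / (1/100)^n) * (K * ?t powr (41/40)) \<le> 80000 * (K * ?t powr (41/40))"
        using K(1) by (intro mult_right_mono) auto
      then show ?thesis by (simp add: mult_ac)
    qed
    finally show "cmod ((deriv ^^ n) reg_zeta s) \<le> 80000 * K * ?t powr (41/40)" .
  qed
qed

section \<open>Dirichlet series and Euler product of zeta for \<open>Re s > 1\<close>\<close>

lemma summable_norm_zeta: 
  assumes "1 < Re s"
  shows "summable (\<lambda>n. cmod (of_nat (Suc n) powr (- s)))"
  unfolding norm_of_nat_powr using assms by (intro summable_Suc_powr) auto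

lemma zeta_has_sum:
  assumes s: "1 < Re s"
  shows "((\<lambda>n. of_nat n powr (- s)) has_sum (reg_zeta s / (s - 1))) {0<..}"
proof -
  have "((\<lambda>n. of_nat (Suc n) powr (- s)) has_sum (reg_zeta s / (s - 1))) UNIV"
    by (rule norm_summable_imp_has_sum[OF summable_norm_zeta[OF s] zeta_sums[OF s]])
  then have "((\<lambda>n. of_nat n powr (- s)) has_sum (reg_zeta s / (s - 1))) (Suc ` UNIV)"
    by (subst has_sum_reindex) (auto simp: o_def)
  also have "Suc ` UNIV = {0<..}" by (auto simp: image_iff gr0_conv_Suc)
  finally show ?thesis .
qed

text \<open>The sieve of Eratosthenes: among the integers free of primes of \<open>S\<close>, the
  multiples of a further prime p form p times the same set, since distinct primes do not divide each
  other. Removing them subtracts p^(-s) times the sum, which multiplies it by the Euler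
  factor.\<close>

lemma zeta_sieve_has_sum:
  assumes s: "1 < Re s" and "finite S" "\<And>p. p \<in> S \<Longrightarrow> prime p"
  shows "((\<lambda>n. of_nat n powr (- s)) has_sum (reg_zeta s / (s - 1) * (\<Prod>p\<in>S. 1 - of_nat p powr (- s))))
           {n::nat. 0 < n \<and> (\<forall>p\<in>S. \<not> p dvd n)}"
  using assms(2,3)
proof (induction S rule: finite_induct)
  case empty
  then show ?case using zeta_has_sum[OF s] by (simp add: greaterThan_def)
next
  case (insert p S)
  let ?f = "\<lambda>n. complex_of_nat n powr (- s)"
  let ?A = "{n::nat. 0 < n \<and> (\<forall>q\<in>S. \<not> q dvd n)}"
  define a where "a = reg_zeta s / (s - 1) * (\<Prod>p\<in>S. 1 - of_nat p powr (- s))"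
  have p: "prime p" using insert by auto
  then have p0: "p > 0" by (simp add: prime_gt_0_nat)
  have A: "(?f has_sum a) ?A" unfolding a_def using insert by auto
  have "((\<lambda>n. ?f p * ?f n) has_sum (?f p * a)) ?A" by (rule has_sum_cmult_right[OF A])
  also have "(\<lambda>n. ?f p * ?f n) = ?f \<circ> (*) p" by (auto simp: fun_eq_iff powr_times_real)
  finally have "(?f has_sum (?f p * a)) ((*) p ` ?A)"
    using p0 by (subst has_sum_reindex) (auto intro!: inj_onI simp only: mult_left_cancel)
  moreover have "(*) p ` ?A \<subseteq> ?A"
  proof -
    have "\<not> q dvd p * n" if "q \<in> S" "\<not> q dvd n" for q n
      using that insert p by (metis insertCI primes_dvd_imp_eq prime_dvd_mult_iff)
    then show ?thesis using p0 by auto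
  qed
  ultimately have D: "(?f has_sum (a - ?f p * a)) (?A - (*) p ` ?A)" using A by (intro has_sum_Diff)
  have "?A - (*) p ` ?A = {n. 0 < n \<and> (\<forall>q\<in>insert p S. \<not> q dvd n)}"
  proof (intro equalityI subsetI)
    fix x assume x: "x \<in> ?A - (*) p ` ?A"
    have "\<not> p dvd x"
    proof
      assume "p dvd x"
      then obtain k where k: "x = p * k" by (rule dvdE)
      then have "k \<in> ?A" using x by (auto intro: dvd_mult)
      then show False using x k by blast
    qed
    then show "x \<in> {n. 0 < n \<and> (\<forall>q\<in>insert p S. \<not> q dvd n)}" using x by auto
  next
    fix x assume "x \<in> {n. 0 < n \<and> (\<forall>q\<in>insert p S. \<not> q dvd n)}"
    then show "x \<in> ?A - (*) p ` ?A" by auto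
  qed
  moreover have "a - ?f p * a = reg_zeta s / (s - 1) * (\<Prod>p\<in>insert p S. 1 - of_nat p powr (- s))"
    using insert.hyps by (simp add: a_def algebra_simps)
  ultimately show ?case using D by simp
qed

text \<open>The reciprocal of a partial Euler product, the form in which the sieve delivers it; no
  infinite product has to converge and nothing is divided.\<close>

definition euler_inv :: "nat \<Rightarrow> complex \<Rightarrow> complex" where
  "euler_inv N s = (\<Prod>p | prime p \<and> p \<le> N. 1 - of_nat p powr (- s))"

text \<open>Once all primes up to \<open>N\<close> are sieved out, the surviving integers are 1 and
  some integers beyond \<open>N\<close>, because any other survivor has a prime factor exceeding
  \<open>N\<close>. The difference from 1 is thus bounded by a tail of an absolutely convergent
  series.\<close>

lemma zeta_euler_tendsto:
  assumes s: "1 < Re s"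
  shows "(\<lambda>N. reg_zeta s / (s - 1) * euler_inv N s) \<longlonglongrightarrow> 1"
proof (rule tendsto_norm_zero_cancel[THEN LIM_zero_cancel], rule LIMSEQ_I)
  let ?f = "\<lambda>n. complex_of_nat n powr (- s)"
  fix e :: real assume e: "0 < e"
  obtain N0 where N0: "\<And>n. n \<ge> N0 \<Longrightarrow> norm (\<Sum>i. cmod (?f (Suc (i + n)))) < e"
    using suminf_exist_split[OF e summable_norm_zeta[OF s]] by auto
  have "norm (cmod (reg_zeta s / (s - 1) * euler_inv N s - 1) - 0) < e" if N: "N \<ge> N0" for N
  proof -
    define S where "S = {p::nat. prime p \<and> p \<le> N}"
    have fS: "finite S" unfolding S_def by simp
    let ?A = "{n::nat. 0 < n \<and> (\<forall>p\<in>S. \<not> p dvd n)}"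
    have "(?f has_sum (reg_zeta s / (s - 1) * euler_inv N s)) ?A"
      unfolding euler_inv_def S_def[symmetric] by (rule zeta_sieve_has_sum[OF s fS]) (auto simp: S_def)
    moreover have "(?f has_sum 1) {1}" using has_sum_finite[of "{1}" ?f] by simp
    moreover have "{1} \<subseteq> ?A" by (auto simp: S_def)
    ultimately have H: "(?f has_sum (reg_zeta s / (s - 1) * euler_inv N s - 1)) (?A - {1})" by (rule has_sum_Diff)
    have sub: "?A - {1} \<subseteq> (\<lambda>i. Suc (i + N)) ` UNIV"
    proof
      fix n assume n: "n \<in> ?A - {1}"
      then obtain p where p: "prime p" "p dvd n" using prime_factor_nat[of n] by auto
      then have "p \<notin> S" using n by auto
      then have "N < p" using p by (simp add: S_def)
      also have "p \<le> n" using p n by (intro dvd_imp_le) auto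
      finally have "n = Suc ((n - Suc N) + N)" by simp
      then show "n \<in> (\<lambda>i. Suc (i + N)) ` UNIV" by blast
    qed
    have sm: "summable (\<lambda>i. cmod (?f (Suc (i + N))))"
      using summable_norm_zeta[OF s] summable_iff_shift[of "\<lambda>n. cmod (?f (Suc n))" N] by simp
    have "((\<lambda>i. cmod (?f (Suc (i + N)))) has_sum (\<Sum>i. cmod (?f (Suc (i + N))))) UNIV"
      by (rule norm_summable_imp_has_sum) (use sm in \<open>simp_all add: summable_sums\<close>)
    then have T: "((\<lambda>n. cmod (?f n)) has_sum (\<Sum>i. cmod (?f (Suc (i + N))))) ((\<lambda>i. Suc (i + N)) ` UNIV)"
      by (subst has_sum_reindex) (auto simp: o_def inj_on_def)
    have S1: "(\<lambda>n. cmod (?f n)) summable_on (?A - {1})"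
      using T sub has_sum_imp_summable summable_on_subset_banach by blast
    have "cmod (reg_zeta s / (s - 1) * euler_inv N s - 1) = cmod (infsum ?f (?A - {1}))"
      using H by (simp add: infsumI)
    also have "\<dots> \<le> infsum (\<lambda>n. cmod (?f n)) (?A - {1})" by (rule norm_infsum_bound[OF S1])
    also have "\<dots> \<le> infsum (\<lambda>n. cmod (?f n)) ((\<lambda>i. Suc (i + N)) ` UNIV)"
      using S1 T sub by (intro infsum_mono_neutral) (auto simp: has_sum_imp_summable)
    also have "\<dots> = (\<Sum>i. cmod (?f (Suc (i + N))))" using T by (rule infsumI)
    also have "\<dots> < e" using N0[OF N] by simp
    finally show ?thesis by simp
  qed
  then show "\<exists>no. \<forall>n\<ge>no. norm (cmod (reg_zeta s / (s - 1) * euler_inv n s - 1) - 0) < e" by blast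
qed

section \<open>Nonvanishing and lower bounds for zeta up to the line \<open>Re s = 1\<close>\<close>

lemma reg_zeta_nonzero_right:
  assumes "1 < Re s"
  shows "reg_zeta s \<noteq> 0"
proof
  assume "reg_zeta s = 0"
  then have "(\<lambda>N::nat. 0::complex) \<longlonglongrightarrow> 1" using zeta_euler_tendsto[OF assms] by simp
  then show False by (simp add: LIMSEQ_const_iff)
qed

text \<open>Here \<open>r * z\<close> stands for p^(-s) with \<open>z\<close> = p^(-it). Logarithms
  turn the product into a series with terms \<open>- (r ^ n / n)\<close> times 3 + 4 c + cos of the
  double angle, where \<open>c = Re (z ^ n)\<close>, and that bracket is the perfect square
  \<open>2 * (1 + c)\<^sup>2\<close>.\<close>

lemma mertens_factor_le:
  assumes z: "cmod z = 1" and r: "0 \<le> r" "r < 1"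
  shows "cmod (1 - of_real r) ^ 3 * cmod (1 - of_real r * z) ^ 4 * cmod (1 - of_real r * z\<^sup>2) \<le> 1"
proof -
  \<comment> \<open>The series starts at \<open>n = 0\<close>, whose term is 0 because division by
    zero gives 0.\<close>
  have L: "(\<lambda>n. - Re (w ^ n) / real n) sums ln (cmod (1 - w))" if w: "cmod w < 1" for w
  proof -
    have "(\<lambda>n. - ((- (- w)) ^ n) / of_nat n) sums Ln (1 + (- w))" using w by (intro Ln_series') simp
    then have "(\<lambda>n. Re (- (w ^ n) / of_nat n)) sums Re (Ln (1 - w))" by (intro sums_Re) simp
    moreover have "1 - w \<noteq> 0" using w by auto
    ultimately show ?thesis by (simp add: Re_divide_of_nat)
  qed
  have n1: "cmod (of_real r) < 1" "cmod (of_real r * z) < 1" "cmod (of_real r * z\<^sup>2) < 1"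
    using r z by (simp_all add: norm_mult norm_power)
  then have nz: "1 - complex_of_real r \<noteq> 0" "1 - of_real r * z \<noteq> 0" "1 - of_real r * z\<^sup>2 \<noteq> 0"
    by (metis eq_iff_diff_eq_0 less_irrefl norm_one)+
  let ?u = "\<lambda>n. 3 * (- Re ((complex_of_real r) ^ n) / real n) + 4 * (- Re ((of_real r * z) ^ n) / real n) + (- Re ((of_real r * z\<^sup>2) ^ n) / real n)"
  have "?u sums (3 * ln (cmod (1 - of_real r)) + 4 * ln (cmod (1 - of_real r * z)) + ln (cmod (1 - of_real r * z\<^sup>2)))"
    using n1 by (intro sums_add sums_mult L)
  moreover have "?u n \<le> 0" for n
  proof -
    define c where "c = Re (z ^ n)"
    have "cmod (z ^ n) = 1" using z by (simp add: norm_power)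
    then have sq: "(Re (z ^ n))\<^sup>2 + (Im (z ^ n))\<^sup>2 = 1" by (simp add: cmod_power2[symmetric])
    have "Re ((z\<^sup>2) ^ n) = Re ((z ^ n)\<^sup>2)" by (simp add: power_mult[symmetric] mult.commute)
    also have "\<dots> = 2 * c\<^sup>2 - 1" using sq by (simp add: c_def power2_eq_square)
    finally have c2: "Re ((z\<^sup>2) ^ n) = 2 * c\<^sup>2 - 1" .
    have "?u n = - (r ^ n / real n) * (3 + 4 * c + (2 * c\<^sup>2 - 1))"
      by (simp add: power_mult_distrib c2 c_def[symmetric] of_real_power[symmetric] add_divide_distrib diff_divide_distrib algebra_simps del: of_real_power)
    also have "3 + 4 * c + (2 * c\<^sup>2 - 1) = 2 * (1 + c)\<^sup>2" by (simp add: power2_eq_square algebra_simps)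
    finally show ?thesis using r by simp
  qed
  ultimately have le: "3 * ln (cmod (1 - of_real r)) + 4 * ln (cmod (1 - of_real r * z)) + ln (cmod (1 - of_real r * z\<^sup>2)) \<le> 0"
    by (rule sums_le[OF _ _ sums_zero, rotated])
  have "ln (cmod (1 - of_real r) ^ 3 * cmod (1 - of_real r * z) ^ 4 * cmod (1 - of_real r * z\<^sup>2)) \<le> 0"
    using le nz by (simp add: ln_mult ln_realpow)
  then show ?thesis using nz by (subst (asm) ln_le_zero_iff) auto
qed

text \<open>The local inequality is multiplied over primes up to \<open>N\<close> and passed to the
  limit through the Euler product. The change from zeta to \<open>reg_zeta\<close> multiplies by
  powers of |s - 1|: the real point contributes \<open>(\<sigma> - 1) ^ 3\<close>, and the two
  others contribute 4 + 1 powers of |t|.\<close>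

lemma reg_zeta_341:
  assumes \<sigma>: "1 < \<sigma>"
  shows "(\<sigma> - 1) ^ 3 * \<bar>t\<bar> ^ 5 \<le> cmod (reg_zeta (of_real \<sigma>)) ^ 3 * cmod (reg_zeta (Complex \<sigma> t)) ^ 4 * cmod (reg_zeta (Complex \<sigma> (2 * t)))"
proof -
  define Z where "Z = (\<lambda>s. reg_zeta s / (s - 1))"
  define A where "A = (\<lambda>N. cmod (euler_inv N (of_real \<sigma>)) ^ 3 * cmod (euler_inv N (Complex \<sigma> t)) ^ 4 * cmod (euler_inv N (Complex \<sigma> (2 * t))))"
  have A1: "A N \<le> 1" for N
  proof -
    have "A N = (\<Prod>p | prime p \<and> p \<le> N. cmod (1 - of_nat p powr (- of_real \<sigma>)) ^ 3
        * cmod (1 - of_nat p powr (- Complex \<sigma> t)) ^ 4 * cmod (1 - of_nat p powr (- Complex \<sigma> (2 * t))))"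
      unfolding A_def euler_inv_def by (simp add: prod_norm[symmetric] prod.distrib prod_power_distrib)
    also have "\<dots> \<le> 1"
    proof (rule prod_le_1, safe)
      fix p :: nat assume p: "prime p"
      then have p1: "real p > 1" using prime_gt_1_nat[OF p] by simp
      define r where "r = real p powr (- \<sigma>)"
      define z where "z = complex_of_nat p powr (- (\<i> * of_real t))"
      have r: "0 \<le> r" "r < 1" using p1 \<sigma> unfolding r_def by (simp_all add: powr_less_one)
      have z: "cmod z = 1" unfolding z_def using p1 by (subst norm_powr_real_powr) auto
      have e0: "complex_of_nat p powr (- of_real \<sigma>) = of_real r"
        unfolding r_def using p1 by (simp add: powr_of_real[symmetric])
      have e1: "complex_of_nat p powr (- Complex \<sigma> t) = of_real r * z"
        unfolding e0[symmetric] z_def powr_add[symmetric] by (simp add: Complex_eq)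
      have e2: "complex_of_nat p powr (- Complex \<sigma> (2 * t)) = of_real r * z\<^sup>2"
        unfolding e0[symmetric] z_def power2_eq_square powr_add[symmetric] by (simp add: Complex_eq algebra_simps)
      show "cmod (1 - of_nat p powr (- of_real \<sigma>)) ^ 3
        * cmod (1 - of_nat p powr (- Complex \<sigma> t)) ^ 4 * cmod (1 - of_nat p powr (- Complex \<sigma> (2 * t))) \<le> 1"
        unfolding e0 e1 e2 by (rule mertens_factor_le[OF z r])
    qed auto
    finally show ?thesis .
  qed
  let ?B = "cmod (Z (of_real \<sigma>)) ^ 3 * cmod (Z (Complex \<sigma> t)) ^ 4 * cmod (Z (Complex \<sigma> (2 * t)))"
  have "(\<lambda>N. cmod (Z (of_real \<sigma>) * euler_inv N (of_real \<sigma>)) ^ 3 * cmod (Z (Complex \<sigma> t) * euler_inv N (Complex \<sigma> t)) ^ 4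
      * cmod (Z (Complex \<sigma> (2 * t)) * euler_inv N (Complex \<sigma> (2 * t)))) \<longlonglongrightarrow> cmod 1 ^ 3 * cmod 1 ^ 4 * cmod 1"
    unfolding Z_def using \<sigma> by (intro tendsto_intros zeta_euler_tendsto) auto
  also have "(\<lambda>N. cmod (Z (of_real \<sigma>) * euler_inv N (of_real \<sigma>)) ^ 3 * cmod (Z (Complex \<sigma> t) * euler_inv N (Complex \<sigma> t)) ^ 4
      * cmod (Z (Complex \<sigma> (2 * t)) * euler_inv N (Complex \<sigma> (2 * t)))) = (\<lambda>N. ?B * A N)"
    unfolding A_def by (simp add: norm_mult power_mult_distrib mult_ac)
  finally have "(\<lambda>N. ?B * A N) \<longlonglongrightarrow> 1" by simp
  moreover have "?B * A N \<le> ?B" for N using A1[of N] by (intro mult_left_le) auto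
  ultimately have B: "1 \<le> ?B" by (intro LIMSEQ_le_const2) auto
  let ?R = "cmod (reg_zeta (of_real \<sigma>)) ^ 3 * cmod (reg_zeta (Complex \<sigma> t)) ^ 4 * cmod (reg_zeta (Complex \<sigma> (2 * t)))"
  let ?D = "cmod (complex_of_real \<sigma> - 1) ^ 3 * cmod (Complex \<sigma> t - 1) ^ 4 * cmod (Complex \<sigma> (2 * t) - 1)"
  have BR: "?B = ?R / ?D" unfolding Z_def by (simp add: norm_divide power_divide)
  have "Complex \<sigma> t - 1 \<noteq> 0" "Complex \<sigma> (2 * t) - 1 \<noteq> 0" "complex_of_real \<sigma> - 1 \<noteq> 0"
    using \<sigma> by (auto simp: complex_eq_iff)
  then have D0: "0 < ?D" by (intro mult_pos_pos zero_less_power) auto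
  have "(\<sigma> - 1) ^ 3 * \<bar>t\<bar> ^ 4 * \<bar>t\<bar> \<le> ?D"
  proof (intro mult_mono power_mono)
    show "\<sigma> - 1 \<le> cmod (complex_of_real \<sigma> - 1)" using complex_Re_le_cmod[of "complex_of_real \<sigma> - 1"] by simp
    show "\<bar>t\<bar> \<le> cmod (Complex \<sigma> t - 1)" using abs_Im_le_cmod[of "Complex \<sigma> t - 1"] by simp
    show "\<bar>t\<bar> \<le> cmod (Complex \<sigma> (2 * t) - 1)" using abs_Im_le_cmod[of "Complex \<sigma> (2 * t) - 1"] by simp
  qed (use \<sigma> in auto)
  also have "?D \<le> ?R" using B D0 unfolding BR by (simp add: field_simps)
  also have "(\<sigma> - 1) ^ 3 * \<bar>t\<bar> ^ 4 * \<bar>t\<bar> = (\<sigma> - 1) ^ 3 * \<bar>t\<bar> ^ 5"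
    using power_Suc2[of "\<bar>t\<bar>" 4] by simp
  finally show ?thesis .
qed

lemma convex_Im_eq: "convex {s. Im s = t}"
proof -
  have "{s. Im s = t} = {s. Im s \<ge> t} \<inter> {s. Im s \<le> t}" by auto
  then show ?thesis by (simp add: convex_Int convex_halfspace_Im_ge convex_halfspace_Im_le)
qed

text \<open>One constant \<open>K \<ge> 1\<close> for all estimates, so that its powers can be
  merged. The last clause is the 3-4-1 inequality with the real point and the point of height
  \<open>2 * t\<close> estimated trivially, which leaves a lower bound at height
  \<open>t\<close>.\<close>

lemma reg_zeta_nice_bounds:
  obtains K where "K \<ge> 1"
    "\<And>s. 1 \<le> Re s \<Longrightarrow> Re s \<le> 3 \<Longrightarrow> cmod (reg_zeta s) \<le> K * (1 + \<bar>Im s\<bar>) powr (41 / 40)"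
    "\<And>s. 1 \<le> Re s \<Longrightarrow> Re s \<le> 3 \<Longrightarrow> cmod (deriv reg_zeta s) \<le> K * (1 + \<bar>Im s\<bar>) powr (41 / 40)"
    "\<And>s. 1 \<le> Re s \<Longrightarrow> Re s \<le> 3 \<Longrightarrow> cmod (deriv (deriv reg_zeta) s) \<le> K * (1 + \<bar>Im s\<bar>) powr (41 / 40)"
    "\<And>\<sigma> \<sigma>' t. 1 \<le> \<sigma> \<Longrightarrow> \<sigma> \<le> \<sigma>' \<Longrightarrow> \<sigma>' \<le> 3 \<Longrightarrow>
       cmod (reg_zeta (Complex \<sigma>' t) - reg_zeta (Complex \<sigma> t)) \<le> K * (1 + \<bar>t\<bar>) powr (41 / 40) * (\<sigma>' - \<sigma>)"
    "\<And>\<sigma> t. 1 < \<sigma> \<Longrightarrow> \<sigma> \<le> 3 \<Longrightarrow>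
       (\<sigma> - 1) ^ 3 * \<bar>t\<bar> ^ 5 \<le> K ^ 4 * (1 + 2 * \<bar>t\<bar>) powr (41 / 40) * cmod (reg_zeta (Complex \<sigma> t)) ^ 4"
proof -
  obtain K0 where K0: "K0 > 0"
    "\<And>s n. n \<le> 2 \<Longrightarrow> 1 \<le> Re s \<Longrightarrow> Re s \<le> 3 \<Longrightarrow> cmod ((deriv ^^ n) reg_zeta s) \<le> K0 * (1 + \<bar>Im s\<bar>) powr (41 / 40)"
    by (rule reg_zeta_deriv_bounds) blast
  define K where "K = max 1 K0"
  have K1: "K \<ge> 1" unfolding K_def by simp
  have B: "cmod ((deriv ^^ n) reg_zeta s) \<le> K * (1 + \<bar>Im s\<bar>) powr (41 / 40)"
    if "n \<le> 2" "1 \<le> Re s" "Re s \<le> 3" for n s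
  proof -
    have "K0 * (1 + \<bar>Im s\<bar>) powr (41 / 40) \<le> K * (1 + \<bar>Im s\<bar>) powr (41 / 40)"
      unfolding K_def by (intro mult_right_mono) auto
    then show ?thesis using K0(2)[OF that] by linarith
  qed
  have b0: "cmod (reg_zeta s) \<le> K * (1 + \<bar>Im s\<bar>) powr (41 / 40)" if "1 \<le> Re s" "Re s \<le> 3" for s
    using B[of 0 s] that by simp
  have b1: "cmod (deriv reg_zeta s) \<le> K * (1 + \<bar>Im s\<bar>) powr (41 / 40)" if "1 \<le> Re s" "Re s \<le> 3" for s
    using B[of 1 s] that by simp
  have b2: "cmod (deriv (deriv reg_zeta) s) \<le> K * (1 + \<bar>Im s\<bar>) powr (41 / 40)" if "1 \<le> Re s" "Re s \<le> 3" for s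
    using B[of 2 s] that by (simp add: numeral_2_eq_2)
  have lip: "cmod (reg_zeta (Complex \<sigma>' t) - reg_zeta (Complex \<sigma> t)) \<le> K * (1 + \<bar>t\<bar>) powr (41 / 40) * (\<sigma>' - \<sigma>)"
    if \<sigma>: "1 \<le> \<sigma>" "\<sigma> \<le> \<sigma>'" "\<sigma>' \<le> 3" for \<sigma> \<sigma>' t
  proof -
    let ?S = "{s. 1 \<le> Re s} \<inter> {s. Re s \<le> 3} \<inter> {s. Im s = t}"
    have "cmod (reg_zeta (Complex \<sigma>' t) - reg_zeta (Complex \<sigma> t)) \<le> K * (1 + \<bar>t\<bar>) powr (41 / 40) * cmod (Complex \<sigma>' t - Complex \<sigma> t)"
    proof (rule field_differentiable_bound[where S = ?S])
      show "convex ?S" by (intro convex_Int convex_halfspace_Re_ge convex_halfspace_Re_le convex_Im_eq)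
      show "(reg_zeta has_field_derivative deriv reg_zeta z) (at z within ?S)" if "z \<in> ?S" for z
        by (rule has_field_derivative_at_within, rule holomorphic_derivI[OF holomorphic_reg_zeta open_zeta_dom])
           (use that in \<open>simp add: zeta_dom_def\<close>)
      show "cmod (deriv reg_zeta z) \<le> K * (1 + \<bar>t\<bar>) powr (41 / 40)" if "z \<in> ?S" for z
        using b1[of z] that by simp
    qed (use \<sigma> in auto)
    also have "Complex \<sigma>' t - Complex \<sigma> t = of_real (\<sigma>' - \<sigma>)" by (simp add: complex_eq_iff)
    also have "cmod (of_real (\<sigma>' - \<sigma>)) = \<sigma>' - \<sigma>" using \<sigma> by (simp add: norm_of_real del: of_real_diff)
    finally show ?thesis .
  qed
  have low: "(\<sigma> - 1) ^ 3 * \<bar>t\<bar> ^ 5 \<le> K ^ 4 * (1 + 2 * \<bar>t\<bar>) powr (41 / 40) * cmod (reg_zeta (Complex \<sigma> t)) ^ 4"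
    if \<sigma>: "1 < \<sigma>" "\<sigma> \<le> 3" for \<sigma> t
  proof -
    have "(\<sigma> - 1) ^ 3 * \<bar>t\<bar> ^ 5 \<le> cmod (reg_zeta (of_real \<sigma>)) ^ 3 * cmod (reg_zeta (Complex \<sigma> t)) ^ 4 * cmod (reg_zeta (Complex \<sigma> (2 * t)))"
      by (rule reg_zeta_341[OF \<sigma>(1)])
    also have "\<dots> \<le> K ^ 3 * cmod (reg_zeta (Complex \<sigma> t)) ^ 4 * (K * (1 + 2 * \<bar>t\<bar>) powr (41 / 40))"
    proof (intro mult_mono power_mono order_refl)
      show "cmod (reg_zeta (of_real \<sigma>)) \<le> K" using b0[of "of_real \<sigma>"] \<sigma> by simp
      show "cmod (reg_zeta (Complex \<sigma> (2 * t))) \<le> K * (1 + 2 * \<bar>t\<bar>) powr (41 / 40)"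
        using b0[of "Complex \<sigma> (2 * t)"] \<sigma> by (simp add: abs_mult)
    qed (use K1 in auto)
    also have "\<dots> = K ^ 4 * (1 + 2 * \<bar>t\<bar>) powr (41 / 40) * cmod (reg_zeta (Complex \<sigma> t)) ^ 4"
      using power_Suc2[of K 3] by simp
    finally show ?thesis .
  qed
  show ?thesis using that[of K] K1 b0 b1 b2 lip low by blast
qed

text \<open>A zero at \<open>1 + it\<close> would make the modulus at \<open>1 + h + it\<close> at
  most \<open>D * h\<close>. Its fourth power is of order \<open>h ^ 4\<close>, too small against
  the \<open>h ^ 3\<close> of the 3-4-1 inequality.\<close>

lemma reg_zeta_nonzero:
  assumes "1 \<le> Re s"
  shows "reg_zeta s \<noteq> 0"
proof (cases "1 < Re s")
  case True then show ?thesis by (rule reg_zeta_nonzero_right)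
next
  case False
  then have r: "Re s = 1" using assms by simp
  define t where "t = Im s"
  have s: "s = Complex 1 t" using r by (simp add: t_def complex_eq_iff)
  show ?thesis
  proof (cases "t = 0")
    case True
    then have "s = 1" using s by (simp add: complex_eq_iff)
    then show ?thesis by (simp add: reg_zeta_1)
  next
    case t0: False
    show ?thesis
    proof
      assume z: "reg_zeta s = 0"
      obtain K where K: "K \<ge> 1"
       "\<And>\<sigma> \<sigma>' t. 1 \<le> \<sigma> \<Longrightarrow> \<sigma> \<le> \<sigma>' \<Longrightarrow> \<sigma>' \<le> 3 \<Longrightarrow>
         cmod (reg_zeta (Complex \<sigma>' t) - reg_zeta (Complex \<sigma> t)) \<le> K * (1 + \<bar>t\<bar>) powr (41 / 40) * (\<sigma>' - \<sigma>)"
       "\<And>\<sigma> t. 1 < \<sigma> \<Longrightarrow> \<sigma> \<le> 3 \<Longrightarrow>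
         (\<sigma> - 1) ^ 3 * \<bar>t\<bar> ^ 5 \<le> K ^ 4 * (1 + 2 * \<bar>t\<bar>) powr (41 / 40) * cmod (reg_zeta (Complex \<sigma> t)) ^ 4"
        by (rule reg_zeta_nice_bounds) blast
      define D where "D = K * (1 + \<bar>t\<bar>) powr (41 / 40)"
      define E where "E = K ^ 4 * (1 + 2 * \<bar>t\<bar>) powr (41 / 40) * D ^ 4"
      have D: "0 < D" unfolding D_def using K(1) by simp
      then have E: "0 < E" unfolding E_def using K(1) by simp
      \<comment> \<open>Small enough that \<open>E * h\<close> is at most half of
        \<open>\<bar>t\<bar> ^ 5\<close>, which it would have to exceed.\<close>
      define h where "h = min 1 (\<bar>t\<bar> ^ 5 / (2 * E))"
      have h: "0 < h" "h \<le> 1" "h \<le> \<bar>t\<bar> ^ 5 / (2 * E)" unfolding h_def using t0 E by auto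
      have u: "cmod (reg_zeta (Complex (1 + h) t)) \<le> D * h"
        using K(2)[of 1 "1 + h" t] h z unfolding s D_def by simp
      have "h ^ 3 * \<bar>t\<bar> ^ 5 \<le> K ^ 4 * (1 + 2 * \<bar>t\<bar>) powr (41 / 40) * cmod (reg_zeta (Complex (1 + h) t)) ^ 4"
        using K(3)[of "1 + h" t] h by simp
      also have "\<dots> \<le> K ^ 4 * (1 + 2 * \<bar>t\<bar>) powr (41 / 40) * (D * h) ^ 4"
        using u K(1) by (intro mult_left_mono power_mono) auto
      also have "\<dots> = h ^ 3 * (E * h)" unfolding E_def by (simp add: power_mult_distrib eval_nat_numeral)
      finally have "\<bar>t\<bar> ^ 5 \<le> E * h" using h by simp
      also have "\<dots> \<le> E * (\<bar>t\<bar> ^ 5 / (2 * E))" using h E by (intro mult_left_mono) auto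
      also have "\<dots> = \<bar>t\<bar> ^ 5 / 2" using E by simp
      finally show False using t0 by simp
    qed
  qed
qed

text \<open>The 3-4-1 inequality is applied at abscissa \<open>\<sigma> + h\<close> and the result
  carried back to \<open>\<sigma>\<close> by the Lipschitz bound. With \<open>h\<close> of order
  T^(-1/8) the gain has exponent (5 - 3/8 - 41/40) / 4 and the loss 41/40 - 1/8, both equal to 9/10,
  so uniformity as \<open>\<sigma>\<close> tends to 1 costs nothing.\<close>

lemma reg_zeta_lower_bound:
  obtains c where "c > 0"
    "\<And>\<sigma> t. 1 < \<sigma> \<Longrightarrow> \<sigma> \<le> 2 \<Longrightarrow> 1 \<le> \<bar>t\<bar> \<Longrightarrow> c * \<bar>t\<bar> powr (9 / 10) \<le> cmod (reg_zeta (Complex \<sigma> t))"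
proof -
  obtain K where K: "K \<ge> 1"
   "\<And>\<sigma> \<sigma>' t. 1 \<le> \<sigma> \<Longrightarrow> \<sigma> \<le> \<sigma>' \<Longrightarrow> \<sigma>' \<le> 3 \<Longrightarrow>
     cmod (reg_zeta (Complex \<sigma>' t) - reg_zeta (Complex \<sigma> t)) \<le> K * (1 + \<bar>t\<bar>) powr (41 / 40) * (\<sigma>' - \<sigma>)"
   "\<And>\<sigma> t. 1 < \<sigma> \<Longrightarrow> \<sigma> \<le> 3 \<Longrightarrow>
     (\<sigma> - 1) ^ 3 * \<bar>t\<bar> ^ 5 \<le> K ^ 4 * (1 + 2 * \<bar>t\<bar>) powr (41 / 40) * cmod (reg_zeta (Complex \<sigma> t)) ^ 4"
    by (rule reg_zeta_nice_bounds) blast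
  \<comment> \<open>Since the exponents of gain and loss agree, constants must decide: the gain is
    \<open>b ^ 3 / (2 * K)\<close>, the loss \<open>4 * K * b ^ 4\<close>, and this \<open>b\<close>
    makes the loss exactly half of the gain.\<close>
  define b where "b = 1 / (16 * K\<^sup>2)"
  have K2: "1 \<le> K\<^sup>2" using K(1) by simp
  then have "1 \<le> 16 * K\<^sup>2" by linarith
  then have "1 / (16 * K\<^sup>2) \<le> 1 / 1" by (intro divide_left_mono) auto
  then have b: "0 < b" "b \<le> 1" unfolding b_def using K(1) by auto
  show ?thesis
  proof (rule that[of "b ^ 3 / (4 * K)"])
    show "0 < b ^ 3 / (4 * K)" using b K(1) by simp
    fix \<sigma> t :: real assume \<sigma>: "1 < \<sigma>" "\<sigma> \<le> 2" and t: "1 \<le> \<bar>t\<bar>"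
    define T where "T = \<bar>t\<bar>"
    have T: "1 \<le> T" using t by (simp add: T_def)
    define h where "h = b ^ 4 * T powr (- 1 / 8)"
    have "T powr (- 1 / 8) \<le> T powr 0" using T by (intro powr_mono) auto
    then have "h \<le> 1 * 1" unfolding h_def using b T by (intro mult_mono power_le_one) auto
    then have h: "0 < h" "h \<le> 1" unfolding h_def using b T by auto
    define X where "X = cmod (reg_zeta (Complex (\<sigma> + h) t))"
    have "h ^ 3 * T ^ 5 \<le> (\<sigma> + h - 1) ^ 3 * T ^ 5"
      using h \<sigma> T by (intro mult_right_mono power_mono) auto
    also have "\<dots> \<le> K ^ 4 * (1 + 2 * T) powr (41 / 40) * X ^ 4"
      using K(3)[of "\<sigma> + h" t] \<sigma> h unfolding X_def T_def by simp
    also have "\<dots> \<le> K ^ 4 * (9 * T powr (41 / 40)) * X ^ 4"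
    proof (intro mult_right_mono mult_left_mono)
      have "(1 + 2 * T) powr (41 / 40) \<le> (3 * T) powr (41 / 40)" using T by (intro powr_mono2) auto
      also have "\<dots> = 3 powr (41 / 40) * T powr (41 / 40)" using T by (subst powr_mult) auto
      also have "\<dots> \<le> 3 powr 2 * T powr (41 / 40)" by (intro mult_right_mono powr_mono) auto
      finally show "(1 + 2 * T) powr (41 / 40) \<le> 9 * T powr (41 / 40)" by simp
    qed (use K in \<open>auto simp: X_def\<close>)
    finally have 1: "h ^ 3 * T ^ 5 \<le> 9 * K ^ 4 * X ^ 4 * T powr (41 / 40)" by (simp add: mult_ac)
    have "h ^ 3 * T ^ 5 = b ^ 12 * (T powr (- 3 / 8) * T powr 5)"
      unfolding h_def using T by (simp add: power_mult_distrib power_mult[symmetric] powr_power powr_realpow mult_ac)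
    also have "T powr (- 3 / 8) * T powr 5 = (T powr (9 / 10)) ^ 4 * T powr (41 / 40)"
      using T by (simp add: powr_power powr_add[symmetric] del: powr_numeral)
    finally have "b ^ 12 * (T powr (9 / 10)) ^ 4 * T powr (41 / 40) \<le> 9 * K ^ 4 * X ^ 4 * T powr (41 / 40)"
      using 1 by (simp only: mult.assoc)
    then have 2: "b ^ 12 * (T powr (9 / 10)) ^ 4 \<le> 9 * K ^ 4 * X ^ 4" using T by simp
    have "(b ^ 3 * T powr (9 / 10)) ^ 4 = b ^ 12 * (T powr (9 / 10)) ^ 4"
      by (simp add: power_mult_distrib power_mult[symmetric])
    also have "\<dots> \<le> 16 * (K ^ 4 * X ^ 4)" using 2 by (rule order_trans) (use K in simp)
    also have "\<dots> = (2 * K * X) ^ 4" by (simp add: power_mult_distrib)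
    finally have "b ^ 3 * T powr (9 / 10) \<le> 2 * K * X"
      by (subst (asm) power_mono_iff) (use K b in \<open>auto simp: X_def\<close>)
    then have X: "b ^ 3 / (2 * K) * T powr (9 / 10) \<le> X" using K(1) by (simp add: field_simps)
    have "cmod (reg_zeta (Complex (\<sigma> + h) t) - reg_zeta (Complex \<sigma> t)) \<le> K * (1 + T) powr (41 / 40) * h"
      using K(2)[of \<sigma> "\<sigma> + h" t] \<sigma> h unfolding T_def by simp
    also have "\<dots> \<le> K * (4 * T powr (41 / 40)) * h"
    proof (intro mult_right_mono mult_left_mono)
      have "(1 + T) powr (41 / 40) \<le> (2 * T) powr (41 / 40)" using T by (intro powr_mono2) auto
      also have "\<dots> = 2 powr (41 / 40) * T powr (41 / 40)" using T by (subst powr_mult) auto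
      also have "\<dots> \<le> 2 powr 2 * T powr (41 / 40)" by (intro mult_right_mono powr_mono) auto
      finally show "(1 + T) powr (41 / 40) \<le> 4 * T powr (41 / 40)" by simp
    qed (use K h in auto)
    also have "\<dots> = 4 * K * b ^ 4 * (T powr (41 / 40) * T powr (- 1 / 8))" unfolding h_def by simp
    also have "T powr (41 / 40) * T powr (- 1 / 8) = T powr (9 / 10)" by (simp add: powr_add[symmetric])
    also have "4 * K * b ^ 4 = b ^ 3 / (4 * K)"
      using K(1) unfolding b_def by (simp add: field_simps eval_nat_numeral)
    finally have Y: "cmod (reg_zeta (Complex (\<sigma> + h) t) - reg_zeta (Complex \<sigma> t)) \<le> b ^ 3 / (4 * K) * T powr (9 / 10)" .
    have "X \<le> cmod (reg_zeta (Complex (\<sigma> + h) t) - reg_zeta (Complex \<sigma> t)) + cmod (reg_zeta (Complex \<sigma> t))"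
      unfolding X_def using norm_triangle_ineq[of "reg_zeta (Complex (\<sigma> + h) t) - reg_zeta (Complex \<sigma> t)" "reg_zeta (Complex \<sigma> t)"] by simp
    then have "b ^ 3 / (2 * K) * T powr (9 / 10) \<le> b ^ 3 / (4 * K) * T powr (9 / 10) + cmod (reg_zeta (Complex \<sigma> t))"
      using X Y by linarith
    moreover have "b ^ 3 / (2 * K) * T powr (9 / 10) = 2 * (b ^ 3 / (4 * K) * T powr (9 / 10))" by simp
    ultimately have "b ^ 3 / (4 * K) * T powr (9 / 10) \<le> cmod (reg_zeta (Complex \<sigma> t))" by linarith
    then show "b ^ 3 / (4 * K) * \<bar>t\<bar> powr (9 / 10) \<le> cmod (reg_zeta (Complex \<sigma> t))" unfolding T_def .
  qed
qed

text \<open>This is \<open>-\<zeta>'/(s \<zeta>) - 1/(s - 1)\<close>; in terms of \<open>reg_zeta\<close> the pole at \<open>s = 1\<close> has cancelled.\<close>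
definition psi_transform :: "complex \<Rightarrow> complex" where
  "psi_transform s = - (1 + deriv reg_zeta s / reg_zeta s) / s"

section \<open>Size and variation of the transform along vertical lines\<close>

definition decay :: "real \<Rightarrow> real" where
  "decay t = (if \<bar>t\<bar> \<le> 1 then 1 else \<bar>t\<bar> powr (- 3 / 4))"

lemma psi_transform_has_deriv:
  assumes "1 \<le> Re s"
  shows "(psi_transform has_field_derivative
     (1 + deriv reg_zeta s / reg_zeta s) / s\<^sup>2
      - (deriv (deriv reg_zeta) s / reg_zeta s - (deriv reg_zeta s / reg_zeta s)\<^sup>2) / s) (at s)"
proof -
  have dom: "s \<in> zeta_dom" using assms by (simp add: zeta_dom_def)
  have nz: "reg_zeta s \<noteq> 0" "s \<noteq> 0" using reg_zeta_nonzero[OF assms] assms by auto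
  have "(reg_zeta has_field_derivative deriv reg_zeta s) (at s)"
    by (rule holomorphic_derivI[OF holomorphic_reg_zeta open_zeta_dom dom])
  moreover have "(deriv reg_zeta has_field_derivative deriv (deriv reg_zeta) s) (at s)"
    by (rule holomorphic_derivI[OF holomorphic_deriv[OF holomorphic_reg_zeta open_zeta_dom] open_zeta_dom dom])
  ultimately show ?thesis unfolding psi_transform_def using nz
    by (auto intro!: derivative_eq_intros simp: field_simps power2_eq_square)
qed

text \<open>Up to height 1 the bound is compactness of a closed box that includes
  \<open>Re s = 1\<close>, which is where nonvanishing on that line is used. Above, first and second
  derivative divided by \<open>reg_zeta\<close> cost at most |t|^(1/8), as 41/40 - 9/10 =
  1/8.\<close>

lemma psi_transform_deriv_bound:
  obtains C where "C > 0"
    "\<And>s. 1 < Re s \<Longrightarrow> Re s \<le> 2 \<Longrightarrow> cmod (deriv psi_transform s) \<le> C * decay (Im s)"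
proof -
  obtain K where K: "K \<ge> 1"
    "\<And>s. 1 \<le> Re s \<Longrightarrow> Re s \<le> 3 \<Longrightarrow> cmod (deriv reg_zeta s) \<le> K * (1 + \<bar>Im s\<bar>) powr (41 / 40)"
    "\<And>s. 1 \<le> Re s \<Longrightarrow> Re s \<le> 3 \<Longrightarrow> cmod (deriv (deriv reg_zeta) s) \<le> K * (1 + \<bar>Im s\<bar>) powr (41 / 40)"
    by (rule reg_zeta_nice_bounds) blast
  obtain c where c: "c > 0"
    "\<And>\<sigma> t. 1 < \<sigma> \<Longrightarrow> \<sigma> \<le> 2 \<Longrightarrow> 1 \<le> \<bar>t\<bar> \<Longrightarrow> c * \<bar>t\<bar> powr (9 / 10) \<le> cmod (reg_zeta (Complex \<sigma> t))"
    by (rule reg_zeta_lower_bound) blast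
  define q where "q = 4 * K / c"
  have q: "q > 0" unfolding q_def using K c by simp
  let ?D = "\<lambda>s. (1 + deriv reg_zeta s / reg_zeta s) / s\<^sup>2
      - (deriv (deriv reg_zeta) s / reg_zeta s - (deriv reg_zeta s / reg_zeta s)\<^sup>2) / s"
  have D: "deriv psi_transform s = ?D s" if "1 \<le> Re s" for s
    by (rule DERIV_imp_deriv[OF psi_transform_has_deriv[OF that]])
  have "compact (cbox (Complex 1 (-1)) (Complex 2 1))" by simp
  moreover have "continuous_on (cbox (Complex 1 (-1)) (Complex 2 1)) ?D"
  proof -
    have sub: "cbox (Complex 1 (-1)) (Complex 2 1) \<subseteq> zeta_dom"
      by (auto simp: in_cbox_complex_iff zeta_dom_def)
    have h0: "continuous_on (cbox (Complex 1 (-1)) (Complex 2 1)) reg_zeta"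
      using holomorphic_on_imp_continuous_on[OF holomorphic_reg_zeta] sub continuous_on_subset by blast
    have h1: "continuous_on (cbox (Complex 1 (-1)) (Complex 2 1)) (deriv reg_zeta)"
      using holomorphic_on_imp_continuous_on[OF holomorphic_deriv[OF holomorphic_reg_zeta open_zeta_dom]] sub continuous_on_subset by blast
    have h2: "continuous_on (cbox (Complex 1 (-1)) (Complex 2 1)) (deriv (deriv reg_zeta))"
      using holomorphic_on_imp_continuous_on[OF holomorphic_deriv[OF holomorphic_deriv[OF holomorphic_reg_zeta open_zeta_dom] open_zeta_dom]] sub continuous_on_subset by blast
    have "reg_zeta s \<noteq> 0" "s \<noteq> 0" if "s \<in> cbox (Complex 1 (-1)) (Complex 2 1)" for s
      using that reg_zeta_nonzero[of s] by (auto simp: in_cbox_complex_iff)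
    then show ?thesis by (intro continuous_intros h0 h1 h2) auto
  qed
  ultimately have "bounded (?D ` cbox (Complex 1 (-1)) (Complex 2 1))"
    by (intro compact_imp_bounded compact_continuous_image)
  then obtain B where B: "B > 0" "\<And>s. s \<in> cbox (Complex 1 (-1)) (Complex 2 1) \<Longrightarrow> cmod (?D s) \<le> B"
    by (auto simp: bounded_pos)
  \<comment> \<open>\<open>B\<close> serves the low heights; the bracket is
    \<open>(1 + q) + (q + q\<^sup>2)\<close>, the two parts of the derivative at large
    height.\<close>
  define C where "C = B + (1 + 2 * q + q\<^sup>2)"
  show ?thesis
  proof (rule that[of C])
    show "C > 0" unfolding C_def using B q by (simp add: add_pos_pos)
    fix s assume s: "1 < Re s" "Re s \<le> 2"
    show "cmod (deriv psi_transform s) \<le> C * decay (Im s)"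
    proof (cases "\<bar>Im s\<bar> \<le> 1")
      case True
      then have "cmod (?D s) \<le> B" using s by (intro B) (auto simp: in_cbox_complex_iff)
      also have "B \<le> C" unfolding C_def using q by simp
      finally show ?thesis using True D[of s] s by (simp add: decay_def)
    next
      case False
      define T where "T = \<bar>Im s\<bar>"
      have T: "1 < T" using False by (simp add: T_def)
      have r: "x / cmod (reg_zeta s) \<le> q * T powr (1 / 8)"
        if x: "x \<le> K * (1 + T) powr (41 / 40)" "0 \<le> x" for x
      proof -
        have "(1 + T) powr (41 / 40) \<le> (2 * T) powr (41 / 40)" using T by (intro powr_mono2) auto
        also have "\<dots> = 2 powr (41 / 40) * T powr (41 / 40)" using T by (subst powr_mult) auto
        also have "\<dots> \<le> 2 powr 2 * T powr (41 / 40)" by (intro mult_right_mono powr_mono) auto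
        finally have "K * (1 + T) powr (41 / 40) \<le> K * (4 * T powr (41 / 40))" using K(1) by (intro mult_left_mono) auto
        then have x2: "x \<le> 4 * K * T powr (41 / 40)" using x by simp
        have l: "c * T powr (9 / 10) \<le> cmod (reg_zeta s)" using c(2)[of "Re s" "Im s"] s T by (simp add: T_def)
        have "x / cmod (reg_zeta s) \<le> (4 * K * T powr (41 / 40)) / (c * T powr (9 / 10))"
          using x x2 l c(1) T by (intro frac_le) auto
        also have "\<dots> = q * (T powr (41 / 40) / T powr (9 / 10))" unfolding q_def by simp
        also have "T powr (41 / 40) / T powr (9 / 10) = T powr (1 / 8)" by (simp add: powr_diff[symmetric])
        finally show ?thesis .
      qed
      have r1: "cmod (deriv reg_zeta s / reg_zeta s) \<le> q * T powr (1 / 8)"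
        unfolding norm_divide using K(2)[of s] s by (intro r) (auto simp: T_def)
      have r2: "cmod (deriv (deriv reg_zeta) s / reg_zeta s) \<le> q * T powr (1 / 8)"
        unfolding norm_divide using K(3)[of s] s by (intro r) (auto simp: T_def)
      have sT: "T \<le> cmod s" unfolding T_def by (rule abs_Im_le_cmod)
      have e: "T powr a \<le> T powr (1 / 4)" if "a \<le> 1 / 4" for a using T that by (intro powr_mono) auto
      have p1: "1 \<le> T powr (1 / 4)" using e[of 0] T by simp
      have A1: "cmod ((1 + deriv reg_zeta s / reg_zeta s) / s\<^sup>2) \<le> (1 + q) * T powr (1 / 4) / T"
      proof -
        have "cmod (1 + deriv reg_zeta s / reg_zeta s) \<le> 1 + q * T powr (1 / 8)"
          using norm_triangle_ineq[of 1 "deriv reg_zeta s / reg_zeta s"] r1 by simp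
        also have "\<dots> \<le> T powr (1 / 4) + q * T powr (1 / 4)"
          using p1 e[of "1/8"] q by (intro add_mono mult_left_mono) auto
        finally have n: "cmod (1 + deriv reg_zeta s / reg_zeta s) \<le> (1 + q) * T powr (1 / 4)" by (simp add: algebra_simps)
        have "T * 1 \<le> cmod s * cmod s" using sT T by (intro mult_mono) auto
        then show ?thesis unfolding norm_divide
          using n T q by (intro frac_le) (auto simp: norm_mult power2_eq_square)
      qed
      have A2: "cmod ((deriv (deriv reg_zeta) s / reg_zeta s - (deriv reg_zeta s / reg_zeta s)\<^sup>2) / s) \<le> (q + q\<^sup>2) * T powr (1 / 4) / T"
      proof -
        have "cmod (deriv (deriv reg_zeta) s / reg_zeta s - (deriv reg_zeta s / reg_zeta s)\<^sup>2)
            \<le> cmod (deriv (deriv reg_zeta) s / reg_zeta s) + (cmod (deriv reg_zeta s / reg_zeta s))\<^sup>2"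
          using norm_triangle_ineq4 by (metis norm_power)
        also have "\<dots> \<le> q * T powr (1 / 8) + (q * T powr (1 / 8))\<^sup>2"
          by (intro add_mono r2 power_mono r1) auto
        also have "(q * T powr (1 / 8))\<^sup>2 = q\<^sup>2 * T powr (1 / 4)"
          using T by (simp add: power_mult_distrib powr_power)
        also have "q * T powr (1 / 8) + q\<^sup>2 * T powr (1 / 4) \<le> q * T powr (1 / 4) + q\<^sup>2 * T powr (1 / 4)"
          using e[of "1/8"] q by (intro add_mono mult_left_mono) auto
        finally show ?thesis unfolding norm_divide[of _ s]
          using sT T q by (intro frac_le) (auto simp: algebra_simps)
      qed
      have "cmod (?D s) \<le> (1 + q) * T powr (1 / 4) / T + (q + q\<^sup>2) * T powr (1 / 4) / T"
        using norm_triangle_ineq4 A1 A2 by (meson add_mono order_trans)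
      also have "\<dots> = (1 + 2 * q + q\<^sup>2) * (T powr (1 / 4) / T powr 1)" using T by (simp add: field_simps)
      also have "T powr (1 / 4) / T powr 1 = T powr (- 3 / 4)" unfolding powr_diff[symmetric] by simp
      also have "(1 + 2 * q + q\<^sup>2) * T powr (- 3 / 4) \<le> C * T powr (- 3 / 4)"
        unfolding C_def using B by (intro mult_right_mono) auto
      finally show ?thesis using False D[of s] s by (simp add: decay_def T_def)
    qed
  qed
qed

text \<open>The constant does not degenerate as \<open>\<sigma>\<close> tends to 1; this is what
  allows the damping parameter of \<open>psi_wave\<close> to tend to 0.\<close>

lemma psi_transform_lipschitz:
  obtains C where "C > 0"
    "\<And>\<sigma> \<sigma>' t. 1 < \<sigma> \<Longrightarrow> \<sigma> \<le> \<sigma>' \<Longrightarrow> \<sigma>' \<le> 2 \<Longrightarrow>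
      cmod (psi_transform (Complex \<sigma> t) - psi_transform (Complex \<sigma>' t)) \<le> C * decay t * (\<sigma>' - \<sigma>)"
proof -
  obtain C where C: "C > 0"
    "\<And>s. 1 < Re s \<Longrightarrow> Re s \<le> 2 \<Longrightarrow> cmod (deriv psi_transform s) \<le> C * decay (Im s)"
    by (rule psi_transform_deriv_bound) blast
  show ?thesis
  proof (rule that[OF C(1)])
    fix \<sigma> \<sigma>' t :: real assume \<sigma>: "1 < \<sigma>" "\<sigma> \<le> \<sigma>'" "\<sigma>' \<le> 2"
    let ?S = "{s. 1 < Re s} \<inter> {s. Re s \<le> 2} \<inter> {s. Im s = t}"
    have "cmod (psi_transform (Complex \<sigma> t) - psi_transform (Complex \<sigma>' t)) \<le> C * decay t * cmod (Complex \<sigma> t - Complex \<sigma>' t)"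
    proof (rule field_differentiable_bound[where S = ?S])
      show "convex ?S" by (intro convex_Int convex_halfspace_Re_gt convex_halfspace_Re_le convex_Im_eq)
      show "(psi_transform has_field_derivative deriv psi_transform z) (at z within ?S)" if "z \<in> ?S" for z
        using psi_transform_has_deriv[of z] that
        by (metis (no_types, lifting) DERIV_imp_deriv IntD1 has_field_derivative_at_within less_imp_le mem_Collect_eq)
      show "cmod (deriv psi_transform z) \<le> C * decay t" if "z \<in> ?S" for z
        using C(2)[of z] that by simp
    qed (use \<sigma> in auto)
    also have "Complex \<sigma> t - Complex \<sigma>' t = of_real (\<sigma> - \<sigma>')" by (simp add: complex_eq_iff)
    also have "cmod (of_real (\<sigma> - \<sigma>')) = \<sigma>' - \<sigma>" using \<sigma> by (simp add: norm_of_real del: of_real_diff)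
    finally show "cmod (psi_transform (Complex \<sigma> t) - psi_transform (Complex \<sigma>' t)) \<le> C * decay t * (\<sigma>' - \<sigma>)" .
  qed
qed

section \<open>Chebyshev's function\<close>

definition upto_real :: "real \<Rightarrow> nat set" where
  "upto_real x = {n. 0 < n \<and> real n \<le> x}"

lemma upto_real_eq: "upto_real x = {1..nat \<lfloor>x\<rfloor>}"
  unfolding upto_real_def by (auto simp: le_nat_floor le_floor_iff nat_floor_neg) linarith+

lemma finite_upto_real [simp]: "finite (upto_real x)"
  by (simp add: upto_real_eq)

definition psi :: "real \<Rightarrow> real" where
  "psi x = (\<Sum>n\<in>upto_real x. mangoldt n)"

section \<open>Chebyshev's upper bound for \<open>psi\<close>\<close>

lemma ln_real_nat_nonneg: "0 \<le> ln (real k)"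
  by (cases k) auto

lemma mangoldt_real_nonneg: "0 \<le> (mangoldt n :: real)"
  by (simp add: mangoldt_def ln_real_nat_nonneg)

lemma mangoldt_real_le_ln: "0 < n \<Longrightarrow> (mangoldt n :: real) \<le> ln (real n)"
proof -
  assume n: "0 < n"
  have "(mangoldt n :: real) \<le> (\<Sum>d | d dvd n. mangoldt d)"
    using n by (intro member_le_sum) (auto simp: mangoldt_real_nonneg)
  also have "\<dots> = ln (real n)" using mangoldt_sum[of n, where ?'a = real] n by simp
  finally show ?thesis .
qed

lemma psi_mono: "x \<le> y \<Longrightarrow> psi x \<le> psi y"
  unfolding psi_def by (intro sum_mono2 finite_upto_real mangoldt_real_nonneg) (auto simp: upto_real_def)

lemma psi_nonneg: "0 \<le> psi x"
  unfolding psi_def by (intro sum_nonneg mangoldt_real_nonneg)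

text \<open>Legendre's formula: each logarithm is a divisor sum of \<open>mangoldt\<close>, and
  \<open>d\<close> has \<open>N div d\<close> multiples up to \<open>N\<close>. The upper limit
  \<open>M\<close> may exceed \<open>N\<close>, so that the formulas for \<open>N\<close> and
  \<open>2 * N\<close> share one index range.\<close>

lemma ln_fact_eq_sum_mangoldt:
  assumes "N \<le> M"
  shows "ln (fact N :: real) = (\<Sum>d=1..M. mangoldt d * real (N div d))"
proof -
  have "ln (fact N :: real) = (\<Sum>n=1..N. ln (real n))"
    by (induction N) (auto simp: ln_mult)
  also have "\<dots> = (\<Sum>n=1..N. \<Sum>d | d dvd n. mangoldt d)"
    by (intro sum.cong refl) (use mangoldt_sum[where ?'a = real] in auto)
  also have "\<dots> = (\<Sum>n=1..N. \<Sum>d\<in>{d\<in>{1..M}. d dvd n}. mangoldt d)"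
    using assms by (intro sum.cong refl) (auto dest: dvd_imp_le intro: Nat.gr0I)
  also have "\<dots> = (\<Sum>d=1..M. \<Sum>n\<in>{n\<in>{1..N}. d dvd n}. mangoldt d)"
    by (intro sum.swap_restrict) auto
  also have "\<dots> = (\<Sum>d=1..M. mangoldt d * real (N div d))"
  proof (intro sum.cong refl)
    fix d assume d: "d \<in> {1..M}"
    have "{n\<in>{1..N}. d dvd n} = (*) d ` {1..N div d}"
    proof (intro equalityI subsetI)
      fix n assume n: "n \<in> {n\<in>{1..N}. d dvd n}"
      then obtain k where k: "n = d * k" by auto
      then have "k \<le> N div d" using n d by (simp add: less_eq_div_iff_mult_less_eq mult.commute)
      then show "n \<in> (*) d ` {1..N div d}" using n k by auto
    next
      fix n assume "n \<in> (*) d ` {1..N div d}"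
      then obtain k where "n = d * k" "k \<in> {1..N div d}" by (rule imageE)
      then have k: "n = d * k" "1 \<le> k" "k \<le> N div d" by auto
      then have "d * k \<le> N" using d by (simp add: less_eq_div_iff_mult_less_eq mult.commute)
      then show "n \<in> {n\<in>{1..N}. d dvd n}" using k d by auto
    qed
    then have "card {n\<in>{1..N}. d dvd n} = N div d"
      using d by (simp add: card_image inj_on_def)
    then show "(\<Sum>n\<in>{n\<in>{1..N}. d dvd n}. mangoldt d) = mangoldt d * real (N div d)" by simp
  qed
  finally show ?thesis .
qed

lemma psi_of_nat: "psi (real N) = (\<Sum>d=1..N. mangoldt d)"
  unfolding psi_def upto_real_eq by simp

text \<open>The logarithm of the central binomial coefficient is the sum of
  \<open>mangoldt d\<close> with weights \<open>2 * N div d - 2 * (N div d)\<close>. These are never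
  negative and at least 1 for \<open>N < d \<le> 2 * N\<close>, while the coefficient is at most
  4^N.\<close>

lemma psi_doubling: "psi (real (2 * N)) \<le> psi (real N) + 2 * real N"
proof -
  have "psi (real (2 * N)) - psi (real N) = (\<Sum>d\<in>{1..2*N}-{1..N}. mangoldt d)"
    unfolding psi_of_nat by (subst sum_diff) auto
  also have "\<dots> \<le> (\<Sum>d\<in>{1..2*N}-{1..N}. mangoldt d * (real (2 * N div d) - 2 * real (N div d)))"
  proof (intro sum_mono)
    fix d assume d: "d \<in> {1..2*N}-{1..N}"
    then have "N div d = 0" "2 * N div d \<ge> 1" by (auto simp: Suc_le_eq div_greater_zero_iff)
    then have "1 \<le> real (2 * N div d) - 2 * real (N div d)" by simp
    then show "mangoldt d \<le> mangoldt d * (real (2 * N div d) - 2 * real (N div d))"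
      using mangoldt_real_nonneg[of d] by (simp add: mult_le_cancel_left1)
  qed
  also have "\<dots> \<le> (\<Sum>d=1..2*N. mangoldt d * (real (2 * N div d) - 2 * real (N div d)))"
  proof (intro sum_mono2)
    fix d assume "d \<in> {1..2 * N} - ({1..2 * N} - {1..N})"
    then have d: "0 < d" by auto
    have "(N div d) * d \<le> N" by (rule div_times_less_eq_dividend)
    then have "2 * (N div d) * d \<le> 2 * N" by simp
    then have "2 * (N div d) \<le> 2 * N div d" using d by (simp add: less_eq_div_iff_mult_less_eq)
    then have "0 \<le> real (2 * N div d) - 2 * real (N div d)" by linarith
    then show "0 \<le> mangoldt d * (real (2 * N div d) - 2 * real (N div d))"
      by (intro mult_nonneg_nonneg mangoldt_real_nonneg)
  qed auto
  also have "\<dots> = (\<Sum>d=1..2*N. mangoldt d * real (2 * N div d)) - 2 * (\<Sum>d=1..2*N. mangoldt d * real (N div d))"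
    by (simp add: right_diff_distrib sum_subtractf sum_distrib_left mult_ac)
  also have "\<dots> = ln (fact (2 * N)) - 2 * ln (fact N)"
    using ln_fact_eq_sum_mangoldt[of "2*N" "2*N"] ln_fact_eq_sum_mangoldt[of N "2*N"] by simp
  also have "\<dots> = ln (real ((2 * N) choose N))"
    by (simp add: binomial_fact ln_div ln_mult)
  also have "\<dots> \<le> ln (2 ^ (2 * N))"
  proof -
    have "(2 * N) choose N \<le> 2 ^ (2 * N)" by (rule binomial_le_pow2)
    then have "real ((2 * N) choose N) \<le> 2 ^ (2 * N)" by (metis of_nat_le_iff of_nat_numeral of_nat_power)
    then show ?thesis by (subst ln_le_cancel_iff) auto
  qed
  also have "\<dots> = 2 * real N * ln 2" by (simp add: ln_realpow)
  also have "\<dots> \<le> 2 * real N * 1" using ln_2_less_1 by (intro mult_left_mono) auto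
  finally show ?thesis by simp
qed

lemma psi_nat_le: "psi (real N) \<le> 4 * real N"
proof (induction N rule: less_induct)
  case (less N)
  show ?case
  proof (cases "N \<le> 1")
    case True
    then show ?thesis by (cases N) (auto simp: psi_def upto_real_eq)
  next
    case False
    define M where "M = (N + 1) div 2"
    have M: "M < N" "N \<le> 2 * M" "2 * M \<le> N + 1" using False unfolding M_def by auto
    have "psi (real N) \<le> psi (real (2 * M))" using M by (intro psi_mono) linarith
    also have "\<dots> \<le> psi (real M) + 2 * real M" by (rule psi_doubling)
    also have "\<dots> \<le> 6 * real M" using less.IH[OF M(1)] by simp
    \<comment> \<open>Here 4 M is at most 2 (N + 1) and 2 M at most 2 (N - 1), which also covers
      \<open>N = 2\<close>.\<close>
    also have "\<dots> \<le> 4 * real N" using M False by linarith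
    finally show ?thesis .
  qed
qed

lemma psi_le: "0 \<le> x \<Longrightarrow> psi x \<le> 4 * x"
proof -
  assume x: "0 \<le> x"
  have "psi x = psi (real (nat \<lfloor>x\<rfloor>))" unfolding psi_def upto_real_eq by simp
  also have "\<dots> \<le> 4 * real (nat \<lfloor>x\<rfloor>)" by (rule psi_nat_le)
  also have "\<dots> \<le> 4 * x" using x by simp
  finally show ?thesis .
qed

section \<open>The Dirichlet series of the logarithmic derivative of zeta\<close>

lemma ln_le_powr_div:
  fixes x e :: real
  assumes "0 < e" "0 < x"
  shows "ln x \<le> x powr e / e"
proof -
  have "e * ln x = ln (x powr e)" using assms by (simp add: ln_powr)
  also have "\<dots> \<le> x powr e - 1" using assms by (intro ln_le_minus_one) simp
  finally show ?thesis using assms by (simp add: field_simps)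
qed

text \<open>Half of the excess \<open>\<sigma> - 1\<close> is spent on the logarithm; the other half
  keeps the series convergent.\<close>

lemma dirichlet_ln_bound:
  assumes \<sigma>: "1 < \<sigma>"
  shows "ln (real (Suc n)) * real (Suc n) powr (- \<sigma>) \<le> 2 / (\<sigma> - 1) * real (Suc n) powr (- (1 + (\<sigma> - 1) / 2))"
proof -
  have "ln (real (Suc n)) \<le> real (Suc n) powr ((\<sigma> - 1) / 2) / ((\<sigma> - 1) / 2)"
    using \<sigma> by (intro ln_le_powr_div) auto
  then have "ln (real (Suc n)) * real (Suc n) powr (- \<sigma>) \<le> real (Suc n) powr ((\<sigma> - 1) / 2) / ((\<sigma> - 1) / 2) * real (Suc n) powr (- \<sigma>)"
    by (intro mult_right_mono) auto
  also have "\<dots> = 2 / (\<sigma> - 1) * (real (Suc n) powr ((\<sigma> - 1) / 2) * real (Suc n) powr (- \<sigma>))" by simp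
  also have "real (Suc n) powr ((\<sigma> - 1) / 2) * real (Suc n) powr (- \<sigma>) = real (Suc n) powr (- (1 + (\<sigma> - 1) / 2))"
    unfolding powr_add[symmetric] by (rule arg_cong[where f = "\<lambda>e. real (Suc n) powr e"]) (simp add: field_simps)
  finally show ?thesis .
qed

lemma summable_dirichlet_ln:
  assumes "1 < \<sigma>"
  shows "summable (\<lambda>n. ln (real (Suc n)) * real (Suc n) powr (- \<sigma>))"
proof (rule summable_comparison_test')
  show "summable (\<lambda>n. 2 / (\<sigma> - 1) * real (Suc n) powr (- (1 + (\<sigma> - 1) / 2)))"
    using assms by (intro summable_mult summable_Suc_powr) simp
  show "norm (ln (real (Suc n)) * real (Suc n) powr (- \<sigma>)) \<le> 2 / (\<sigma> - 1) * real (Suc n) powr (- (1 + (\<sigma> - 1) / 2))" for n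
    using dirichlet_ln_bound[OF assms, of n] by simp
qed

text \<open>This is zeta itself, and it is used as such only for \<open>Re s > 1\<close>.\<close>

definition zeta_right :: "complex \<Rightarrow> complex" where
  "zeta_right s = reg_zeta s / (s - 1)"

lemma zeta_right_deriv_sums:
  assumes s: "1 < Re s"
  shows "(\<lambda>n. - of_real (ln (real (Suc n))) * of_nat (Suc n) powr (- s)) sums deriv zeta_right s"
proof -
  let ?S = "{s. 1 < Re s}"
  have oS: "open ?S" by (rule open_halfspace_Re_gt)
  have "\<exists>g g'. \<forall>x\<in>?S. (\<lambda>n. of_nat (Suc n) powr (- x)) sums g x \<and>
     (\<lambda>n. - of_real (ln (real (Suc n))) * of_nat (Suc n) powr (- x)) sums g' x \<and> (g has_field_derivative g' x) (at x)"
  proof (rule series_and_derivative_comparison_complex[OF oS])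
    fix n x
    have "((\<lambda>z. of_nat (Suc n) powr z) has_field_derivative Ln (of_nat (Suc n)) * of_nat (Suc n) powr (- x)) (at (- x))"
      by (rule has_field_derivative_powr_right) (simp del: of_nat_Suc)
    moreover have "((\<lambda>x::complex. - x) has_field_derivative - 1) (at x)" by (auto intro!: derivative_eq_intros)
    ultimately have "((\<lambda>x. of_nat (Suc n) powr (- x)) has_field_derivative ln (of_nat (Suc n)) * of_nat (Suc n) powr (- x) * - 1) (at x)"
      by (rule DERIV_chain2)
    moreover have "ln (of_nat (Suc n)) = complex_of_real (ln (real (Suc n)))"
      using Ln_of_nat[of "Suc n"] by simp
    ultimately show "((\<lambda>x. of_nat (Suc n) powr (- x)) has_field_derivative (- of_real (ln (real (Suc n))) * of_nat (Suc n) powr (- x))) (at x)"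
      by (simp add: mult.commute del: of_nat_Suc)
  next
    fix x assume x: "x \<in> ?S"
    \<comment> \<open>Half the distance to \<open>Re s = 1\<close>: on the ball of this radius the
      terms are dominated by those of exponent \<open>1 + d\<close>.\<close>
    define d where "d = (Re x - 1) / 2"
    have d: "d > 0" using x by (simp add: d_def)
    show "\<exists>d h. 0 < d \<and> summable h \<and> range h \<subseteq> \<real>\<^sub>\<ge>\<^sub>0 \<and>
        (\<forall>\<^sub>F n in sequentially. \<forall>y\<in>ball x d \<inter> ?S. cmod (of_nat (Suc n) powr (- y)) \<le> cmod (h n))"
    proof (rule exI[of _ d], rule exI[of _ "\<lambda>n. complex_of_real (real (Suc n) powr (- (1 + d)))"], intro conjI always_eventually allI ballI)
      show "summable (\<lambda>n. complex_of_real (real (Suc n) powr (- (1 + d))))"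
        using d by (intro summable_of_real summable_Suc_powr) auto
      show "range (\<lambda>n. complex_of_real (real (Suc n) powr (- (1 + d)))) \<subseteq> \<real>\<^sub>\<ge>\<^sub>0" by auto
      fix n y assume y: "y \<in> ball x d \<inter> ?S"
      then have "Re x - Re y < d" using complex_Re_le_cmod[of "x - y"] by (simp add: dist_norm)
      then have "1 + d \<le> Re y" unfolding d_def by (simp add: field_simps)
      then show "cmod (of_nat (Suc n) powr (- y)) \<le> cmod (complex_of_real (real (Suc n) powr (- (1 + d))))"
        unfolding norm_of_nat_powr by (simp del: of_nat_Suc) (intro powr_mono; simp)
    qed (rule d)
  qed
  then obtain g g' where g: "\<And>x. x \<in> ?S \<Longrightarrow> (\<lambda>n. of_nat (Suc n) powr (- x)) sums g x"
    "\<And>x. x \<in> ?S \<Longrightarrow> (\<lambda>n. - of_real (ln (real (Suc n))) * of_nat (Suc n) powr (- x)) sums g' x"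
    "\<And>x. x \<in> ?S \<Longrightarrow> (g has_field_derivative g' x) (at x)" by blast
  have eq: "g x = zeta_right x" if "x \<in> ?S" for x
    using g(1)[OF that] zeta_sums[of x] that sums_unique2 unfolding zeta_right_def by auto
  have sS: "s \<in> ?S" using s by simp
  have "(zeta_right has_field_derivative g' s) (at s)"
    by (rule has_field_derivative_transform_within_open[OF g(3)[OF sS] oS sS]) (rule eq)
  then have "deriv zeta_right s = g' s" by (rule DERIV_imp_deriv)
  then show ?thesis using g(2)[OF sS] by simp
qed

definition mangoldt_series :: "complex \<Rightarrow> complex" where
  "mangoldt_series s = (\<Sum>n. mangoldt (Suc n) * of_nat (Suc n) powr (- s))"

lemma norm_mangoldt [simp]: "cmod (mangoldt n) = mangoldt n"
proof -
  have "cmod (of_real (mangoldt n)) = \<bar>mangoldt n\<bar>" by (rule norm_of_real)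
  then show ?thesis using mangoldt_real_nonneg[of n] by simp
qed

lemma summable_norm_mangoldt_series:
  assumes s: "1 < Re s"
  shows "summable (\<lambda>n. cmod (mangoldt (Suc n) * of_nat (Suc n) powr (- s)))"
proof (rule summable_comparison_test'[OF summable_dirichlet_ln[OF s]])
  fix n
  show "norm (cmod (mangoldt (Suc n) * of_nat (Suc n) powr (- s))) \<le> ln (real (Suc n)) * real (Suc n) powr (- Re s)"
    unfolding norm_mult norm_of_nat_powr norm_mangoldt
    using mangoldt_real_le_ln[of "Suc n"] mangoldt_real_nonneg[of "Suc n"]
    by (simp add: abs_mult mult_right_mono del: of_nat_Suc)
qed

lemma has_sum_Suc_iff: "((\<lambda>n. f (Suc n)) has_sum S) UNIV \<longleftrightarrow> (f has_sum S) {0<..}"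
proof -
  have "Suc ` UNIV = {0<..}" by (auto simp: image_iff gr0_conv_Suc)
  then show ?thesis using has_sum_reindex[of Suc UNIV f S] by (simp add: o_def)
qed

lemma abs_summable_on_product:
  fixes f g :: "nat \<Rightarrow> complex"
  assumes f: "(\<lambda>x. cmod (f x)) summable_on A" and g: "(\<lambda>x. cmod (g x)) summable_on B"
  shows "(\<lambda>z. cmod (case z of (x, y) \<Rightarrow> f x * g y)) summable_on A \<times> B"
  unfolding Infinite_Sum.abs_summable_on_Sigma_iff
proof (intro conjI ballI)
  show "(\<lambda>y. cmod (case (x, y) of (x, y) \<Rightarrow> f x * g y)) summable_on B" for x
    using summable_on_cmult_right[OF g, of "cmod (f x)"] by (simp add: norm_mult)
  have "(\<lambda>x. cmod (f x) * infsum (\<lambda>y. cmod (g y)) B) summable_on A"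
    by (rule summable_on_cmult_left[OF f])
  then show "(\<lambda>x. norm (\<Sum>\<^sub>\<infinity>y\<in>B. cmod (case (x, y) of (x, y) \<Rightarrow> f x * g y))) summable_on A"
    by (simp add: norm_mult infsum_cmult_right' abs_mult infsum_nonneg)
qed

text \<open>The divisor sum of \<open>mangoldt\<close> is the logarithm. Absolute convergence allows
  the product of the two series to be regrouped by the product of their indices, which gives the
  termwise derivative of zeta up to sign.\<close>

lemma zeta_times_mangoldt:
  assumes s: "1 < Re s"
  shows "mangoldt_series s * zeta_right s = - deriv zeta_right s"
proof -
  let ?z = "\<lambda>n. complex_of_nat n powr (- s)"
  let ?m = "\<lambda>n. mangoldt n * complex_of_nat n powr (- s)"
  have M: "(?m has_sum mangoldt_series s) {0<..}"
    unfolding has_sum_Suc_iff[symmetric] mangoldt_series_def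
    by (rule norm_summable_imp_has_sum[OF summable_norm_mangoldt_series[OF s]])
       (rule summable_sums[OF summable_norm_cancel[OF summable_norm_mangoldt_series[OF s]]])
  have Z: "(?z has_sum zeta_right s) {0<..}" unfolding zeta_right_def by (rule zeta_has_sum[OF s])
  have "(\<lambda>z. cmod (case z of (d, k) \<Rightarrow> ?m d * ?z k)) summable_on {0<..} \<times> {0<..}"
  proof (rule abs_summable_on_product)
    have "(\<lambda>n. cmod (?m (Suc n))) summable_on UNIV"
      by (rule norm_summable_imp_summable_on) (use summable_norm_mangoldt_series[OF s] in simp)
    then show "(\<lambda>n. cmod (?m n)) summable_on {0<..}"
      unfolding summable_on_def has_sum_Suc_iff[symmetric] .
    have "(\<lambda>n. cmod (?z (Suc n))) summable_on UNIV"
      by (rule norm_summable_imp_summable_on) (use summable_norm_zeta[OF s] in simp)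
    then show "(\<lambda>n. cmod (?z n)) summable_on {0<..}"
      unfolding summable_on_def has_sum_Suc_iff[symmetric] .
  qed
  then have sm: "(\<lambda>(d, k). ?m d * ?z k) summable_on {0<..} \<times> {0<..}" by (rule abs_summable_summable)
  have P: "((\<lambda>(d, k). ?m d * ?z k) has_sum (mangoldt_series s * zeta_right s)) ({0<..} \<times> {0<..})"
  proof (rule has_sum_SigmaI[OF _ _ sm])
    show "((\<lambda>y. case (x, y) of (d, k) \<Rightarrow> ?m d * ?z k) has_sum (?m x * zeta_right s)) {0<..}" for x
      using has_sum_cmult_right[OF Z, of "?m x"] by simp
    show "((\<lambda>x. ?m x * zeta_right s) has_sum mangoldt_series s * zeta_right s) {0<..}"
      by (rule has_sum_cmult_left[OF M])
  qed
  \<comment> \<open>Pairs \<open>(d, k)\<close> of positive integers correspond to pairs of an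
    integer \<open>n = d * k\<close> and a divisor \<open>d\<close>.\<close>
  have "((\<lambda>(n, d). mangoldt d * ?z n) has_sum (mangoldt_series s * zeta_right s)) (Sigma {0<..} (\<lambda>n. {d. d dvd n}))"
  proof (rule iffD1[OF has_sum_reindex_bij_witness[where i = "\<lambda>(n, d). (d, n div d)" and j = "\<lambda>(d, k). (d * k, d)"] P])
    fix a assume a: "a \<in> {0::nat<..} \<times> {0::nat<..}"
    then show "(case (case a of (d, k) \<Rightarrow> (d * k, d)) of (n, d) \<Rightarrow> (d, n div d)) = a" by auto
    show "(case a of (d, k) \<Rightarrow> (d * k, d)) \<in> Sigma {0<..} (\<lambda>n. {d. d dvd n})" using a by auto
    show "(case (case a of (d, k) \<Rightarrow> (d * k, d)) of (n, d) \<Rightarrow> mangoldt d * ?z n) = (case a of (d, k) \<Rightarrow> ?m d * ?z k)"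
      using a by (auto simp: powr_times_real)
  next
    fix b assume b: "b \<in> Sigma {0::nat<..} (\<lambda>n. {d. d dvd n})"
    then show "(case (case b of (n, d) \<Rightarrow> (d, n div d)) of (d, k) \<Rightarrow> (d * k, d)) = b" by auto
    show "(case b of (n, d) \<Rightarrow> (d, n div d)) \<in> {0<..} \<times> {0<..}"
      using b by (auto simp: div_greater_zero_iff dvd_imp_le intro: dvd_pos_nat)
  qed simp
  then have "((\<lambda>n. of_real (ln (real n)) * ?z n) has_sum (mangoldt_series s * zeta_right s)) {0<..}"
  proof (rule has_sum_SigmaD)
    fix n :: nat assume n: "n \<in> {0<..}"
    have "((\<lambda>d. mangoldt d * ?z n) has_sum (\<Sum>d | d dvd n. mangoldt d * ?z n)) {d. d dvd n}"
      using n by (intro has_sum_finite) auto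
    also have "(\<Sum>d | d dvd n. mangoldt d * ?z n) = of_real (ln (real n)) * ?z n"
      unfolding sum_distrib_right[symmetric] using n by (subst mangoldt_sum) auto
    finally show "((\<lambda>d. case (n, d) of (n, d) \<Rightarrow> mangoldt d * ?z n) has_sum of_real (ln (real n)) * ?z n) {d. d dvd n}"
      by simp
  qed
  then have "(\<lambda>n. of_real (ln (real (Suc n))) * ?z (Suc n)) sums (mangoldt_series s * zeta_right s)"
    unfolding has_sum_Suc_iff[symmetric] by (rule has_sum_imp_sums)
  moreover have "(\<lambda>n. - (- of_real (ln (real (Suc n))) * ?z (Suc n))) sums (- deriv zeta_right s)"
    by (rule sums_minus[OF zeta_right_deriv_sums[OF s]])
  ultimately show ?thesis using sums_unique2 by (simp only: minus_mult_left[symmetric] minus_minus)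
qed

text \<open>Joins the two descriptions: the pole-free form in \<open>reg_zeta\<close>, which is
  estimated up to \<open>Re s = 1\<close>, and the difference of Laplace transforms of
  \<open>psi (exp x)\<close> and \<open>exp x\<close> that it stands for on the right.\<close>

lemma psi_transform_eq:
  assumes s: "1 < Re s"
  shows "psi_transform s = mangoldt_series s / s - 1 / (s - 1)"
proof -
  have dom: "s \<in> zeta_dom" using s by (simp add: zeta_dom_def)
  have nz: "reg_zeta s \<noteq> 0" "s \<noteq> 0" "s - 1 \<noteq> 0" using reg_zeta_nonzero[of s] s by auto
  have "(reg_zeta has_field_derivative deriv reg_zeta s) (at s)"
    by (rule holomorphic_derivI[OF holomorphic_reg_zeta open_zeta_dom dom])
  then have "(zeta_right has_field_derivative (deriv reg_zeta s * (s - 1) - reg_zeta s) / (s - 1)\<^sup>2) (at s)"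
    unfolding zeta_right_def using nz by (auto intro!: derivative_eq_intros simp: power2_eq_square)
  then have "deriv zeta_right s = (deriv reg_zeta s * (s - 1) - reg_zeta s) / (s - 1)\<^sup>2" by (rule DERIV_imp_deriv)
  then have "mangoldt_series s * (reg_zeta s / (s - 1)) = - ((deriv reg_zeta s * (s - 1) - reg_zeta s) / (s - 1)\<^sup>2)"
    using zeta_times_mangoldt[OF s] unfolding zeta_right_def by simp
  moreover have "m = 1 / u - d / h" if "m * (h / u) = - ((d * u - h) / u\<^sup>2)" "h \<noteq> 0" "u \<noteq> 0" for m h u d :: complex
    using that by (simp add: field_simps power2_eq_square)
  ultimately have "mangoldt_series s = 1 / (s - 1) - deriv reg_zeta s / reg_zeta s" using nz by blast
  moreover have "- (1 + D) / (u + 1) = (1 / u - D) / (u + 1) - 1 / u" if "u + 1 \<noteq> 0" "u \<noteq> 0" for u D :: complex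
    using that by (simp add: divide_simps) (simp add: algebra_simps)
  from this[of "s - 1"] have "- (1 + D) / s = (1 / (s - 1) - D) / s - 1 / (s - 1)" for D using nz by simp
  ultimately show ?thesis unfolding psi_transform_def by simp
qed

section \<open>The Laplace transform of Chebyshev's function\<close>

lemma integrable_exp_tail_real:
  assumes c: "0 < (c::real)"
  shows "set_integrable lborel {a<..} (\<lambda>x. exp (- c * x))"
proof -
  have "set_integrable lborel (einterval (ereal a) \<infinity>) (\<lambda>x. exp (- c * x))"
  proof (rule interval_integral_FTC_nonneg(1)[where F = "\<lambda>x. - exp (- c * x) / c" and A = "- exp (- c * a) / c" and B = 0])
    show "((\<lambda>x. - exp (- c * x) / c) has_real_derivative exp (- c * x)) (at x)" for x
      using c by (auto intro!: derivative_eq_intros)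
    show "(((\<lambda>x. - exp (- c * x) / c) \<circ> real_of_ereal) \<longlongrightarrow> - exp (- c * a) / c) (at_right (ereal a))"
      unfolding ereal_tendsto_simps by (intro tendsto_intros) (use c in auto)
    show "(((\<lambda>x. - exp (- c * x) / c) \<circ> real_of_ereal) \<longlongrightarrow> 0) (at_left \<infinity>)"
      unfolding ereal_tendsto_simps using c by real_asymp
  qed auto
  also have "einterval (ereal a) \<infinity> = {a<..}" by (auto simp: einterval_def)
  finally show ?thesis .
qed

lemma has_bochner_integral_exp_tail:
  assumes c: "0 < Re c"
  shows "has_bochner_integral lborel (\<lambda>x. indicator {a..} x *\<^sub>R exp (- c * of_real x)) (exp (- c * of_real a) / c)"
proof -
  have c0: "c \<noteq> 0" using c by auto
  have I: "set_integrable lborel {a<..} (\<lambda>x. exp (- c * of_real x))"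
    unfolding set_integrable_def
  proof (rule Bochner_Integration.integrable_bound)
    show "integrable lborel (\<lambda>x. indicator {a<..} x *\<^sub>R exp (- Re c * x))"
      using integrable_exp_tail_real[OF c, of a] by (simp add: set_integrable_def)
    show "AE x in lborel. norm (indicator {a<..} x *\<^sub>R exp (- c * of_real x)) \<le> norm (indicator {a<..} x *\<^sub>R exp (- Re c * x))"
      by (auto simp: indicator_def)
  qed measurable
  have "(LBINT x=ereal a..\<infinity>. exp (- c * of_real x)) = 0 - (- exp (- c * of_real a) / c)"
  proof (rule interval_integral_FTC_integrable[where F = "\<lambda>x. - exp (- c * of_real x) / c"])
    show "((\<lambda>x. - exp (- c * of_real x) / c) has_vector_derivative exp (- c * of_real x)) (at x)" for x
    proof -
      have "((\<lambda>z. - exp (- c * z) / c) has_field_derivative exp (- c * of_real x)) (at (of_real x))"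
        using c0 by (auto intro!: derivative_eq_intros)
      then show ?thesis by (rule has_vector_derivative_real_field)
    qed
    show "set_integrable lborel (einterval (ereal a) \<infinity>) (\<lambda>x. exp (- c * of_real x))"
    proof -
      have "einterval (ereal a) \<infinity> = {a<..}" by (auto simp: einterval_def)
      then show ?thesis using I by simp
    qed
    show "(((\<lambda>x. - exp (- c * of_real x) / c) \<circ> real_of_ereal) \<longlongrightarrow> - exp (- c * of_real a) / c) (at_right (ereal a))"
      unfolding ereal_tendsto_simps by (intro tendsto_intros) (use c0 in auto)
    have "((\<lambda>x. exp (- Re c * x) / cmod c) \<longlongrightarrow> 0) at_top" using c c0 by real_asymp
    then show "(((\<lambda>x. - exp (- c * of_real x) / c) \<circ> real_of_ereal) \<longlongrightarrow> 0) (at_left \<infinity>)"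
      unfolding ereal_tendsto_simps by (subst tendsto_norm_zero_iff[symmetric]) (simp add: norm_divide)
  qed auto
  then have V: "(LBINT x. indicator {a<..} x *\<^sub>R exp (- c * of_real x)) = exp (- c * of_real a) / c"
    by (simp add: interval_lebesgue_integral_def set_lebesgue_integral_def einterval_def greaterThan_def)
  have "has_bochner_integral lborel (\<lambda>x. indicator {a<..} x *\<^sub>R exp (- c * of_real x)) (exp (- c * of_real a) / c)"
    using I V unfolding set_integrable_def by (simp add: has_bochner_integral_iff)
  moreover have "AE x in lborel. indicator {a<..} x *\<^sub>R exp (- c * of_real x) = indicator {a..} x *\<^sub>R exp (- c * of_real x)"
    using AE_lborel_singleton[of a] by eventually_elim (auto simp: indicator_def)
  ultimately show ?thesis
    by (subst (asm) has_bochner_integral_cong_AE) auto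
qed

text \<open>Each integer n enters \<open>psi (exp x)\<close> from \<open>x = ln n\<close> on and
  contributes its \<open>mangoldt\<close> value times n^(-s) / s. The series of the absolute
  integrals converges, so summation and integration commute.\<close>

lemma psi_laplace:
  assumes s: "1 < Re s"
  shows "has_bochner_integral lborel (\<lambda>x. complex_of_real (psi (exp x)) * exp (- s * of_real x)) (mangoldt_series s / s)"
proof -
  define g where "g = (\<lambda>n x. (mangoldt (Suc n) :: complex) * (indicator {ln (real (Suc n))..} x *\<^sub>R exp (- s * of_real x)))"
  have ex: "exp (- s * of_real (ln (real (Suc n)))) = of_nat (Suc n) powr (- s)" for n
  proof -
    have "of_nat (Suc n) powr (- s) = exp (- s * ln (of_nat (Suc n)))" by (simp add: powr_def del: of_nat_Suc)
    then show ?thesis using Ln_of_nat[of "Suc n"] by simp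
  qed
  have Re_s: "0 < Re s" using s by simp
  have gi: "has_bochner_integral lborel (g n) (mangoldt (Suc n) * (of_nat (Suc n) powr (- s) / s))" for n
    unfolding g_def ex[symmetric] by (intro has_bochner_integral_mult_right has_bochner_integral_exp_tail Re_s)
  have gn: "(LBINT x. norm (g n x)) = mangoldt (Suc n) * real (Suc n) powr (- Re s) / Re s" for n
  proof -
    have "has_bochner_integral lborel (\<lambda>x. indicator {ln (real (Suc n))..} x *\<^sub>R exp (- of_real (Re s) * complex_of_real x))
       (exp (- of_real (Re s) * of_real (ln (real (Suc n)))) / of_real (Re s))"
      by (rule has_bochner_integral_exp_tail) (simp add: Re_s)
    then have "has_bochner_integral lborel (\<lambda>x. Re (indicator {ln (real (Suc n))..} x *\<^sub>R exp (- of_real (Re s) * complex_of_real x)))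
       (Re (exp (- of_real (Re s) * of_real (ln (real (Suc n)))) / of_real (Re s)))"
      by (rule has_bochner_integral_bounded_linear[OF bounded_linear_Re])
    also have "(\<lambda>x. Re (indicator {ln (real (Suc n))..} x *\<^sub>R exp (- of_real (Re s) * complex_of_real x)))
      = (\<lambda>x. indicator {ln (real (Suc n))..} x * exp (- Re s * x))"
      by (simp add: Re_exp)
    also have "Re (exp (- of_real (Re s) * of_real (ln (real (Suc n)))) / of_real (Re s)) = real (Suc n) powr (- Re s) / Re s"
      by (simp add: Re_divide_of_real Re_exp powr_def del: of_nat_Suc)
    finally have "(LBINT x. mangoldt (Suc n) * (indicator {ln (real (Suc n))..} x * exp (- Re s * x))) = mangoldt (Suc n) * (real (Suc n) powr (- Re s) / Re s)"
      by (intro has_bochner_integral_integral_eq has_bochner_integral_mult_right)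
    moreover have "norm (g n x) = mangoldt (Suc n) * (indicator {ln (real (Suc n))..} x * exp (- Re s * x))" for x
      unfolding g_def by (simp add: norm_mult indicator_def)
    ultimately show ?thesis by simp
  qed
  have gpt: "(\<lambda>n. g n x) sums (complex_of_real (psi (exp x)) * exp (- s * of_real x))" and
       gsm: "summable (\<lambda>n. norm (g n x))" for x
  proof -
    define N where "N = nat \<lfloor>exp x\<rfloor>"
    have iff: "x \<ge> ln (real (Suc n)) \<longleftrightarrow> Suc n \<le> N" for n
    proof -
      have "x \<ge> ln (real (Suc n)) \<longleftrightarrow> real (Suc n) \<le> exp x"
        by (metis exp_le_cancel_iff exp_ln of_nat_0_less_iff zero_less_Suc)
      also have "\<dots> \<longleftrightarrow> Suc n \<le> N" unfolding N_def by (simp add: le_nat_iff le_floor_iff)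
      finally show ?thesis .
    qed
    have z: "g n x = 0" if "n \<notin> {..<N}" for n
      using that iff[of n] unfolding g_def by (auto simp: indicator_def)
    show "summable (\<lambda>n. norm (g n x))" by (rule summable_finite[of "{..<N}"]) (use z in auto)
    have "(\<lambda>n. g n x) sums (\<Sum>n<N. g n x)" by (rule sums_finite) (use z in auto)
    also have "(\<Sum>n<N. g n x) = (\<Sum>n<N. mangoldt (Suc n) * exp (- s * of_real x))"
      using iff unfolding g_def by (intro sum.cong refl) (auto simp: indicator_def Suc_le_eq)
    also have "\<dots> = complex_of_real (\<Sum>n<N. mangoldt (Suc n)) * exp (- s * of_real x)"
      by (simp add: sum_distrib_right)
    also have "(\<Sum>n<N. mangoldt (Suc n)) = (\<Sum>d=1..N. mangoldt d :: real)"
      by (rule sum.reindex_bij_witness[where i = "\<lambda>d. d - 1" and j = Suc]) auto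
    also have "\<dots> = psi (exp x)" unfolding psi_def upto_real_eq N_def by simp
    finally show "(\<lambda>n. g n x) sums (complex_of_real (psi (exp x)) * exp (- s * of_real x))" .
  qed
  have sm: "summable (\<lambda>n. LBINT x. norm (g n x))"
  proof -
    have "summable (\<lambda>n. cmod (mangoldt (Suc n) * of_nat (Suc n) powr (- s)) / Re s)"
      by (intro summable_divide summable_norm_mangoldt_series s)
    then show ?thesis unfolding gn norm_mult norm_of_nat_powr norm_mangoldt by simp
  qed
  have int: "integrable lborel (g n)" for n using gi[of n] by (simp add: has_bochner_integral_iff)
  have i1: "integrable lborel (\<lambda>x. \<Sum>n. g n x)"
    by (rule integrable_suminf[OF int _ sm]) (use gsm in auto)
  have i2: "(LBINT x. \<Sum>n. g n x) = (\<Sum>n. LBINT x. g n x)"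
    by (rule integral_suminf[OF int _ sm]) (use gsm in auto)
  have e: "(\<Sum>n. g n x) = complex_of_real (psi (exp x)) * exp (- s * of_real x)" for x
    using gpt[of x] by (rule sums_unique[symmetric])
  have "(\<Sum>n. LBINT x. g n x) = (\<Sum>n. (mangoldt (Suc n) * of_nat (Suc n) powr (- s)) / s)"
    using gi by (intro arg_cong[where f = suminf] ext) (simp add: has_bochner_integral_iff)
  also have "\<dots> = mangoldt_series s / s"
    unfolding mangoldt_series_def
    by (rule suminf_divide[OF summable_norm_cancel[OF summable_norm_mangoldt_series[OF s]]])
  finally show ?thesis using i1 i2 unfolding e by (simp add: has_bochner_integral_iff)
qed

section \<open>Mean square and mean absolute value of the error in the prime number theorem\<close>

text \<open>The relative error of \<open>psi\<close> in the logarithmic variable, in which the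
  Laplace transform on a vertical line becomes a Fourier transform.\<close>

definition psi_err :: "real \<Rightarrow> real" where
  "psi_err x = psi (exp x) * exp (- x) - 1"

text \<open>With \<open>\<delta> = 1/V\<close> the weight is comparable to \<open>x/V\<close> on \<open>[0, V]\<close>, while its Fourier transform is a difference
  of values of \<open>psi_transform\<close>; this replaces differentiating the transform.\<close>
definition psi_wave :: "real \<Rightarrow> real \<Rightarrow> real" where
  "psi_wave \<delta> x = indicator {0..} x * (psi_err x * (exp (- \<delta> * x) - exp (- 2 * \<delta> * x)))"

lemma psi_neg: "x < 1 \<Longrightarrow> psi x = 0"
  unfolding psi_def upto_real_def by (auto intro!: sum.neutral)

lemma abs_psi_err_le: "\<bar>psi_err x\<bar> \<le> 3"
proof -
  have "psi (exp x) * exp (- x) \<le> 4 * exp x * exp (- x)"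
    using psi_le[of "exp x"] by (intro mult_right_mono) auto
  also have "\<dots> = 4" by (simp add: exp_minus)
  finally have "psi (exp x) * exp (- x) \<le> 4" .
  moreover have "0 \<le> psi (exp x) * exp (- x)" using psi_nonneg by simp
  ultimately show ?thesis unfolding psi_err_def by (simp add: abs_le_iff)
qed

text \<open>Damping by \<open>exp (- a * x)\<close> moves the Laplace variable to
  \<open>1 + a + it\<close>. Since \<open>psi (exp x)\<close> vanishes for negative
  \<open>x\<close>, the cut at 0 affects only the constant 1, whose transform is the polar term
  \<open>1 / (s - 1)\<close>.\<close>

lemma psi_wave_fourier:
  assumes d: "0 < \<delta>"
  shows "has_bochner_integral lborel (\<lambda>x. complex_of_real (psi_wave \<delta> x) * cis (- t * x))
           (psi_transform (Complex (1 + \<delta>) t) - psi_transform (Complex (1 + 2 * \<delta>) t))"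
proof -
  let ?s = "\<lambda>a. Complex (1 + a) t"
  let ?P = "\<lambda>a x. complex_of_real (psi (exp x)) * exp (- ?s a * of_real x)"
  let ?E = "\<lambda>a x. indicator {0..} x *\<^sub>R exp (- (?s a - 1) * of_real x)"
  have P: "has_bochner_integral lborel (?P a) (mangoldt_series (?s a) / ?s a)" if "0 < a" for a
    by (rule psi_laplace) (use that in simp)
  have E: "has_bochner_integral lborel (?E a) (1 / (?s a - 1))" if "0 < a" for a
    using has_bochner_integral_exp_tail[of "?s a - 1" 0] that by simp
  have d2: "0 < 2 * \<delta>" using d by simp
  have H: "has_bochner_integral lborel (\<lambda>x. (?P \<delta> x - ?E \<delta> x) - (?P (2 * \<delta>) x - ?E (2 * \<delta>) x))
      ((mangoldt_series (?s \<delta>) / ?s \<delta> - 1 / (?s \<delta> - 1)) - (mangoldt_series (?s (2 * \<delta>)) / ?s (2 * \<delta>) - 1 / (?s (2 * \<delta>) - 1)))"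
    by (intro has_bochner_integral_diff P E d d2)
  have e1: "exp (- ?s a * of_real x) = of_real (exp (- x) * exp (- a * x)) * cis (- t * x)" for a x
    by (simp add: complex_eq_iff Re_exp Im_exp exp_add[symmetric] algebra_simps)
  have e2: "exp (- (?s a - 1) * of_real x) = of_real (exp (- a * x)) * cis (- t * x)" for a x
    by (simp add: complex_eq_iff Re_exp Im_exp algebra_simps)
  have "(?P \<delta> x - ?E \<delta> x) - (?P (2 * \<delta>) x - ?E (2 * \<delta>) x) = complex_of_real (psi_wave \<delta> x) * cis (- t * x)" for x
  proof (cases "x < 0")
    case True
    then have "psi (exp x) = 0" by (intro psi_neg) simp
    then show ?thesis using True by (simp add: psi_wave_def)
  next
    case False
    then show ?thesis unfolding e1 e2 psi_wave_def psi_err_def by (simp add: algebra_simps)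
  qed
  then show ?thesis using H psi_transform_eq[of "?s \<delta>"] psi_transform_eq[of "?s (2 * \<delta>)"] d by simp
qed

lemma integrable_psi_wave:
  assumes d: "0 < \<delta>"
  shows "integrable lborel (psi_wave \<delta>)"
proof -
  have "integrable lborel (\<lambda>x. complex_of_real (psi_wave \<delta> x) * cis (- 0 * x))"
    using psi_wave_fourier[OF d, of 0] by (simp add: has_bochner_integral_iff)
  then show ?thesis by (simp add: complex_of_real_integrable_eq)
qed

lemma abs_psi_wave_le:
  assumes d: "0 < \<delta>"
  shows "\<bar>psi_wave \<delta> x\<bar> \<le> 3"
proof (cases "0 \<le> x")
  case True
  have "exp (- \<delta> * x) \<le> 1" "exp (- 2 * \<delta> * x) \<le> exp (- \<delta> * x)" "0 < exp (- 2 * \<delta> * x)" using True d by auto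
  then have "\<bar>exp (- \<delta> * x) - exp (- 2 * \<delta> * x)\<bar> \<le> 1" by linarith
  then have "\<bar>psi_err x\<bar> * \<bar>exp (- \<delta> * x) - exp (- 2 * \<delta> * x)\<bar> \<le> 3 * 1"
    using abs_psi_err_le by (intro mult_mono) auto
  then show ?thesis using True by (simp add: psi_wave_def abs_mult)
qed (simp add: psi_wave_def)

text \<open>Jumps occur only at logarithms of integers, a countable set. It contains
  \<open>0 = ln 1\<close>, which takes care of the cut at the origin.\<close>

lemma AE_isCont_psi_wave: "AE x in lborel. isCont (psi_wave \<delta>) x"
proof -
  let ?D = "range (\<lambda>i::int. ln (real_of_int i))"
  have "?D \<in> null_sets lborel" by (intro countable_imp_null_set_lborel countable_image) auto
  then have "AE x in lborel. x \<notin> ?D" by (rule AE_not_in)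
  then show ?thesis
  proof eventually_elim
    case (elim x)
    have ex: "exp x \<notin> \<int>"
    proof
      assume "exp x \<in> \<int>"
      then obtain i where i: "exp x = real_of_int i" by (auto elim: Ints_cases)
      then have "x = ln (real_of_int i)" by (metis ln_exp)
      then show False using elim by blast
    qed
    have x0: "x \<noteq> 0" using ex by auto
    have "((\<lambda>y. exp y) \<longlongrightarrow> exp x) (nhds x)"
      using DERIV_isCont[OF DERIV_exp[of x]] by (simp add: isCont_def tendsto_at_iff_tendsto_nhds)
    from eventually_floor_eq[OF this ex]
    have fl: "eventually (\<lambda>y. psi (exp y) = psi (exp x)) (nhds x)"
      by eventually_elim (simp add: psi_def upto_real_eq)
    have sg: "eventually (\<lambda>y. (0 \<le> y) = (0 \<le> x)) (nhds x)"
    proof (cases "x < 0")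
      case True
      then have "eventually (\<lambda>y. y \<in> {..<0}) (nhds x)" by (intro eventually_nhds_in_open) auto
      then show ?thesis by eventually_elim (use True in auto)
    next
      case False
      then have "eventually (\<lambda>y. y \<in> {0<..}) (nhds x)" using x0 by (intro eventually_nhds_in_open) auto
      then show ?thesis by eventually_elim (use False in auto)
    qed
    define c where "c = (indicator {0..} x :: real)"
    have "eventually (\<lambda>y. psi_wave \<delta> y = c * ((psi (exp x) * exp (- y) - 1) * (exp (- \<delta> * y) - exp (- 2 * \<delta> * y)))) (nhds x)"
      using fl sg by eventually_elim (simp add: psi_wave_def psi_err_def c_def indicator_def)
    then show ?case by (subst isCont_cong) (auto intro!: continuous_intros)
  qed
qed

lemma integrable_powr_tail:
  assumes a: "1 < (a::real)"
  shows "integrable lborel (\<lambda>x. indicator {1<..} x * x powr (- a))"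
proof -
  have "set_integrable lborel (einterval (ereal 1) \<infinity>) (\<lambda>x. x powr (- a))"
  proof (rule interval_integral_FTC_nonneg(1)[where F = "\<lambda>x. x powr (1 - a) / (1 - a)" and A = "1 / (1 - a)" and B = 0])
    fix x assume "ereal 1 < ereal x"
    then have x: "1 < x" by simp
    show "((\<lambda>x. x powr (1 - a) / (1 - a)) has_real_derivative x powr (- a)) (at x)"
      using x a by (auto intro!: derivative_eq_intros)
    show "isCont (\<lambda>x. x powr (- a)) x" using x by (auto intro!: continuous_intros)
  next
    have "((\<lambda>x. x powr (1 - a) / (1 - a)) \<longlongrightarrow> 1 powr (1 - a) / (1 - a)) (at_right 1)"
      by (intro tendsto_intros) (use a in auto)
    then show "(((\<lambda>x. x powr (1 - a) / (1 - a)) \<circ> real_of_ereal) \<longlongrightarrow> 1 / (1 - a)) (at_right (ereal 1))"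
      unfolding ereal_tendsto_simps by simp
    show "(((\<lambda>x. x powr (1 - a) / (1 - a)) \<circ> real_of_ereal) \<longlongrightarrow> 0) (at_left \<infinity>)"
      unfolding ereal_tendsto_simps using a by real_asymp
  qed auto
  also have "einterval (ereal 1) \<infinity> = {1<..}" by (auto simp: einterval_def)
  finally show ?thesis by (simp add: set_integrable_def)
qed

lemma integrable_decay_sq: "integrable lborel (\<lambda>t. (decay t)\<^sup>2)"
proof -
  let ?h = "\<lambda>x::real. indicator {1<..} x * x powr (- (3 / 2))"
  have h: "integrable lborel ?h" by (rule integrable_powr_tail) simp
  have h': "integrable lborel (\<lambda>x. ?h (0 + (- 1) * x))" by (rule lborel_integrable_real_affine[OF h]) simp
  have i: "integrable lborel (indicator {-1..1} :: real \<Rightarrow> real)" by simp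
  have "(decay x)\<^sup>2 = indicator {-1..1} x + ?h x + ?h (0 + (- 1) * x)" for x
    unfolding decay_def by (auto simp: indicator_def powr_power abs_if)
  then show ?thesis using i h h' by simp
qed

text \<open>The transform is a difference between abscissae \<open>1 + \<delta>\<close> and
  \<open>1 + 2 * \<delta>\<close>, so the Lipschitz bound gives a factor \<open>\<delta>\<close>
  times a square integrable function of the height. The condition \<open>\<delta> \<le> 1/2\<close>
  keeps both abscissae at most 2.\<close>

lemma psi_wave_energy:
  obtains C where "C > 0" "\<And>\<delta>. 0 < \<delta> \<Longrightarrow> \<delta> \<le> 1/2 \<Longrightarrow> (LBINT x. (psi_wave \<delta> x)\<^sup>2) \<le> C * \<delta>\<^sup>2"
proof -
  obtain C where C: "C > 0"
    "\<And>\<sigma> \<sigma>' t. 1 < \<sigma> \<Longrightarrow> \<sigma> \<le> \<sigma>' \<Longrightarrow> \<sigma>' \<le> 2 \<Longrightarrow>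
      cmod (psi_transform (Complex \<sigma> t) - psi_transform (Complex \<sigma>' t)) \<le> C * decay t * (\<sigma>' - \<sigma>)"
    by (rule psi_transform_lipschitz) blast
  define W where "W = (LBINT t. (decay t)\<^sup>2)"
  have W: "0 \<le> W" unfolding W_def by simp
  show ?thesis
  proof (rule that[of "C\<^sup>2 * W / (2 * pi) + 1"])
    show "0 < C\<^sup>2 * W / (2 * pi) + 1" using W by (intro add_nonneg_pos divide_nonneg_pos mult_nonneg_nonneg) auto
    fix \<delta> :: real assume d: "0 < \<delta>" "\<delta> \<le> 1/2"
    have "2 * pi * (LBINT x. (psi_wave \<delta> x)\<^sup>2) \<le> (LBINT t. (C * \<delta>)\<^sup>2 * (decay t)\<^sup>2)"
    proof (rule plancherel_le[OF integrable_psi_wave[OF d(1)] abs_psi_wave_le[OF d(1)] AE_isCont_psi_wave])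
      show "integrable lborel (\<lambda>t. (C * \<delta>)\<^sup>2 * (decay t)\<^sup>2)" using integrable_decay_sq by simp
      fix t
      have "cmod (LBINT x. complex_of_real (psi_wave \<delta> x) * cis (- t * x)) \<le> C * decay t * \<delta>"
        using psi_wave_fourier[OF d(1), of t] C(2)[of "1 + \<delta>" "1 + 2 * \<delta>" t] d by (simp add: has_bochner_integral_iff)
      then have "(cmod (LBINT x. complex_of_real (psi_wave \<delta> x) * cis (- t * x)))\<^sup>2 \<le> (C * decay t * \<delta>)\<^sup>2"
        by (intro power_mono) auto
      then show "(cmod (LBINT x. complex_of_real (psi_wave \<delta> x) * cis (- t * x)))\<^sup>2 \<le> (C * \<delta>)\<^sup>2 * (decay t)\<^sup>2"
        by (simp add: power_mult_distrib mult_ac)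
    qed
    also have "\<dots> = C\<^sup>2 * W * \<delta>\<^sup>2" unfolding W_def by (simp add: power_mult_distrib)
    finally have "(LBINT x. (psi_wave \<delta> x)\<^sup>2) \<le> C\<^sup>2 * W / (2 * pi) * \<delta>\<^sup>2"
      by (simp add: field_simps)
    also have "\<dots> \<le> (C\<^sup>2 * W / (2 * pi) + 1) * \<delta>\<^sup>2" by (intro mult_right_mono) auto
    finally show "(LBINT x. (psi_wave \<delta> x)\<^sup>2) \<le> (C\<^sup>2 * W / (2 * pi) + 1) * \<delta>\<^sup>2" .
  qed
qed

lemma psi_err_measurable [measurable]: "psi_err \<in> borel_measurable borel"
proof -
  have "mono (\<lambda>x. psi (exp x))" by (intro monoI psi_mono) simp
  then have "(\<lambda>x. psi (exp x)) \<in> borel_measurable borel" by (rule borel_measurable_mono)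
  then show ?thesis unfolding psi_err_def by measurable
qed

lemma integrable_Ioc_bounded:
  fixes g :: "real \<Rightarrow> real"
  assumes [measurable]: "g \<in> borel_measurable borel" and B: "\<And>x. a < x \<Longrightarrow> x \<le> b \<Longrightarrow> \<bar>g x\<bar> \<le> B"
  shows "integrable lborel (\<lambda>x. indicator {a<..b} x * g x)"
proof (rule Bochner_Integration.integrable_bound)
  have "emeasure lborel {a<..b} < \<infinity>" by (cases "a \<le> b") auto
  then show "integrable lborel (\<lambda>x. indicator {a<..b} x * \<bar>B\<bar>)" by (auto intro!: integrable_real_indicator)
  show "AE x in lborel. norm (indicator {a<..b} x * g x) \<le> norm (indicator {a<..b} x * \<bar>B\<bar>)"
  proof (rule AE_I2)
    fix x show "norm (indicator {a<..b} x * g x) \<le> norm (indicator {a<..b} x * \<bar>B\<bar>)"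
      using B[of x] by (auto simp: indicator_def)
  qed
qed measurable

text \<open>The lower half of the comparability of the weight in \<open>psi_wave\<close>; factoring
  out \<open>exp (- 2 * x)\<close> leaves \<open>exp x - 1\<close>.\<close>

lemma exp_diff_ge:
  fixes x :: real
  assumes x: "0 \<le> x" "x \<le> 1"
  shows "exp (- 2) * x \<le> exp (- x) - exp (- 2 * x)"
proof -
  have "exp (- 2) * x \<le> exp (- 2 * x) * (exp x - 1)"
  proof (intro mult_mono)
    show "x \<le> exp x - 1" using exp_ge_add_one_self[of x] by linarith
  qed (use x in auto)
  also have "\<dots> = exp (- x) - exp (- 2 * x)" by (simp add: algebra_simps exp_add[symmetric])
  finally show ?thesis .
qed

text \<open>With damping \<open>1 / V\<close> the weight is at least
  \<open>exp (- 2) * x / V\<close> on \<open>[0, V]\<close>, so the integral of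
  \<open>x\<^sup>2 * (psi_err x)\<^sup>2\<close> is at most \<open>exp 4 * V\<^sup>2\<close> times
  an energy of order \<open>1 / V\<^sup>2\<close>. The powers of \<open>V\<close> cancel, and the
  bound is uniform in \<open>V\<close>.\<close>

lemma psi_err_integral_bound:
  obtains C where "C > 0" "\<And>V. (LBINT x. indicator {0<..V} x * \<bar>psi_err x\<bar>) \<le> C"
proof -
  obtain C where C: "C > 0" "\<And>\<delta>. 0 < \<delta> \<Longrightarrow> \<delta> \<le> 1/2 \<Longrightarrow> (LBINT x. (psi_wave \<delta> x)\<^sup>2) \<le> C * \<delta>\<^sup>2"
    by (rule psi_wave_energy) blast
  define T where "T = (LBINT x::real. indicator {1<..} x * x powr (- 2))"
  have T: "0 \<le> T" unfolding T_def by simp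
  have Ti: "integrable lborel (\<lambda>x::real. indicator {1<..} x * x powr (- 2))" by (rule integrable_powr_tail) simp
  define B where "B = 3 + exp 4 * C + T"
  have big: "(LBINT x. indicator {0<..V} x * \<bar>psi_err x\<bar>) \<le> B" if V: "2 \<le> V" for V
  proof -
    let ?h = "\<lambda>x. indicator {0<..1} x * 3 + (exp 4 * V\<^sup>2) * (psi_wave (1 / V) x)\<^sup>2 + indicator {1<..} x * x powr (- 2)"
    have dV: "0 < 1 / V" "1 / V \<le> 1/2" using V by auto
    have sq: "integrable lborel (\<lambda>x. (psi_wave (1 / V) x)\<^sup>2)"
    proof (rule Bochner_Integration.integrable_bound)
      show "integrable lborel (\<lambda>x. 3 * psi_wave (1 / V) x)" using integrable_psi_wave[OF dV(1)] by simp
      show "(\<lambda>x. (psi_wave (1 / V) x)\<^sup>2) \<in> borel_measurable lborel"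
        using integrable_psi_wave[OF dV(1)] by (intro borel_measurable_power) auto
      show "AE x in lborel. norm ((psi_wave (1 / V) x)\<^sup>2) \<le> norm (3 * psi_wave (1 / V) x)"
      proof (rule AE_I2)
        fix x
        have "\<bar>psi_wave (1 / V) x\<bar> * \<bar>psi_wave (1 / V) x\<bar> \<le> 3 * \<bar>psi_wave (1 / V) x\<bar>"
          using abs_psi_wave_le[OF dV(1)] by (intro mult_right_mono) auto
        then show "norm ((psi_wave (1 / V) x)\<^sup>2) \<le> norm (3 * psi_wave (1 / V) x)"
          by (simp add: power2_eq_square abs_mult)
      qed
    qed
    have "(LBINT x. indicator {0<..V} x * \<bar>psi_err x\<bar>) \<le> (LBINT x. ?h x)"
    proof (rule integral_mono)
      show "integrable lborel (\<lambda>x. indicator {0<..V} x * \<bar>psi_err x\<bar>)"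
        by (rule integrable_Ioc_bounded[where B = 3]) (use abs_psi_err_le in auto)
      show "integrable lborel ?h"
        using sq Ti by (intro Bochner_Integration.integrable_add) auto
      fix x :: real
      show "indicator {0<..V} x * \<bar>psi_err x\<bar> \<le> ?h x"
      proof (cases "0 < x \<and> x \<le> V")
        case False
        then show ?thesis by (auto simp: indicator_def)
      next
        case x: True
        show ?thesis
        proof (cases "x \<le> 1")
          case True
          have "\<bar>psi_err x\<bar> \<le> 3" by (rule abs_psi_err_le)
          moreover have "0 \<le> (exp 4 * V\<^sup>2) * (psi_wave (1 / V) x)\<^sup>2" by simp
          ultimately have "\<bar>psi_err x\<bar> \<le> 3 + (exp 4 * V\<^sup>2) * (psi_wave (1 / V) x)\<^sup>2" by linarith
          then show ?thesis using True x by (simp add: indicator_def)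
        next
          case False
          define y where "y = x / V"
          have y: "0 \<le> y" "y \<le> 1" using x V by (auto simp: y_def)
          have w: "psi_wave (1 / V) x = psi_err x * (exp (- y) - exp (- 2 * y))"
            using x by (simp add: psi_wave_def y_def indicator_def)
          have "(psi_err x)\<^sup>2 * (exp (- 2) * y)\<^sup>2 \<le> (psi_err x)\<^sup>2 * (exp (- y) - exp (- 2 * y))\<^sup>2"
            using exp_diff_ge[OF y] y by (intro mult_left_mono power_mono) auto
          then have 1: "(psi_err x)\<^sup>2 * (exp (- 2) * y)\<^sup>2 \<le> (psi_wave (1 / V) x)\<^sup>2" unfolding w by (simp add: power_mult_distrib)
          have e4: "exp 4 * (exp (- 2))\<^sup>2 = (1::real)" by (simp add: power2_eq_square mult_exp_exp)
          have "x\<^sup>2 * (psi_err x)\<^sup>2 = (exp 4 * V\<^sup>2) * ((psi_err x)\<^sup>2 * (exp (- 2) * y)\<^sup>2)"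
          proof -
            have "(exp 4 * V\<^sup>2) * ((psi_err x)\<^sup>2 * (exp (- 2) * y)\<^sup>2) = (exp 4 * (exp (- 2))\<^sup>2) * ((V * y)\<^sup>2 * (psi_err x)\<^sup>2)"
              by (simp add: power_mult_distrib mult_ac)
            also have "\<dots> = x\<^sup>2 * (psi_err x)\<^sup>2"
            proof -
              have "V * y = x" using V by (simp add: y_def)
              then show ?thesis by (simp only: e4 mult_1_left)
            qed
            finally show ?thesis by (rule sym)
          qed
          also have "\<dots> \<le> (exp 4 * V\<^sup>2) * (psi_wave (1 / V) x)\<^sup>2" using 1 by (intro mult_left_mono) auto
          finally have 2: "x\<^sup>2 * (psi_err x)\<^sup>2 \<le> (exp 4 * V\<^sup>2) * (psi_wave (1 / V) x)\<^sup>2" .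
          \<comment> \<open>Cauchy-Schwarz in pointwise form: the inequality between the means of
            \<open>x * \<bar>psi_err x\<bar>\<close> and \<open>1 / x\<close>, whose square is
            integrable beyond 1.\<close>
          have "0 \<le> (x * \<bar>psi_err x\<bar> - 1 / x)\<^sup>2" by simp
          also have "\<dots> = x\<^sup>2 * (psi_err x)\<^sup>2 - 2 * \<bar>psi_err x\<bar> + 1 / x\<^sup>2"
            using x by (simp add: power2_eq_square field_simps)
          finally have "2 * \<bar>psi_err x\<bar> \<le> x\<^sup>2 * (psi_err x)\<^sup>2 + 1 / x\<^sup>2" by simp
          also have "1 / x\<^sup>2 = x powr (- 2)" using x by (simp add: powr_minus divide_inverse)
          finally have 3: "2 * \<bar>psi_err x\<bar> \<le> (exp 4 * V\<^sup>2) * (psi_wave (1 / V) x)\<^sup>2 + x powr (- 2)" using 2 by linarith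
          have "\<bar>psi_err x\<bar> \<le> (exp 4 * V\<^sup>2) * (psi_wave (1 / V) x)\<^sup>2 + x powr (- 2)"
            using 3 abs_ge_zero[of "psi_err x"] by linarith
          then show ?thesis using x False by (simp add: indicator_def)
        qed
      qed
    qed
    also have "(LBINT x. ?h x) = 3 + (exp 4 * V\<^sup>2) * (LBINT x. (psi_wave (1 / V) x)\<^sup>2) + T"
      unfolding T_def using sq Ti by (subst Bochner_Integration.integral_add) (auto simp: Bochner_Integration.integral_add)
    also have "\<dots> \<le> 3 + (exp 4 * V\<^sup>2) * (C * (1 / V)\<^sup>2) + T"
      using C(2)[OF dV] by (intro add_mono mult_left_mono) auto
    also have "\<dots> = B" unfolding B_def using V by (simp add: power2_eq_square)
    finally show ?thesis .
  qed
  show ?thesis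
  proof (rule that[of B])
    show "B > 0" unfolding B_def using C T by (simp add: add_pos_nonneg)
    fix V :: real
    have "(LBINT x. indicator {0<..V} x * \<bar>psi_err x\<bar>) \<le> (LBINT x. indicator {0<..max 2 V} x * \<bar>psi_err x\<bar>)"
      by (intro integral_mono integrable_Ioc_bounded[where B = 3])
         (use abs_psi_err_le in \<open>auto simp: indicator_def\<close>)
    also have "\<dots> \<le> B" by (rule big) simp
    finally show "(LBINT x. indicator {0<..V} x * \<bar>psi_err x\<bar>) \<le> B" .
  qed
qed

text \<open>The sum is compared with the integral of \<open>\<bar>psi_err\<bar>\<close> over the
  intervals between \<open>ln (v / (m + 1))\<close> and \<open>ln (v / m)\<close>. Each has length
  at least \<open>1 / (2 * m)\<close>, and the error there carries a factor of at most
  \<open>v / m\<close>, so \<open>m\<close> cancels and \<open>2 * v\<close> times the total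
  integral remains.\<close>

lemma psi_err_sum_bound:
  obtains C where "C > 0" "\<And>v. 1 \<le> v \<Longrightarrow> (\<Sum>m\<in>upto_real v. \<bar>psi (v / real m) - v / real m\<bar>) \<le> C * v"
proof -
  obtain C where C: "C > 0" "\<And>V. (LBINT x. indicator {0<..V} x * \<bar>psi_err x\<bar>) \<le> C"
    by (rule psi_err_integral_bound) blast
  define J where "J = (\<lambda>V. LBINT x. indicator {0<..V} x * \<bar>psi_err x\<bar>)"
  have J0: "0 \<le> J V" for V unfolding J_def by (intro integral_nonneg_AE) auto
  have Ji: "integrable lborel (\<lambda>x. indicator {a<..b} x * \<bar>psi_err x\<bar>)" for a b
    by (rule integrable_Ioc_bounded[where B = 3]) (use abs_psi_err_le in auto)
  show ?thesis
  proof (rule that[of "2 * C + 10"])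
    show "2 * C + 10 > 0" using C by simp
    fix v :: real assume v: "1 \<le> v"
    define N where "N = nat \<lfloor>v\<rfloor>"
    have N: "1 \<le> N" "real N \<le> v" "v < real N + 1"
      unfolding N_def using v by (auto simp: le_nat_iff le_floor_iff)
    \<comment> \<open>The sum of two functions that increase in \<open>v / m\<close>: its drop from
      \<open>m\<close> to \<open>m + 1\<close> bounds the variation of their difference on that
      interval, and the drops telescope to \<open>O(v)\<close>.\<close>
    define D where "D = (\<lambda>m. psi (v / real m) + v / real m)"
    have step: "\<bar>psi (v / real m) - v / real m\<bar> \<le> (D m - D (Suc m)) + 2 * v * (J (ln (v / real m)) - J (ln (v / real (Suc m))))"
      if m: "1 \<le> m" "m < N" for m
    proof -
      have m1: "real (Suc m) \<le> v" using m N by (simp flip: of_nat_Suc)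
      define a where "a = ln (v / real (Suc m))"
      define b where "b = ln (v / real m)"
      have q: "1 \<le> v / real (Suc m)" "v / real (Suc m) \<le> v / real m" using m m1 v by (auto simp: field_simps)
      have a0: "0 \<le> a" unfolding a_def using q by simp
      have ab: "a \<le> b" unfolding a_def b_def using q by (intro ln_mono) linarith+
      have len: "1 / (2 * real m) \<le> b - a"
      proof -
        have "b - a = - ln (real m / real (Suc m))" unfolding a_def b_def using m v by (simp add: ln_div)
        also have "\<dots> \<ge> - (real m / real (Suc m) - 1)"
          using m by (intro le_imp_neg_le ln_le_minus_one) auto
        also have "- (real m / real (Suc m) - 1) = 1 / real (Suc m)" by (simp add: field_simps)
        also have "1 / real (Suc m) \<ge> 1 / (2 * real m)" using m by (intro divide_left_mono) auto
        finally show ?thesis .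
      qed
      define E where "E = \<bar>psi (v / real m) - v / real m\<bar>"
      have pt: "E \<le> (D m - D (Suc m)) + v / real m * \<bar>psi_err x\<bar>" if x: "a < x" "x \<le> b" for x
      proof -
        have ev: "exp b = v / real m" "exp a = v / real (Suc m)" unfolding a_def b_def using m v by auto
        have x1: "exp a \<le> exp x" "exp x \<le> exp b" using x by auto
        have p: "psi (exp a) \<le> psi (exp x)" "psi (exp x) \<le> psi (exp b)" using x1 by (auto intro: psi_mono)
        have "E \<le> (D m - D (Suc m)) + \<bar>psi (exp x) - exp x\<bar>"
          unfolding E_def D_def ev[symmetric] using x1 p by linarith
        also have "\<bar>psi (exp x) - exp x\<bar> = exp x * \<bar>psi_err x\<bar>"
        proof -
          have "exp x * psi_err x = psi (exp x) - exp x" unfolding psi_err_def by (simp add: exp_minus field_simps)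
          then show ?thesis by (metis abs_exp_cancel abs_mult)
        qed
        also have "exp x * \<bar>psi_err x\<bar> \<le> v / real m * \<bar>psi_err x\<bar>" using x1 ev by (intro mult_right_mono) auto
        finally show ?thesis by simp
      qed
      have "(b - a) * E = (LBINT x. indicator {a<..b} x * E)" using ab by simp
      also have "\<dots> \<le> (LBINT x. indicator {a<..b} x * (D m - D (Suc m)) + v / real m * (indicator {a<..b} x * \<bar>psi_err x\<bar>))"
      proof (rule integral_mono)
        show "integrable lborel (\<lambda>x. indicator {a<..b} x * E)"
          by (rule integrable_Ioc_bounded[where B = "\<bar>E\<bar>"]) auto
        show "integrable lborel (\<lambda>x. indicator {a<..b} x * (D m - D (Suc m)) + v / real m * (indicator {a<..b} x * \<bar>psi_err x\<bar>))"
          by (intro Bochner_Integration.integrable_add Bochner_Integration.integrable_mult_right Ji integrable_Ioc_bounded[where B = "\<bar>D m - D (Suc m)\<bar>"]) auto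
        fix x show "indicator {a<..b} x * E \<le> indicator {a<..b} x * (D m - D (Suc m)) + v / real m * (indicator {a<..b} x * \<bar>psi_err x\<bar>)"
          using pt[of x] by (auto simp: indicator_def)
      qed
      also have "\<dots> = (b - a) * (D m - D (Suc m)) + v / real m * (LBINT x. indicator {a<..b} x * \<bar>psi_err x\<bar>)"
      proof -
        have "integrable lborel (\<lambda>x. indicator {a<..b} x * (D m - D (Suc m)))"
          by (rule integrable_Ioc_bounded[where B = "\<bar>D m - D (Suc m)\<bar>"]) auto
        then show ?thesis using ab by (subst Bochner_Integration.integral_add) (auto intro!: Ji)
      qed
      also have "(LBINT x. indicator {a<..b} x * \<bar>psi_err x\<bar>) = J b - J a"
      proof -
        have "(LBINT x. indicator {a<..b} x * \<bar>psi_err x\<bar>)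
           = (LBINT x. indicator {0<..b} x * \<bar>psi_err x\<bar> - indicator {0<..a} x * \<bar>psi_err x\<bar>)"
          using a0 ab by (intro Bochner_Integration.integral_cong refl) (auto simp: indicator_def)
        then show ?thesis unfolding J_def by (subst (asm) Bochner_Integration.integral_diff) (auto intro!: Ji)
      qed
      finally have "(b - a) * (E - (D m - D (Suc m))) \<le> v / real m * (J b - J a)" by (simp add: algebra_simps)
      \<comment> \<open>The excess of \<open>E\<close> over the variation may be negative, and then
        the lower bound for the length cannot be inserted; the maximum with 0 covers both
        signs.\<close>
      moreover have "1 / (2 * real m) * (E - (D m - D (Suc m))) \<le> max 0 ((b - a) * (E - (D m - D (Suc m))))"
      proof (cases "0 \<le> E - (D m - D (Suc m))")
        case True
        then show ?thesis using mult_right_mono[OF len True] by simp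
      next
        case False
        then have "1 / (2 * real m) * (E - (D m - D (Suc m))) \<le> 0" by (intro mult_nonneg_nonpos) auto
        then show ?thesis by (rule max.coboundedI1)
      qed
      moreover have "0 \<le> J b - J a"
      proof -
        have "J a \<le> J b" unfolding J_def
          by (intro integral_mono Ji) (use ab in \<open>auto simp: indicator_def\<close>)
        then show ?thesis by simp
      qed
      ultimately have "1 / (2 * real m) * (E - (D m - D (Suc m))) \<le> v / real m * (J b - J a)"
        using v m by (smt (verit) divide_nonneg_nonneg mult_nonneg_nonneg of_nat_0_le_iff)
      then have "(2 * real m) * (1 / (2 * real m) * (E - (D m - D (Suc m)))) \<le> (2 * real m) * (v / real m * (J b - J a))"
        by (intro mult_left_mono) auto
      then have "E - (D m - D (Suc m)) \<le> 2 * v * (J b - J a)" using m by simp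
      then show ?thesis unfolding E_def a_def b_def by simp
    qed
    have "(\<Sum>m\<in>upto_real v. \<bar>psi (v / real m) - v / real m\<bar>)
        = (\<Sum>m\<in>{1..<N}. \<bar>psi (v / real m) - v / real m\<bar>) + \<bar>psi (v / real N) - v / real N\<bar>"
      using N unfolding upto_real_eq N_def[symmetric]
      by (subst atLeastLessThanSuc_atLeastAtMost[symmetric]) simp
    also have "(\<Sum>m\<in>{1..<N}. \<bar>psi (v / real m) - v / real m\<bar>)
       \<le> (\<Sum>m\<in>{1..<N}. (D m - D (Suc m)) + 2 * v * (J (ln (v / real m)) - J (ln (v / real (Suc m)))))"
      using step by (intro sum_mono) auto
    also have "\<dots> = (\<Sum>m\<in>{1..<N}. D m - D (Suc m)) + 2 * v * (\<Sum>m\<in>{1..<N}. J (ln (v / real m)) - J (ln (v / real (Suc m))))"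
      by (simp only: sum.distrib sum_distrib_left)
    also have "(\<Sum>m\<in>{1..<N}. D m - D (Suc m)) = D 1 - D N"
      using N by (simp add: sum_Suc_diff'[of 1 N "\<lambda>m. - D m", simplified])
    also have "(\<Sum>m\<in>{1..<N}. J (ln (v / real m)) - J (ln (v / real (Suc m)))) = J (ln (v / real 1)) - J (ln (v / real N))"
      using N sum_Suc_diff'[of 1 N "\<lambda>m. - J (ln (v / real m))"] by simp
    also have "D 1 - D N + 2 * v * (J (ln (v / real 1)) - J (ln (v / real N))) + \<bar>psi (v / real N) - v / real N\<bar>
       \<le> 5 * v + 2 * v * C + 5 * v"
    proof (intro add_mono mult_left_mono)
      have "0 \<le> D N" unfolding D_def using psi_nonneg v by simp
      then show "D 1 - D N \<le> 5 * v" using psi_le[of v] v unfolding D_def by simp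
      show "J (ln (v / real 1)) - J (ln (v / real N)) \<le> C" using C(2)[of "ln (v / real 1)"] J0[of "ln (v / real N)"] unfolding J_def by linarith
      have "v / real N \<le> v" "0 \<le> v / real N" using v N by (auto simp: field_simps)
      moreover have "psi (v / real N) \<le> 4 * (v / real N)" using calculation by (intro psi_le)
      ultimately show "\<bar>psi (v / real N) - v / real N\<bar> \<le> 5 * v" using psi_nonneg[of "v / real N"] by linarith
    qed (use v in auto)
    finally show "(\<Sum>m\<in>upto_real v. \<bar>psi (v / real m) - v / real m\<bar>) \<le> (2 * C + 10) * v" by (simp add: algebra_simps)
  qed
qed

section \<open>Moebius sums over rough numbers\<close>

definition primes_upto :: "real \<Rightarrow> nat set" where
  "primes_upto x = {p. prime p \<and> real p \<le> x}"

lemma primes_upto_subset: "primes_upto x \<subseteq> upto_real x"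
  unfolding primes_upto_def upto_real_def using prime_gt_0_nat by auto

lemma finite_primes_upto [simp]: "finite (primes_upto x)"
  using primes_upto_subset finite_upto_real finite_subset by blast

lemma card_upto_real_le: "0 \<le> x \<Longrightarrow> real (card (upto_real x)) \<le> x"
  unfolding upto_real_eq by simp

lemma upto_real_mono: "x \<le> y \<Longrightarrow> upto_real x \<subseteq> upto_real y"
  unfolding upto_real_def by auto

lemma dvd_upto_real:
  assumes "n \<in> upto_real v" "q dvd n"
  shows "q \<in> upto_real v"
proof -
  have n: "0 < n" "real n \<le> v" using assms by (auto simp: upto_real_def)
  have "q \<le> n" using assms n by (intro dvd_imp_le)
  then have "real q \<le> v" using n by linarith
  moreover have "0 < q" using assms n by (auto intro: dvd_pos_nat)
  ultimately show ?thesis by (simp add: upto_real_def)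
qed

lemma upto_real_multiples:
  assumes "0 < q"
  shows "{n\<in>upto_real v. q dvd n} = (*) q ` upto_real (v / real q)"
proof (intro equalityI subsetI)
  fix n assume n: "n \<in> {n\<in>upto_real v. q dvd n}"
  then obtain k where k: "n = q * k" by auto
  then have "k \<in> upto_real (v / real q)" using n assms by (auto simp: upto_real_def field_simps)
  then show "n \<in> (*) q ` upto_real (v / real q)" using k by blast
next
  fix n assume "n \<in> (*) q ` upto_real (v / real q)"
  then obtain k where "n = q * k" "k \<in> upto_real (v / real q)" by (rule imageE)
  then show "n \<in> {n\<in>upto_real v. q dvd n}" using assms by (auto simp: upto_real_def field_simps)
qed

lemma sum_inverse_sqrt_le: "(\<Sum>m=1..N. 1 / sqrt (real m)) \<le> 2 * sqrt (real N)"
proof (induction N)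
  case (Suc N)
  have "1 / sqrt (real (Suc N)) \<le> 2 * sqrt (real (Suc N)) - 2 * sqrt (real N)"
  proof -
    let ?a = "sqrt (real (Suc N))" and ?b = "sqrt (real N)"
    have a: "0 < ?a" by simp
    have sq: "?a * ?a = real N + 1" "?b * ?b = real N" by (simp_all del: of_nat_Suc) 
    have "0 \<le> (?a - ?b) * (?a - ?b)" by simp
    then have "2 * ?a * ?b \<le> 2 * (?a * ?a) - 1" using sq by (simp add: algebra_simps)
    then have "1 \<le> (2 * ?a - 2 * ?b) * ?a" by (simp add: algebra_simps)
    then show ?thesis using a by (simp add: pos_divide_le_eq)
  qed
  then show ?case using Suc by simp
qed simp

lemma sum_sqrt_div_le:
  assumes v: "1 \<le> v"
  shows "(\<Sum>m\<in>upto_real v. sqrt (v / real m)) \<le> 2 * v"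
proof -
  have "(\<Sum>m\<in>upto_real v. sqrt (v / real m)) = sqrt v * (\<Sum>m=1..nat \<lfloor>v\<rfloor>. 1 / sqrt (real m))"
    unfolding upto_real_eq by (simp add: real_sqrt_divide sum_distrib_left)
  also have "\<dots> \<le> sqrt v * (2 * sqrt (real (nat \<lfloor>v\<rfloor>)))"
    using v by (intro mult_left_mono sum_inverse_sqrt_le) auto
  also have "\<dots> \<le> sqrt v * (2 * sqrt v)"
    using v by (intro mult_left_mono real_sqrt_le_mono) auto
  also have "\<dots> = 2 * v" using v by simp
  finally show ?thesis .
qed

definition theta :: "real \<Rightarrow> real" where
  "theta x = (\<Sum>p\<in>primes_upto x. ln (real p))"

lemma theta_le_psi: "theta x \<le> psi x"
proof -
  have "theta x = (\<Sum>p\<in>primes_upto x. mangoldt p)"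
    unfolding theta_def by (intro sum.cong refl) (auto simp: primes_upto_def)
  also have "\<dots> \<le> psi x" unfolding psi_def
    by (intro sum_mono2 primes_upto_subset) (auto simp: mangoldt_real_nonneg)
  finally show ?thesis .
qed

lemma theta_le: "0 \<le> x \<Longrightarrow> theta x \<le> 4 * x"
  using theta_le_psi[of x] psi_le[of x] by linarith

lemma theta_nonneg: "0 \<le> theta x"
  unfolding theta_def by (intro sum_nonneg ln_real_nat_nonneg)

text \<open>A proper prime power \<open>p\<^sup>k\<close> is \<open>q\<^sup>2\<close> or \<open>q\<^sup>2 p\<close> for the prime power \<open>q = p\<^sup>k\<^sup>/\<^sup>2\<close> (exponent rounded down).\<close>
lemma psi_minus_theta_le:
  assumes x: "0 \<le> x"
  shows "psi x - theta x \<le> 8 * sqrt x"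
proof -
  define A where "A = {n\<in>upto_real x. primepow n \<and> \<not> prime n}"
  define Q where "Q = {q\<in>upto_real (sqrt x). primepow q}"
  \<comment> \<open>The flag is the parity of the exponent, and \<open>aprimedivisor q\<close>
    recovers the base prime. Since \<open>mangoldt (g z)\<close> depends only on \<open>q\<close>,
    each prime power up to \<open>sqrt x\<close> is counted twice.\<close>
  define g where "g = (\<lambda>(q::nat, b::bool). q\<^sup>2 * (if b then aprimedivisor q else 1))"
  have fA: "finite A" and fQ: "finite Q" unfolding A_def Q_def by auto
  have "theta x = (\<Sum>n\<in>primes_upto x. mangoldt n)"
    unfolding theta_def by (intro sum.cong refl) (auto simp: primes_upto_def)
  then have "psi x - theta x = (\<Sum>n\<in>upto_real x - primes_upto x. mangoldt n)"
    unfolding psi_def using primes_upto_subset by (simp add: sum_diff)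
  also have "\<dots> = (\<Sum>n\<in>A. mangoldt n)"
  proof (rule sum.mono_neutral_right)
    show "finite (upto_real x - primes_upto x)" by (intro finite_Diff finite_upto_real)
  qed (auto simp: A_def primes_upto_def upto_real_def mangoldt_def)
  also have "\<dots> \<le> (\<Sum>n\<in>g ` (Q \<times> UNIV). mangoldt n)"
  proof (intro sum_mono2 subsetI mangoldt_real_nonneg)
    show "finite (g ` (Q \<times> UNIV))" using fQ by auto
    fix n assume n: "n \<in> A"
    then obtain p k where pk: "prime p" "k > 0" "n = p ^ k" unfolding A_def primepow_def by auto
    have "k \<noteq> 1" using n pk unfolding A_def by auto
    then have k2: "k div 2 > 0" using pk by auto
    define q where "q = p ^ (k div 2)"
    have ap: "aprimedivisor q = p" unfolding q_def using pk k2 by (simp add: aprimedivisor_prime_power)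
    have "p ^ k = p ^ (2 * (k div 2) + k mod 2)" by simp
    also have "\<dots> = q\<^sup>2 * p ^ (k mod 2)" unfolding q_def power_add by (simp add: power_mult[symmetric] mult.commute)
    finally have nq: "n = q\<^sup>2 * p ^ (k mod 2)" using pk by simp
    have p0: "p > 0" using pk(1) by (rule prime_gt_0_nat)
    have gn: "g (q, odd k) = n" unfolding g_def nq by (auto simp: ap odd_iff_mod_2_eq_one even_iff_mod_2_eq_zero)
    have "q\<^sup>2 \<le> n" using nq p0 by simp
    then have "real (q\<^sup>2) \<le> real n" by (rule of_nat_mono)
    also have "real n \<le> x" using n unfolding A_def upto_real_def by auto
    finally have "real q \<le> sqrt x" by (simp add: real_le_rsqrt)
    moreover have "primepow q" unfolding q_def using pk k2 by (auto simp: primepow_def)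
    moreover have "q > 0" unfolding q_def using p0 by simp
    ultimately have "q \<in> Q" unfolding Q_def upto_real_def by auto
    then show "n \<in> g ` (Q \<times> UNIV)" using gn by (intro image_eqI[of _ _ "(q, odd k)"]) auto
  qed
  also have "\<dots> \<le> (\<Sum>z\<in>Q \<times> UNIV. mangoldt (g z))"
    using fQ mangoldt_real_nonneg by (intro sum_image_le[unfolded o_def]) auto
  also have "\<dots> = (\<Sum>z\<in>Q \<times> (UNIV :: bool set). mangoldt (fst z))"
  proof (intro sum.cong refl)
    fix z assume z: "z \<in> Q \<times> (UNIV :: bool set)"
    obtain q b where qb: "z = (q, b)" by (cases z)
    have "primepow q" using z qb unfolding Q_def by auto
    then obtain p k where pk: "prime p" "k > 0" "q = p ^ k" unfolding primepow_def by auto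
    have ap: "aprimedivisor q = p" using pk by (simp add: aprimedivisor_prime_power)
    have "g z = p ^ (2 * k + (if b then 1 else 0))"
      unfolding g_def qb using ap pk by (simp add: power_add power_mult[symmetric] mult.commute)
    then show "mangoldt (g z) = (mangoldt (fst z) :: real)"
      using pk qb by (simp add: mangoldt_primepow)
  qed
  also have "\<dots> = (\<Sum>q\<in>Q. \<Sum>b\<in>(UNIV :: bool set). mangoldt q)"
    unfolding sum.cartesian_product by (simp only: case_prod_unfold)
  also have "\<dots> = 2 * (\<Sum>q\<in>Q. mangoldt q)" by (simp add: sum_distrib_left UNIV_bool)
  also have "\<dots> \<le> 2 * psi (sqrt x)"
    unfolding psi_def Q_def by (intro mult_left_mono sum_mono2) (auto simp: mangoldt_real_nonneg)
  also have "\<dots> \<le> 2 * (4 * sqrt x)" using x by (intro mult_left_mono psi_le) auto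
  finally show ?thesis by simp
qed

text \<open>Proper prime powers add \<open>8 * sqrt (v / m)\<close> to each term, and these square
  roots sum to at most \<open>16 * v\<close>.\<close>

lemma theta_err_sum_bound:
  obtains C where "C > 0" "\<And>v. 1 \<le> v \<Longrightarrow> (\<Sum>m\<in>upto_real v. \<bar>theta (v / real m) - v / real m\<bar>) \<le> C * v"
proof -
  obtain C where C: "C > 0" "\<And>v. 1 \<le> v \<Longrightarrow> (\<Sum>m\<in>upto_real v. \<bar>psi (v / real m) - v / real m\<bar>) \<le> C * v"
    by (rule psi_err_sum_bound) blast
  show ?thesis
  proof (rule that[of "C + 16"])
    show "C + 16 > 0" using C by simp
    fix v :: real assume v: "1 \<le> v"
    have "(\<Sum>m\<in>upto_real v. \<bar>theta (v / real m) - v / real m\<bar>)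
       \<le> (\<Sum>m\<in>upto_real v. \<bar>psi (v / real m) - v / real m\<bar> + 8 * sqrt (v / real m))"
    proof (intro sum_mono)
      fix m
      have "psi (v / real m) - theta (v / real m) \<le> 8 * sqrt (v / real m)"
        using v by (intro psi_minus_theta_le) auto
      then show "\<bar>theta (v / real m) - v / real m\<bar> \<le> \<bar>psi (v / real m) - v / real m\<bar> + 8 * sqrt (v / real m)"
        using theta_le_psi[of "v / real m"] by linarith
    qed
    also have "\<dots> = (\<Sum>m\<in>upto_real v. \<bar>psi (v / real m) - v / real m\<bar>) + 8 * (\<Sum>m\<in>upto_real v. sqrt (v / real m))"
      by (simp add: sum.distrib sum_distrib_left)
    also have "\<dots> \<le> C * v + 8 * (2 * v)" by (intro add_mono mult_left_mono C sum_sqrt_div_le v) simp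
    finally show "(\<Sum>m\<in>upto_real v. \<bar>theta (v / real m) - v / real m\<bar>) \<le> (C + 16) * v" by (simp add: algebra_simps)
  qed
qed

section \<open>The Moebius function on integers with primes from a given set\<close>

text \<open>An arbitrary set of primes rather than a lower bound on them, because extracting a prime
  has to delete it from the set.\<close>

definition mu_on :: "nat set \<Rightarrow> nat \<Rightarrow> real" where
  "mu_on P n = (if prime_factors n \<subseteq> P then real_of_int (moebius_mu n) else 0)"

lemma abs_mu_on_le: "\<bar>mu_on P n\<bar> \<le> 1"
  by (simp add: mu_on_def moebius_mu_def abs_if power_abs)

lemma mu_on_not_squarefree: "\<not> squarefree n \<Longrightarrow> mu_on P n = 0"
  by (simp add: mu_on_def moebius_mu_def)

lemma squarefree_prime_mult:
  assumes "prime (q::nat)" "0 < m"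
  shows "squarefree (q * m) \<longleftrightarrow> squarefree m \<and> \<not> q dvd m"
proof
  assume s: "squarefree (q * m)"
  have "\<not> q dvd m"
  proof
    assume "q dvd m"
    then have "q\<^sup>2 dvd q * m" by (simp add: power2_eq_square)
    then have "q dvd 1" using s unfolding squarefree_def by blast
    then show False using assms by simp
  qed
  then show "squarefree m \<and> \<not> q dvd m" using squarefree_multD[OF s] by simp
next
  assume m: "squarefree m \<and> \<not> q dvd m"
  then have "coprime q m" using assms by (intro prime_imp_coprime) auto
  then show "squarefree (q * m)" using m squarefree_prime[OF assms(1)] by (intro squarefree_mult_coprime) auto
qed

lemma prime_factors_prime_mult:
  assumes "prime (q::nat)" "0 < m"
  shows "prime_factors (q * m) = insert q (prime_factors m)"
proof -
  have "q \<noteq> 0" "m \<noteq> 0" using assms prime_gt_0_nat by auto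
  then show ?thesis by (simp add: prime_factors_product prime_prime_factors[OF assms(1)])
qed

lemma omega_prime_mult:
  assumes "prime q" "0 < m" "\<not> q dvd m"
  shows "omega (q * m) = Suc (omega m)"
proof -
  have "prime_factors (q * m) = insert q (prime_factors m)" by (rule prime_factors_prime_mult[OF assms(1,2)])
  then show ?thesis using assms unfolding omega_def by (simp add: in_prime_factors_iff)
qed

text \<open>Squarefreeness forces the cofactor to avoid \<open>q\<close>; removing \<open>q\<close>
  from the set expresses this without a coprimality condition.\<close>

lemma mu_on_prime_mult:
  assumes q: "prime q" and m: "0 < m"
  shows "mu_on P (q * m) = (if q \<in> P then - mu_on (P - {q}) m else 0)"
proof (cases "squarefree m \<and> \<not> q dvd m")
  case True
  have pf: "prime_factors (q * m) = insert q (prime_factors m)"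
    by (rule prime_factors_prime_mult[OF q m])
  have "q \<notin> prime_factors m" using True by (simp add: in_prime_factors_iff)
  then have e: "insert q (prime_factors m) \<subseteq> P \<longleftrightarrow> q \<in> P \<and> prime_factors m \<subseteq> P - {q}" by blast
  have "squarefree (q * m)" "squarefree m" "omega (q * m) = Suc (omega m)"
    using True squarefree_prime_mult[OF q m] omega_prime_mult[OF q m] by auto
  then have mu: "moebius_mu (q * m) = - moebius_mu m" unfolding moebius_mu_def by simp
  show ?thesis unfolding mu_on_def pf e mu by auto
next
  case False
  then have 0: "mu_on P (q * m) = 0" using squarefree_prime_mult[OF q m] by (intro mu_on_not_squarefree) simp
  have "mu_on (P - {q}) m = 0"
  proof (cases "q dvd m")
    case True
    then have "q \<in> prime_factors m" using q m by (simp add: in_prime_factors_iff)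
    then show ?thesis by (auto simp: mu_on_def)
  next
    case qm: False
    then show ?thesis using False by (intro mu_on_not_squarefree) simp
  qed
  then show ?thesis using 0 by simp
qed

text \<open>The common extraction step: n is written as \<open>q * m\<close> for each of its prime
  factors and the sums are interchanged. It is used with weight \<open>ln q\<close> for the bound of
  Mertens type, with weights in \<open>omega\<close> for the moments, and with a weight that singles
  out the least prime factor.\<close>

lemma sum_mu_on_prime_factors:
  fixes c :: "nat \<Rightarrow> nat \<Rightarrow> real"
  shows "(\<Sum>n\<in>upto_real v. mu_on P n * (\<Sum>q\<in>prime_factors n. c q (n div q)))
       = - (\<Sum>q\<in>primes_upto v \<inter> P. \<Sum>m\<in>upto_real (v / real q). mu_on (P - {q}) m * c q m)"
proof -
  have "(\<Sum>n\<in>upto_real v. mu_on P n * (\<Sum>q\<in>prime_factors n. c q (n div q)))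
      = (\<Sum>n\<in>upto_real v. \<Sum>q\<in>{q\<in>primes_upto v. q dvd n}. mu_on P n * c q (n div q))"
  proof (intro sum.cong refl)
    fix n assume n: "n \<in> upto_real v"
    have "prime_factors n = {q\<in>primes_upto v. q dvd n}"
    proof (intro equalityI subsetI)
      fix q assume "q \<in> prime_factors n"
      then have q: "prime q" "q dvd n" by auto
      then show "q \<in> {q\<in>primes_upto v. q dvd n}"
        using dvd_upto_real[OF n q(2)] by (simp add: primes_upto_def upto_real_def)
    next
      fix q assume "q \<in> {q\<in>primes_upto v. q dvd n}"
      then show "q \<in> prime_factors n" using n by (simp add: in_prime_factors_iff primes_upto_def upto_real_def)
    qed
    then show "mu_on P n * (\<Sum>q\<in>prime_factors n. c q (n div q)) = (\<Sum>q\<in>{q\<in>primes_upto v. q dvd n}. mu_on P n * c q (n div q))"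
      by (simp add: sum_distrib_left)
  qed
  also have "\<dots> = (\<Sum>q\<in>primes_upto v. \<Sum>n\<in>{n\<in>upto_real v. q dvd n}. mu_on P n * c q (n div q))"
    by (intro sum.swap_restrict) auto
  also have "\<dots> = (\<Sum>q\<in>primes_upto v. if q \<in> P then - (\<Sum>m\<in>upto_real (v / real q). mu_on (P - {q}) m * c q m) else 0)"
  proof (intro sum.cong refl)
    fix q assume "q \<in> primes_upto v"
    then have q: "prime q" "q > 0" by (auto simp: primes_upto_def prime_gt_0_nat)
    have "(\<Sum>n\<in>{n\<in>upto_real v. q dvd n}. mu_on P n * c q (n div q))
        = (\<Sum>m\<in>upto_real (v / real q). mu_on P (q * m) * c q m)"
      unfolding upto_real_multiples[OF q(2)] using q by (subst sum.reindex) (auto simp: inj_on_def)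
    also have "\<dots> = (\<Sum>m\<in>upto_real (v / real q). (if q \<in> P then - mu_on (P - {q}) m else 0) * c q m)"
      by (intro sum.cong refl) (use q in \<open>auto simp: mu_on_prime_mult upto_real_def\<close>)
    also have "\<dots> = (if q \<in> P then - (\<Sum>m\<in>upto_real (v / real q). mu_on (P - {q}) m * c q m) else 0)"
      by (simp add: sum_negf)
    finally show "(\<Sum>n\<in>{n\<in>upto_real v. q dvd n}. mu_on P n * c q (n div q))
       = (if q \<in> P then - (\<Sum>m\<in>upto_real (v / real q). mu_on (P - {q}) m * c q m) else 0)" .
  qed
  also have "\<dots> = - (\<Sum>q\<in>primes_upto v \<inter> P. \<Sum>m\<in>upto_real (v / real q). mu_on (P - {q}) m * c q m)"
    unfolding sum_negf[symmetric] by (rule sum.inter_restrict[symmetric]) simp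
  finally show ?thesis .
qed

text \<open>If some \<open>q\<close> in \<open>P\<close> divides n, divisors \<open>d\<close> free
  of \<open>q\<close> cancel against \<open>q * d\<close>; divisors with a repeated \<open>q\<close>
  contribute nothing. Otherwise only \<open>d = 1\<close> is left.\<close>

lemma sum_mu_on_divisors:
  assumes n: "0 < n"
  shows "(\<Sum>d | d dvd n. mu_on P d) = (if prime_factors n \<inter> P = {} then 1 else 0)"
proof (cases "prime_factors n \<inter> P = {}")
  case True
  have "(\<Sum>d | d dvd n. mu_on P d) = (\<Sum>d\<in>{1}. mu_on P d)"
  proof (rule sum.mono_neutral_right)
    show "\<forall>d\<in>{d. d dvd n} - {1}. mu_on P d = 0"
    proof
      fix d assume d: "d \<in> {d. d dvd n} - {1}"
      then obtain p where p: "prime p" "p dvd d" using prime_factor_nat[of d] by auto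
      have "d \<noteq> 0" using d n by auto
      then have "p \<in> prime_factors d" using p by (simp add: in_prime_factors_iff)
      moreover have "p \<in> prime_factors n" using p d n by (auto simp: in_prime_factors_iff intro: dvd_trans)
      ultimately show "mu_on P d = 0" using True by (auto simp: mu_on_def)
    qed
  qed (use n in auto)
  then show ?thesis using True by (simp add: mu_on_def moebius_mu_def omega_def)
next
  case False
  then obtain q where q: "q \<in> prime_factors n" "q \<in> P" by blast
  then have pq: "prime q" "q dvd n" "q > 0" by (auto simp: in_prime_factors_iff prime_gt_0_nat)
  let ?D = "{d. d dvd n}"
  have fD: "finite ?D" using n by simp
  have "(\<Sum>d\<in>{d\<in>?D. q dvd d}. mu_on P d) = (\<Sum>e\<in>{e. q * e dvd n}. mu_on P (q * e))"
  proof (rule sum.reindex_bij_witness[where i = "\<lambda>e. q * e" and j = "\<lambda>d. d div q"])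
  qed (use pq in auto)
  also have "\<dots> = (\<Sum>e\<in>{e. q * e dvd n}. - mu_on (P - {q}) e)"
    using q pq n by (intro sum.cong refl) (auto simp: mu_on_prime_mult intro!: Nat.gr0I)
  also have "\<dots> = (\<Sum>e\<in>{d\<in>?D. \<not> q dvd d}. - mu_on P e)"
  proof (rule sum.mono_neutral_cong_right)
    show "finite {e. q * e dvd n}" by (rule finite_subset[OF _ fD]) (auto intro: dvd_mult_right)
    show "{d\<in>?D. \<not> q dvd d} \<subseteq> {e. q * e dvd n}"
      using pq by (auto intro!: divides_mult simp: prime_imp_coprime)
    show "\<forall>e\<in>{e. q * e dvd n} - {d\<in>?D. \<not> q dvd d}. - mu_on (P - {q}) e = 0"
    proof
      fix e assume e: "e \<in> {e. q * e dvd n} - {d\<in>?D. \<not> q dvd d}"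
      then have "q dvd e" "e \<noteq> 0" using n by (auto intro: dvd_mult_right)
      then have "q \<in> prime_factors e" using pq by (simp add: in_prime_factors_iff)
      then show "- mu_on (P - {q}) e = 0" by (auto simp: mu_on_def)
    qed
    show "- mu_on (P - {q}) e = - mu_on P e" if "e \<in> {d\<in>?D. \<not> q dvd d}" for e
    proof -
      have "q \<notin> prime_factors e" using that by (auto simp: in_prime_factors_iff)
      then have e: "prime_factors e \<subseteq> P - {q} \<longleftrightarrow> prime_factors e \<subseteq> P" by blast
      show ?thesis unfolding mu_on_def e by (rule refl)
    qed
  qed
  finally have h: "(\<Sum>d\<in>{d\<in>?D. q dvd d}. mu_on P d) = - (\<Sum>e\<in>{d\<in>?D. \<not> q dvd d}. mu_on P e)"
    by (simp add: sum_negf)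
  have "(\<Sum>d\<in>?D. mu_on P d) = (\<Sum>d\<in>{d\<in>?D. q dvd d}. mu_on P d) + (\<Sum>d\<in>{d\<in>?D. \<not> q dvd d}. mu_on P d)"
    by (subst sum.union_disjoint[symmetric]) (auto intro!: sum.cong simp: fD)
  then show ?thesis using h False by simp
qed

text \<open>Weighted by the number of multiples of m up to \<open>x\<close>, the sum counts the
  integers with no prime factor in \<open>P\<close>, hence lies between 0 and \<open>x\<close>.
  Replacing that number by \<open>x / m\<close> costs less than 1 per term. The result is uniform in
  \<open>P\<close>.\<close>

lemma abs_sum_mu_on_div_le:
  assumes x: "0 < x"
  shows "\<bar>\<Sum>m\<in>upto_real x. mu_on P m / real m\<bar> \<le> 2"
proof -
  have card: "real (card (upto_real (x / real m))) \<le> x / real m" "x / real m \<le> real (card (upto_real (x / real m))) + 1" for m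
  proof -
    have "0 \<le> \<lfloor>x / real m\<rfloor>" using x by simp
    then have "real (card (upto_real (x / real m))) = real_of_int \<lfloor>x / real m\<rfloor>" unfolding upto_real_eq by simp
    then show "real (card (upto_real (x / real m))) \<le> x / real m" "x / real m \<le> real (card (upto_real (x / real m))) + 1"
      by linarith+
  qed
  have "(\<Sum>m\<in>upto_real x. mu_on P m * real (card (upto_real (x / real m))))
      = (\<Sum>m\<in>upto_real x. \<Sum>n\<in>{n\<in>upto_real x. m dvd n}. mu_on P m)"
  proof (intro sum.cong refl)
    fix m assume "m \<in> upto_real x"
    then have "m > 0" by (simp add: upto_real_def)
    then show "mu_on P m * real (card (upto_real (x / real m))) = (\<Sum>n\<in>{n\<in>upto_real x. m dvd n}. mu_on P m)"
      by (simp add: upto_real_multiples card_image inj_on_def)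
  qed
  also have "\<dots> = (\<Sum>n\<in>upto_real x. \<Sum>m\<in>{m\<in>upto_real x. m dvd n}. mu_on P m)"
    by (intro sum.swap_restrict) auto
  also have "\<dots> = (\<Sum>n\<in>upto_real x. if prime_factors n \<inter> P = {} then 1 else 0)"
  proof (intro sum.cong refl)
    fix n assume n: "n \<in> upto_real x"
    have "{m\<in>upto_real x. m dvd n} = {m. m dvd n}"
      using dvd_upto_real[OF n] by blast
    then show "(\<Sum>m\<in>{m\<in>upto_real x. m dvd n}. mu_on P m) = (if prime_factors n \<inter> P = {} then 1 else 0)"
      using n sum_mu_on_divisors[of n P] by (simp add: upto_real_def)
  qed
  finally have e: "(\<Sum>m\<in>upto_real x. mu_on P m * real (card (upto_real (x / real m)))) = (\<Sum>n\<in>upto_real x. if prime_factors n \<inter> P = {} then 1 else 0)" .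
  have "(\<Sum>n\<in>upto_real x. if prime_factors n \<inter> P = {} then 1 else 0) \<le> (\<Sum>n\<in>upto_real x. 1::real)"
    by (intro sum_mono) auto
  also have "\<dots> \<le> x" using card_upto_real_le[of x] x by simp
  finally have e1: "\<bar>\<Sum>m\<in>upto_real x. mu_on P m * real (card (upto_real (x / real m)))\<bar> \<le> x"
    unfolding e by (simp add: abs_of_nonneg sum_nonneg)
  have "\<bar>\<Sum>m\<in>upto_real x. mu_on P m * (x / real m - real (card (upto_real (x / real m))))\<bar>
      \<le> (\<Sum>m\<in>upto_real x. \<bar>mu_on P m\<bar> * \<bar>x / real m - real (card (upto_real (x / real m)))\<bar>)"
    unfolding abs_mult[symmetric] by (rule sum_abs)
  also have "\<dots> \<le> (\<Sum>m\<in>upto_real x. 1 * 1)"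
    using abs_mu_on_le card by (intro sum_mono mult_mono) (auto simp: abs_le_iff algebra_simps)
  also have "\<dots> \<le> x" using card_upto_real_le[of x] x by simp
  finally have e2: "\<bar>\<Sum>m\<in>upto_real x. mu_on P m * (x / real m - real (card (upto_real (x / real m))))\<bar> \<le> x" .
  have "x * (\<Sum>m\<in>upto_real x. mu_on P m / real m)
      = (\<Sum>m\<in>upto_real x. mu_on P m * real (card (upto_real (x / real m)))) + (\<Sum>m\<in>upto_real x. mu_on P m * (x / real m - real (card (upto_real (x / real m)))))"
    unfolding sum.distrib[symmetric] sum_distrib_left by (intro sum.cong refl) (simp add: algebra_simps)
  then have "\<bar>x * (\<Sum>m\<in>upto_real x. mu_on P m / real m)\<bar> \<le> x * 2" using e1 e2 by linarith
  then show ?thesis using x by (simp add: abs_mult)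
qed

text \<open>\<open>F\<close> holds the primes already extracted from the integer under
  consideration.\<close>

definition rough_primes :: "nat \<Rightarrow> nat set \<Rightarrow> nat set" where
  "rough_primes p F = {q. prime q \<and> p < q \<and> q \<notin> F}"

lemma ln_eq_sum_prime_factors:
  assumes "squarefree n"
  shows "ln (real n) = (\<Sum>q\<in>prime_factors n. ln (real q))"
proof -
  have n: "n > 0" using assms by (auto intro: Nat.gr0I)
  have "n = (\<Prod>q\<in>prime_factors n. q ^ multiplicity q n)"
    using prime_factorization_nat[OF n] .
  also have "\<dots> = (\<Prod>q\<in>prime_factors n. q)"
  proof (intro prod.cong refl)
    fix q assume q: "q \<in> prime_factors n"
    have "multiplicity q n = 1"
      using assms q n squarefree_factorial_semiring'[of n] by auto
    then show "q ^ multiplicity q n = q" by simp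
  qed
  finally have "real n = real (\<Prod>q\<in>prime_factors n. q)" by (rule arg_cong)
  then have "ln (real n) = ln (\<Prod>q\<in>prime_factors n. real q)" unfolding of_nat_prod by (rule arg_cong)
  also have "\<dots> = (\<Sum>q\<in>prime_factors n. ln (real q))"
    by (rule ln_prod) (auto simp: in_prime_factors_iff prime_gt_0_nat)
  finally show ?thesis .
qed

lemma sum_ln_div_le:
  assumes v: "1 \<le> v"
  shows "(\<Sum>m\<in>upto_real v. ln (v / real m)) \<le> 4 * v"
proof -
  have "(\<Sum>m\<in>upto_real v. ln (v / real m)) \<le> (\<Sum>m\<in>upto_real v. 2 * sqrt (v / real m))"
  proof (intro sum_mono)
    fix m assume "m \<in> upto_real v"
    then have "0 < v / real m" using v by (simp add: upto_real_def)
    then show "ln (v / real m) \<le> 2 * sqrt (v / real m)"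
      using ln_le_powr_div[of "1/2" "v / real m"] by (simp add: powr_half_sqrt)
  qed
  also have "\<dots> = 2 * (\<Sum>m\<in>upto_real v. sqrt (v / real m))" by (simp add: sum_distrib_left)
  also have "\<dots> \<le> 2 * (2 * v)" by (intro mult_left_mono sum_sqrt_div_le v) simp
  finally show ?thesis by simp
qed

lemma sum_ln_over_square_le:
  obtains C where "C > 0" "\<And>v. (\<Sum>q\<in>primes_upto v. ln (real q) / (real q)\<^sup>2) \<le> C"
proof
  let ?f = "\<lambda>n. 2 * real (Suc n) powr (- 3 / 2)"
  have sm: "summable ?f" by (intro summable_mult summable_Suc_powr) simp
  show "(\<Sum>n. ?f n) + 1 > 0" by (intro add_nonneg_pos suminf_nonneg sm) auto
  fix v
  have "(\<Sum>q\<in>primes_upto v. ln (real q) / (real q)\<^sup>2) \<le> (\<Sum>q\<in>primes_upto v. ?f (q - 1))"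
  proof (intro sum_mono)
    fix q assume "q \<in> primes_upto v"
    then have q: "q > 0" by (auto simp: primes_upto_def prime_gt_0_nat)
    have "ln (real q) / (real q)\<^sup>2 \<le> (2 * real q powr (1/2)) / (real q powr 2)"
      using ln_le_powr_div[of "1/2" "real q"] q by (simp add: divide_right_mono)
    also have "\<dots> = 2 * (real q powr (1/2) / real q powr 2)" by simp
    also have "real q powr (1/2) / real q powr 2 = real q powr (- 3 / 2)" unfolding powr_diff[symmetric] by simp
    finally show "ln (real q) / (real q)\<^sup>2 \<le> ?f (q - 1)" using q by simp
  qed
  also have "\<dots> = (\<Sum>n\<in>(\<lambda>q. q - 1) ` primes_upto v. ?f n)"
    by (subst sum.reindex) (auto simp: inj_on_def primes_upto_def dest!: prime_gt_0_nat)
  also have "\<dots> \<le> (\<Sum>n. ?f n)" by (intro sum_le_suminf sm) auto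
  finally show "(\<Sum>q\<in>primes_upto v. ln (real q) / (real q)\<^sup>2) \<le> (\<Sum>n. ?f n) + 1" by simp
qed

text \<open>What has to be uniform is the gap between the primes of \<open>P\<close> up to
  \<open>v / m\<close> and all of them. Primes up to \<open>p\<close> matter only for
  \<open>m \<le> v / p\<close>, where they cost \<open>theta p\<close> of order \<open>p\<close>
  each time, and each exceptional prime costs at most \<open>v\<close> in total. The denominator
  \<open>1 + ln v\<close> makes the bound meaningful from \<open>v = 1\<close> on.\<close>

lemma rough_mertens_bound:
  obtains C where "C > 0" "\<And>p F v. 1 \<le> p \<Longrightarrow> finite F \<Longrightarrow> card F \<le> 2 \<Longrightarrow> 1 \<le> v \<Longrightarrow>
     \<bar>\<Sum>m\<in>upto_real v. mu_on (rough_primes p F) m\<bar> \<le> C * v / (1 + ln v)"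
proof -
  obtain C1 where C1: "C1 > 0" "\<And>v. 1 \<le> v \<Longrightarrow> (\<Sum>m\<in>upto_real v. \<bar>theta (v / real m) - v / real m\<bar>) \<le> C1 * v"
    by (rule theta_err_sum_bound) blast
  obtain C2 where C2: "C2 > 0" "\<And>v. (\<Sum>q\<in>primes_upto v. ln (real q) / (real q)\<^sup>2) \<le> C2"
    by (rule sum_ln_over_square_le) blast
  \<comment> \<open>In order: the trivial bound, the weight \<open>ln (v / m)\<close>, repeated
    primes, and in brackets the main term \<open>v / m\<close>, the error of \<open>theta\<close>,
    the primes up to \<open>p\<close>, and the exceptional set.\<close>
  define C where "C = 1 + 4 + C2 + (2 + C1 + 4 + 2)"
  show ?thesis
  proof (rule that[of C])
    show "C > 0" unfolding C_def using C1(1) C2(1) by simp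
    fix p :: nat and F :: "nat set" and v :: real assume p: "1 \<le> p" and F: "finite F" "card F \<le> 2" and v: "1 \<le> v"
    define P where "P = rough_primes p F"
    define M where "M = (\<lambda>w. \<Sum>m\<in>upto_real w. mu_on P m)"
    have sumle: "\<bar>\<Sum>m\<in>A. mu_on P m * g m\<bar> \<le> (\<Sum>m\<in>A. \<bar>g m\<bar>)" for A g
    proof -
      have "\<bar>\<Sum>m\<in>A. mu_on P m * g m\<bar> \<le> (\<Sum>m\<in>A. \<bar>mu_on P m * g m\<bar>)" by (rule sum_abs)
      also have "\<dots> \<le> (\<Sum>m\<in>A. \<bar>g m\<bar>)"
        by (intro sum_mono) (simp add: abs_mult mult_left_le_one_le abs_mu_on_le)
      finally show ?thesis .
    qed
    have M0: "\<bar>M v\<bar> \<le> v"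
      using sumle[of "\<lambda>_. 1" "upto_real v"] card_upto_real_le[of v] v unfolding M_def by simp
    have a1: "\<bar>\<Sum>m\<in>upto_real v. mu_on P m * ln (v / real m)\<bar> \<le> 4 * v"
    proof -
      have "(\<Sum>m\<in>upto_real v. \<bar>ln (v / real m)\<bar>) = (\<Sum>m\<in>upto_real v. ln (v / real m))"
        by (intro sum.cong refl) (auto simp: upto_real_def intro!: abs_of_nonneg)
      then show ?thesis using sumle[of "\<lambda>m. ln (v / real m)" "upto_real v"] sum_ln_div_le[OF v] by linarith
    qed
    have split: "ln v * M v = (\<Sum>m\<in>upto_real v. mu_on P m * ln (v / real m)) + (\<Sum>m\<in>upto_real v. mu_on P m * ln (real m))"
      unfolding M_def sum_distrib_left sum.distrib[symmetric]
      by (intro sum.cong refl) (use v in \<open>auto simp: upto_real_def ln_div algebra_simps\<close>)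
    have "(\<Sum>m\<in>upto_real v. mu_on P m * ln (real m)) = (\<Sum>m\<in>upto_real v. mu_on P m * (\<Sum>q\<in>prime_factors m. ln (real q)))"
    proof (intro sum.cong refl)
      fix m show "mu_on P m * ln (real m) = mu_on P m * (\<Sum>q\<in>prime_factors m. ln (real q))"
        by (cases "squarefree m") (auto simp: mu_on_not_squarefree ln_eq_sum_prime_factors)
    qed
    also have "\<dots> = - (\<Sum>q\<in>primes_upto v \<inter> P. \<Sum>m\<in>upto_real (v / real q). mu_on (P - {q}) m * ln (real q))"
      using sum_mu_on_prime_factors[of P "\<lambda>q _. ln (real q)" v] by simp
    also have "\<dots> = - (\<Sum>q\<in>primes_upto v \<inter> P. ln (real q) * M (v / real q))
          + (\<Sum>q\<in>primes_upto v \<inter> P. ln (real q) * (\<Sum>m\<in>{m\<in>upto_real (v / real q). q dvd m}. mu_on P m))"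
    proof -
      have "(\<Sum>m\<in>upto_real w. mu_on (P - {q}) m * ln (real q)) = ln (real q) * M w - ln (real q) * (\<Sum>m\<in>{m\<in>upto_real w. q dvd m}. mu_on P m)"
        if "prime q" for q w
      proof -
        \<comment> \<open>The deletion of \<open>q\<close> is undone at the price of a sum over
          multiples of \<open>q\<close>, of size \<open>v / q\<^sup>2\<close>; after that the same
          function \<open>M\<close> occurs at every scale and the order of summation can be
          changed.\<close>
        have mu: "mu_on (P - {q}) m = mu_on P m - (if q dvd m then mu_on P m else 0)" if m: "m \<in> upto_real w" for m
        proof -
          have "q \<in> prime_factors m \<longleftrightarrow> q dvd m" using \<open>prime q\<close> m by (auto simp: in_prime_factors_iff upto_real_def)
          then show ?thesis by (auto simp: mu_on_def)
        qed
        have "(\<Sum>m\<in>upto_real w. mu_on (P - {q}) m * ln (real q)) = (\<Sum>m\<in>upto_real w. ln (real q) * mu_on P m - ln (real q) * (if q dvd m then mu_on P m else 0))"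
        proof (intro sum.cong refl)
          fix m assume m: "m \<in> upto_real w"
          show "mu_on (P - {q}) m * ln (real q) = ln (real q) * mu_on P m - ln (real q) * (if q dvd m then mu_on P m else 0)"
            by (subst mu[OF m]) (simp only: right_diff_distrib mult.commute)
        qed
        also have "\<dots> = ln (real q) * M w - ln (real q) * (\<Sum>m\<in>upto_real w. if q dvd m then mu_on P m else 0)"
          unfolding M_def by (simp add: sum_subtractf sum_distrib_left)
        also have "(\<Sum>m\<in>upto_real w. if q dvd m then mu_on P m else 0) = (\<Sum>m\<in>{m\<in>upto_real w. q dvd m}. mu_on P m)"
          by (simp add: sum.inter_filter)
        finally show ?thesis .
      qed
      then have "(\<Sum>q\<in>primes_upto v \<inter> P. \<Sum>m\<in>upto_real (v / real q). mu_on (P - {q}) m * ln (real q))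
        = (\<Sum>q\<in>primes_upto v \<inter> P. ln (real q) * M (v / real q) - ln (real q) * (\<Sum>m\<in>{m\<in>upto_real (v / real q). q dvd m}. mu_on P m))"
        by (intro sum.cong refl) (auto simp: primes_upto_def)
      then show ?thesis by (simp add: sum_subtractf)
    qed
    finally have lnsum: "(\<Sum>m\<in>upto_real v. mu_on P m * ln (real m)) = - (\<Sum>q\<in>primes_upto v \<inter> P. ln (real q) * M (v / real q))
          + (\<Sum>q\<in>primes_upto v \<inter> P. ln (real q) * (\<Sum>m\<in>{m\<in>upto_real (v / real q). q dvd m}. mu_on P m))" .
    have a2: "\<bar>\<Sum>q\<in>primes_upto v \<inter> P. ln (real q) * (\<Sum>m\<in>{m\<in>upto_real (v / real q). q dvd m}. mu_on P m)\<bar> \<le> C2 * v"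
    proof -
      have "\<bar>\<Sum>q\<in>primes_upto v \<inter> P. ln (real q) * (\<Sum>m\<in>{m\<in>upto_real (v / real q). q dvd m}. mu_on P m)\<bar>
         \<le> (\<Sum>q\<in>primes_upto v \<inter> P. \<bar>ln (real q) * (\<Sum>m\<in>{m\<in>upto_real (v / real q). q dvd m}. mu_on P m)\<bar>)"
        by (rule sum_abs)
      also have "\<dots> \<le> (\<Sum>q\<in>primes_upto v \<inter> P. v * (ln (real q) / (real q)\<^sup>2))"
      proof (intro sum_mono)
        fix q assume "q \<in> primes_upto v \<inter> P"
        then have q: "q > 0" by (auto simp: primes_upto_def prime_gt_0_nat)
        have "\<bar>\<Sum>m\<in>{m\<in>upto_real (v / real q). q dvd m}. mu_on P m\<bar> \<le> real (card {m\<in>upto_real (v / real q). q dvd m})"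
          using sumle[of "\<lambda>_. 1"] by simp
        also have "\<dots> = real (card (upto_real (v / real q / real q)))"
          using q by (simp add: upto_real_multiples card_image inj_on_def)
        also have "\<dots> \<le> v / real q / real q" using v by (intro card_upto_real_le) auto
        finally have "ln (real q) * \<bar>\<Sum>m\<in>{m\<in>upto_real (v / real q). q dvd m}. mu_on P m\<bar> \<le> ln (real q) * (v / real q / real q)"
          by (intro mult_left_mono ln_real_nat_nonneg)
        then show "\<bar>ln (real q) * (\<Sum>m\<in>{m\<in>upto_real (v / real q). q dvd m}. mu_on P m)\<bar> \<le> v * (ln (real q) / (real q)\<^sup>2)"
          using ln_real_nat_nonneg[of q] by (simp add: abs_mult power2_eq_square mult_ac)
      qed
      also have "\<dots> \<le> (\<Sum>q\<in>primes_upto v. v * (ln (real q) / (real q)\<^sup>2))"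
        using v by (intro sum_mono2) (auto intro!: mult_nonneg_nonneg divide_nonneg_nonneg ln_real_nat_nonneg)
      also have "\<dots> = v * (\<Sum>q\<in>primes_upto v. ln (real q) / (real q)\<^sup>2)" by (simp add: sum_distrib_left)
      also have "\<dots> \<le> v * C2" using v by (intro mult_left_mono C2) auto
      finally show ?thesis by (simp add: mult.commute)
    qed
    have a3: "\<bar>\<Sum>q\<in>primes_upto v \<inter> P. ln (real q) * M (v / real q)\<bar> \<le> (2 + C1 + 4 + 2) * v"
    proof -
      have "(\<Sum>q\<in>primes_upto v \<inter> P. ln (real q) * M (v / real q))
         = (\<Sum>q\<in>primes_upto v \<inter> P. \<Sum>m\<in>{m\<in>upto_real v. real q * real m \<le> v}. mu_on P m * ln (real q))"
      proof (intro sum.cong refl)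
        fix q assume "q \<in> primes_upto v \<inter> P"
        then have q: "q > 0" "1 \<le> real q" using prime_ge_1_nat by (auto simp: primes_upto_def prime_gt_0_nat)
        have "upto_real (v / real q) = {m\<in>upto_real v. real q * real m \<le> v}"
        proof (intro equalityI subsetI)
          fix m assume m: "m \<in> upto_real (v / real q)"
          then have 1: "real q * real m \<le> v" "0 < m" using q by (auto simp: upto_real_def field_simps)
          have "1 * real m \<le> real q * real m" using q by (intro mult_right_mono) auto
          then have "real m \<le> v" using 1 by linarith
          then show "m \<in> {m\<in>upto_real v. real q * real m \<le> v}" using 1 by (simp add: upto_real_def)
        next
          fix m assume "m \<in> {m\<in>upto_real v. real q * real m \<le> v}"
          then show "m \<in> upto_real (v / real q)" using q by (auto simp: upto_real_def field_simps)
        qed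
        then show "ln (real q) * M (v / real q) = (\<Sum>m\<in>{m\<in>upto_real v. real q * real m \<le> v}. mu_on P m * ln (real q))"
          unfolding M_def by (simp add: sum_distrib_left mult.commute)
      qed
      also have "\<dots> = (\<Sum>m\<in>upto_real v. \<Sum>q\<in>{q\<in>primes_upto v \<inter> P. real q * real m \<le> v}. mu_on P m * ln (real q))"
        by (intro sum.swap_restrict) auto
      also have "\<dots> = (\<Sum>m\<in>upto_real v. mu_on P m * (\<Sum>q\<in>primes_upto (v / real m) \<inter> P. ln (real q)))"
      proof (intro sum.cong refl)
        fix m assume m: "m \<in> upto_real v"
        have "{q\<in>primes_upto v \<inter> P. real q * real m \<le> v} = primes_upto (v / real m) \<inter> P"
        proof -
          have m0: "0 < real m" "1 \<le> real m" using m by (auto simp: upto_real_def)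
          have "real q \<le> v" if "real q * real m \<le> v" for q
          proof -
            have "real q * 1 \<le> real q * real m" using m0 by (intro mult_left_mono) auto
            then show ?thesis using that by linarith
          qed
          then show ?thesis using m0 by (auto simp: primes_upto_def field_simps)
        qed
        then show "(\<Sum>q\<in>{q\<in>primes_upto v \<inter> P. real q * real m \<le> v}. mu_on P m * ln (real q))
          = mu_on P m * (\<Sum>q\<in>primes_upto (v / real m) \<inter> P. ln (real q))" by (simp add: sum_distrib_left)
      qed
      \<comment> \<open>For larger \<open>m\<close> no prime above \<open>p\<close> fits below
        \<open>v / m\<close>. Without this truncation the correction for primes up to
        \<open>p\<close> would be multiplied by about \<open>v\<close> terms instead of
        \<open>v / p\<close>.\<close>
      also have "\<dots> = (\<Sum>m\<in>upto_real (v / real p). mu_on P m * (\<Sum>q\<in>primes_upto (v / real m) \<inter> P. ln (real q)))"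
      proof (rule sum.mono_neutral_right)
        have p1: "1 \<le> real p" using p by simp
        then have "v / real p \<le> v / 1" using v by (intro divide_left_mono) auto
        then show "upto_real (v / real p) \<subseteq> upto_real v" by (intro upto_real_mono) simp
        show "\<forall>m\<in>upto_real v - upto_real (v / real p). mu_on P m * (\<Sum>q\<in>primes_upto (v / real m) \<inter> P. ln (real q)) = 0"
        proof
          fix m assume m: "m \<in> upto_real v - upto_real (v / real p)"
          then have m0: "0 < real m" "v / real p < real m" by (auto simp: upto_real_def)
          then have "v / real m < real p" using p1 by (simp add: field_simps)
          then have "primes_upto (v / real m) \<inter> P = {}" unfolding P_def rough_primes_def primes_upto_def by auto
          then show "mu_on P m * (\<Sum>q\<in>primes_upto (v / real m) \<inter> P. ln (real q)) = 0" by simp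
        qed
      qed auto
      also have "\<dots> = (\<Sum>m\<in>upto_real (v / real p). mu_on P m * (v / real m) + mu_on P m * (theta (v / real m) - v / real m)
            - mu_on P m * theta (real p) - mu_on P m * (\<Sum>q\<in>primes_upto (v / real m) \<inter> {q\<in>F. p < q}. ln (real q)))"
      proof (intro sum.cong refl)
        fix m assume m: "m \<in> upto_real (v / real p)"
        then have "real p \<le> v / real m" using p by (auto simp: upto_real_def field_simps)
        then have sub: "primes_upto (real p) \<subseteq> primes_upto (v / real m)" by (auto simp: primes_upto_def)
        have "primes_upto (v / real m) \<inter> P = (primes_upto (v / real m) - primes_upto (real p)) - (primes_upto (v / real m) \<inter> {q\<in>F. p < q})"
          unfolding P_def rough_primes_def primes_upto_def by auto
        moreover have "primes_upto (v / real m) \<inter> {q\<in>F. p < q} \<subseteq> primes_upto (v / real m) - primes_upto (real p)"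
          unfolding primes_upto_def by auto
        ultimately have S: "(\<Sum>q\<in>primes_upto (v / real m) \<inter> P. ln (real q))
           = theta (v / real m) - theta (real p) - (\<Sum>q\<in>primes_upto (v / real m) \<inter> {q\<in>F. p < q}. ln (real q))"
          unfolding theta_def using sub by (simp add: sum_diff)
        show "mu_on P m * (\<Sum>q\<in>primes_upto (v / real m) \<inter> P. ln (real q)) = mu_on P m * (v / real m) + mu_on P m * (theta (v / real m) - v / real m)
            - mu_on P m * theta (real p) - mu_on P m * (\<Sum>q\<in>primes_upto (v / real m) \<inter> {q\<in>F. p < q}. ln (real q))"
          unfolding S by (simp only: right_diff_distrib)
      qed
      finally have eq: "(\<Sum>q\<in>primes_upto v \<inter> P. ln (real q) * M (v / real q))
        = (\<Sum>m\<in>upto_real (v / real p). mu_on P m * (v / real m)) + (\<Sum>m\<in>upto_real (v / real p). mu_on P m * (theta (v / real m) - v / real m))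
            - (\<Sum>m\<in>upto_real (v / real p). mu_on P m * theta (real p))
            - (\<Sum>m\<in>upto_real (v / real p). mu_on P m * (\<Sum>q\<in>primes_upto (v / real m) \<inter> {q\<in>F. p < q}. ln (real q)))"
        by (simp add: sum.distrib sum_subtractf)
      have vp: "0 < v / real p" "v / real p \<le> v" using v p by (auto simp: field_simps)
      have sub: "upto_real (v / real p) \<subseteq> upto_real v" by (rule upto_real_mono[OF vp(2)])
      have b1: "\<bar>\<Sum>m\<in>upto_real (v / real p). mu_on P m * (v / real m)\<bar> \<le> 2 * v"
      proof -
        have "(\<Sum>m\<in>upto_real (v / real p). mu_on P m * (v / real m)) = v * (\<Sum>m\<in>upto_real (v / real p). mu_on P m / real m)"
          by (simp add: sum_distrib_left mult_ac)
        then show ?thesis using abs_sum_mu_on_div_le[OF vp(1), of P] v by (simp add: abs_mult)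
      qed
      have b2: "\<bar>\<Sum>m\<in>upto_real (v / real p). mu_on P m * (theta (v / real m) - v / real m)\<bar> \<le> C1 * v"
      proof -
        have "(\<Sum>m\<in>upto_real (v / real p). \<bar>theta (v / real m) - v / real m\<bar>) \<le> (\<Sum>m\<in>upto_real v. \<bar>theta (v / real m) - v / real m\<bar>)"
          using sub by (intro sum_mono2) auto
        then show ?thesis using sumle[of "\<lambda>m. theta (v / real m) - v / real m" "upto_real (v / real p)"] C1(2)[OF v] by linarith
      qed
      have b3: "\<bar>\<Sum>m\<in>upto_real (v / real p). mu_on P m * theta (real p)\<bar> \<le> 4 * v"
      proof -
        have "\<bar>\<Sum>m\<in>upto_real (v / real p). mu_on P m * theta (real p)\<bar> \<le> real (card (upto_real (v / real p))) * theta (real p)"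
          using sumle[of "\<lambda>_. theta (real p)" "upto_real (v / real p)"] theta_nonneg[of "real p"] by simp
        also have "\<dots> \<le> (v / real p) * (4 * real p)"
          using vp theta_nonneg by (intro mult_mono card_upto_real_le theta_le) auto
        also have "\<dots> = 4 * v" using p by simp
        finally show ?thesis .
      qed
      \<comment> \<open>A prime \<open>q\<close> of \<open>F\<close> occurs for at most
        \<open>v / q\<close> values of \<open>m\<close>, each time with weight
        \<open>ln q \<le> q\<close>.\<close>
      have b4: "\<bar>\<Sum>m\<in>upto_real (v / real p). mu_on P m * (\<Sum>q\<in>primes_upto (v / real m) \<inter> {q\<in>F. p < q}. ln (real q))\<bar> \<le> 2 * v"
      proof -
        have "\<bar>\<Sum>m\<in>upto_real (v / real p). mu_on P m * (\<Sum>q\<in>primes_upto (v / real m) \<inter> {q\<in>F. p < q}. ln (real q))\<bar>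
          \<le> (\<Sum>m\<in>upto_real (v / real p). \<bar>\<Sum>q\<in>primes_upto (v / real m) \<inter> {q\<in>F. p < q}. ln (real q)\<bar>)" by (rule sumle)
        also have "\<dots> \<le> (\<Sum>m\<in>upto_real v. \<bar>\<Sum>q\<in>primes_upto (v / real m) \<inter> {q\<in>F. p < q}. ln (real q)\<bar>)"
          using sub by (intro sum_mono2) auto
        also have "\<dots> \<le> (\<Sum>m\<in>upto_real v. \<Sum>q\<in>{q\<in>F. 0 < q \<and> real q * real m \<le> v}. ln (real q))"
        proof (intro sum_mono)
          fix m assume "m \<in> upto_real v"
          then have m0: "0 < real m" by (auto simp: upto_real_def)
          have "\<bar>\<Sum>q\<in>primes_upto (v / real m) \<inter> {q\<in>F. p < q}. ln (real q)\<bar> = (\<Sum>q\<in>primes_upto (v / real m) \<inter> {q\<in>F. p < q}. ln (real q))"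
            by (intro abs_of_nonneg sum_nonneg ln_real_nat_nonneg)
          also have "\<dots> \<le> (\<Sum>q\<in>{q\<in>F. 0 < q \<and> real q * real m \<le> v}. ln (real q))"
            using F m0 by (intro sum_mono2) (auto simp: primes_upto_def field_simps intro: ln_real_nat_nonneg)
          finally show "\<bar>\<Sum>q\<in>primes_upto (v / real m) \<inter> {q\<in>F. p < q}. ln (real q)\<bar> \<le> (\<Sum>q\<in>{q\<in>F. 0 < q \<and> real q * real m \<le> v}. ln (real q))" .
        qed
        also have "\<dots> = (\<Sum>m\<in>upto_real v. \<Sum>q\<in>{q\<in>{q\<in>F. 0 < q}. real q * real m \<le> v}. ln (real q))"
          by (intro sum.cong refl) auto
        also have "\<dots> = (\<Sum>q\<in>{q\<in>F. 0 < q}. \<Sum>m\<in>{m\<in>upto_real v. real q * real m \<le> v}. ln (real q))"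
          using F by (intro sum.swap_restrict) auto
        also have "\<dots> \<le> (\<Sum>q\<in>{q\<in>F. 0 < q}. v)"
        proof (intro sum_mono)
          fix q assume "q \<in> {q\<in>F. 0 < q}"
          then have q: "0 < real q" by auto
          have "{m\<in>upto_real v. real q * real m \<le> v} \<subseteq> upto_real (v / real q)"
            using q by (auto simp: upto_real_def field_simps)
          then have "real (card {m\<in>upto_real v. real q * real m \<le> v}) \<le> real (card (upto_real (v / real q)))"
            by (intro of_nat_mono card_mono) auto
          also have "\<dots> \<le> v / real q" using v by (intro card_upto_real_le) auto
          finally have "real (card {m\<in>upto_real v. real q * real m \<le> v}) * ln (real q) \<le> v / real q * real q"
            using q v ln_bound[of "real q"] by (intro mult_mono ln_real_nat_nonneg) auto
          then show "(\<Sum>m\<in>{m\<in>upto_real v. real q * real m \<le> v}. ln (real q)) \<le> v" using q by simp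
        qed
        also have "\<dots> = real (card {q\<in>F. 0 < q}) * v" by simp
        also have "\<dots> \<le> 2 * v"
        proof (intro mult_right_mono)
          have "card {q\<in>F. 0 < q} \<le> card F" using F by (intro card_mono) auto
          then show "real (card {q\<in>F. 0 < q}) \<le> 2" using F by linarith
        qed (use v in auto)
        finally show ?thesis .
      qed
      show ?thesis unfolding eq using b1 b2 b3 b4 by (simp add: algebra_simps)
    qed
    have "\<bar>ln v * M v\<bar> \<le> 4 * v + C2 * v + (2 + C1 + 4 + 2) * v"
      unfolding split lnsum using a1 a2 a3 by linarith
    then have "(1 + ln v) * \<bar>M v\<bar> \<le> C * v"
      using M0 v by (simp add: abs_mult C_def algebra_simps)
    moreover have "0 < 1 + ln v" using v by (simp add: add_pos_nonneg)
    ultimately have "\<bar>M v\<bar> \<le> C * v / (1 + ln v)" by (simp add: field_simps)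
    then show "\<bar>\<Sum>m\<in>upto_real v. mu_on (rough_primes p F) m\<bar> \<le> C * v / (1 + ln v)" unfolding M_def P_def .
  qed
qed

section \<open>Sums over primes that cost one iterated logarithm\<close>

text \<open>Shifted so as to be at least 1 from \<open>v = 1\<close> on; lower powers can then be
  absorbed into higher ones.\<close>

definition loglog :: "real \<Rightarrow> real" where
  "loglog v = 1 + ln (1 + ln v)"

lemma loglog_ge_1: "1 \<le> v \<Longrightarrow> 1 \<le> loglog v"
  unfolding loglog_def by simp

lemma loglog_mono: "1 \<le> v \<Longrightarrow> v \<le> w \<Longrightarrow> loglog v \<le> loglog w"
proof -
  assume v: "1 \<le> v" "v \<le> w"
  then have "ln v \<le> ln w" "0 \<le> ln v" by auto
  then show ?thesis unfolding loglog_def by (simp add: add_pos_nonneg)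
qed

lemma sum_inverse_le_ln:
  assumes "1 \<le> M" "M \<le> N"
  shows "(\<Sum>n\<in>{M<..N}. 1 / real n) \<le> ln (real N / real M)"
  using assms(2)
proof (induction N rule: dec_induct)
  case base
  then show ?case using assms by simp
next
  case (step n)
  have n: "0 < real n" using step assms by simp
  have "{M<..Suc n} = insert (Suc n) {M<..n}" using step by auto
  then have "(\<Sum>k\<in>{M<..Suc n}. 1 / real k) = 1 / real (Suc n) + (\<Sum>k\<in>{M<..n}. 1 / real k)" by simp
  also have "\<dots> \<le> (ln (real (Suc n)) - ln (real n)) + ln (real n / real M)"
  proof (intro add_mono step.IH)
    have "ln (real n / real (Suc n)) \<le> real n / real (Suc n) - 1" using n by (intro ln_le_minus_one) auto
    also have "\<dots> = - (1 / real (Suc n))" by (simp add: field_simps)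
    also have "ln (real n / real (Suc n)) = ln (real n) - ln (real (Suc n))" using n by (simp add: ln_div del: of_nat_Suc)
    finally show "1 / real (Suc n) \<le> ln (real (Suc n)) - ln (real n)" by simp
  qed
  also have "\<dots> = ln (real (Suc n) / real M)" using n assms by (simp add: ln_div del: of_nat_Suc)
  finally show ?case .
qed

text \<open>Blocks on a logarithmic scale, with Chebyshev's bound in each block, leave a harmonic
  sum up to \<open>ln w\<close>. The block function is a parameter because the blocks are taken once
  in \<open>q\<close> and once in \<open>w / q\<close>.\<close>

lemma sum_blocks_le_loglog:
  assumes w: "1 \<le> w" and B: "0 \<le> B"
    and k: "\<And>q. q \<in> primes_upto w \<Longrightarrow> \<kappa> q \<le> nat \<lfloor>ln w\<rfloor>"
    and block: "\<And>k. (\<Sum>q\<in>{q\<in>primes_upto w. \<kappa> q = k}. h q) \<le> B / real (Suc k)"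
  shows "(\<Sum>q\<in>primes_upto w. h q) \<le> B * loglog w"
proof -
  define K where "K = nat \<lfloor>ln w\<rfloor>"
  have "(\<Sum>q\<in>primes_upto w. h q) = (\<Sum>k\<in>{..K}. \<Sum>q\<in>{q\<in>primes_upto w. \<kappa> q = k}. h q)"
    by (rule sum.group[symmetric]) (use k in \<open>auto simp: K_def\<close>)
  also have "\<dots> \<le> (\<Sum>k\<in>{..K}. B / real (Suc k))" by (intro sum_mono block)
  also have "\<dots> = B * (\<Sum>k\<in>{..K}. 1 / real (Suc k))" by (simp add: sum_distrib_left)
  also have "(\<Sum>k\<in>{..K}. 1 / real (Suc k)) = (\<Sum>n\<in>{1..Suc K}. 1 / real n)"
    by (rule sum.reindex_bij_witness[where i = "\<lambda>n. n - 1" and j = Suc]) auto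
  also have "{1..Suc K} = insert 1 {1<..Suc K}" by auto
  also have "(\<Sum>n\<in>insert 1 {1<..Suc K}. 1 / real n) = 1 + (\<Sum>n\<in>{1<..Suc K}. 1 / real n)" by simp
  also have "\<dots> \<le> 1 + ln (real (Suc K) / real 1)" by (intro add_left_mono sum_inverse_le_ln) auto
  also have "\<dots> \<le> loglog w"
  proof -
    have "real K \<le> ln w" unfolding K_def using w by simp
    then have "ln (real (Suc K)) \<le> ln (1 + ln w)" by (intro ln_mono) auto
    then show ?thesis unfolding loglog_def by simp
  qed
  finally show ?thesis using B by (simp add: mult_left_mono)
qed

lemma nat_floor_eqD: "0 \<le> y \<Longrightarrow> nat \<lfloor>y\<rfloor> = k \<Longrightarrow> real k \<le> y \<and> y < real k + 1"
  by (metis floor_correct of_int_of_nat_eq of_nat_nat zero_le_floor add.commute of_int_1 of_int_add)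

text \<open>For \<open>q\<close> between \<open>exp k\<close> and \<open>exp (k + 1)\<close> the
  reciprocal is at most \<open>exp (- k)\<close>, and \<open>ln q\<close> is at least a third of
  \<open>k + 1\<close>. Chebyshev's bound for \<open>theta\<close> at the end of the block then
  gives \<open>12 * exp 1 / (k + 1)\<close>.\<close>

lemma sum_inverse_primes_le:
  assumes w: "1 \<le> w"
  shows "(\<Sum>q\<in>primes_upto w. 1 / real q) \<le> 12 * exp 1 * loglog w"
proof (rule sum_blocks_le_loglog[OF w, where \<kappa> = "\<lambda>q. nat \<lfloor>ln (real q)\<rfloor>"])
  fix q assume "q \<in> primes_upto w"
  then have "real q \<le> w" "0 < q" by (auto simp: primes_upto_def prime_gt_0_nat)
  then show "nat \<lfloor>ln (real q)\<rfloor> \<le> nat \<lfloor>ln w\<rfloor>" by (intro nat_mono floor_mono ln_mono) auto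
next
  fix k
  have "(\<Sum>q\<in>{q\<in>primes_upto w. nat \<lfloor>ln (real q)\<rfloor> = k}. 1 / real q)
     \<le> (\<Sum>q\<in>{q\<in>primes_upto w. nat \<lfloor>ln (real q)\<rfloor> = k}. 3 * exp (- real k) / real (Suc k) * ln (real q))"
  proof (intro sum_mono)
    fix q assume q: "q \<in> {q\<in>primes_upto w. nat \<lfloor>ln (real q)\<rfloor> = k}"
    then have q2: "2 \<le> q" by (auto simp: primes_upto_def prime_ge_2_nat)
    have fl: "real k \<le> ln (real q)" "ln (real q) < real k + 1"
      using nat_floor_eqD[OF ln_real_nat_nonneg, of q k] q by auto
    have "exp (real k) \<le> real q" using fl(1) q2 by (simp add: ln_ge_iff)
    moreover have "0 < real q" using q2 by simp
    ultimately have 1: "1 / real q \<le> exp (- real k)" by (simp add: exp_minus field_simps)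
    \<comment> \<open>Needed for the block \<open>k = 0\<close>, where \<open>k \<le> ln q\<close>
      says too little.\<close>
    have "2 / 3 \<le> ln (2::real)" by (rule ln2_ge_two_thirds)
    also have "ln 2 \<le> ln (real q)" using q2 by simp
    finally have "real (Suc k) \<le> 3 * ln (real q)" using fl(1) by (cases "k = 0") auto
    then have "1 \<le> 3 * ln (real q) / real (Suc k)" by simp
    then have "1 / real q * 1 \<le> exp (- real k) * (3 * ln (real q) / real (Suc k))" using 1 by (intro mult_mono) auto
    then show "1 / real q \<le> 3 * exp (- real k) / real (Suc k) * ln (real q)" by (simp add: mult_ac)
  qed
  also have "\<dots> = 3 * exp (- real k) / real (Suc k) * (\<Sum>q\<in>{q\<in>primes_upto w. nat \<lfloor>ln (real q)\<rfloor> = k}. ln (real q))"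
    by (simp add: sum_distrib_left)
  also have "\<dots> \<le> 3 * exp (- real k) / real (Suc k) * theta (exp (real k + 1))"
  proof (intro mult_left_mono)
    show "(\<Sum>q\<in>{q\<in>primes_upto w. nat \<lfloor>ln (real q)\<rfloor> = k}. ln (real q)) \<le> theta (exp (real k + 1))"
      unfolding theta_def
    proof (intro sum_mono2 subsetI ln_real_nat_nonneg)
      fix q assume q: "q \<in> {q\<in>primes_upto w. nat \<lfloor>ln (real q)\<rfloor> = k}"
      then have q2: "0 < real q" by (auto simp: primes_upto_def prime_gt_0_nat)
      have "ln (real q) \<le> real k + 1" using nat_floor_eqD[OF ln_real_nat_nonneg, of q k] q by auto
      then have "real q \<le> exp (real k + 1)" using q2 by (metis exp_le_cancel_iff exp_ln)
      then show "q \<in> primes_upto (exp (real k + 1))" using q by (simp add: primes_upto_def)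
    qed simp
  qed simp
  also have "\<dots> \<le> 3 * exp (- real k) / real (Suc k) * (4 * exp (real k + 1))"
    by (intro mult_left_mono theta_le) auto
  also have "\<dots> = 12 * (exp (- real k) * exp (real k + 1)) / real (Suc k)" by simp
  also have "exp (- real k) * exp (real k + 1) = exp 1" unfolding exp_add[symmetric] by simp
  finally show "(\<Sum>q\<in>{q\<in>primes_upto w. nat \<lfloor>ln (real q)\<rfloor> = k}. 1 / real q) \<le> 12 * exp 1 / real (Suc k)" .
qed simp

text \<open>Blocks in \<open>w / q\<close>: the denominator is at least \<open>k + 1\<close>, while
  both \<open>q\<close> and the sum of logarithms over the block are controlled at the scale
  \<open>w / exp k\<close>.\<close>

lemma sum_log_primes_hyperbola_le:
  assumes w: "1 \<le> w"
  shows "(\<Sum>q\<in>primes_upto w. ln (real q) / (real q * (1 + ln (w / real q)))) \<le> 4 * exp 1 * loglog w"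
proof (rule sum_blocks_le_loglog[OF w, where \<kappa> = "\<lambda>q. nat \<lfloor>ln (w / real q)\<rfloor>"])
  fix q assume "q \<in> primes_upto w"
  then have "real q \<le> w" "1 \<le> real q" using prime_ge_1_nat by (auto simp: primes_upto_def)
  then show "nat \<lfloor>ln (w / real q)\<rfloor> \<le> nat \<lfloor>ln w\<rfloor>" using w
    by (intro nat_mono floor_mono ln_mono) (auto simp: field_simps)
next
  fix k
  let ?A = "{q\<in>primes_upto w. nat \<lfloor>ln (w / real q)\<rfloor> = k}"
  have A: "0 < real q" "real k \<le> ln (w / real q)" "ln (w / real q) < real k + 1" "prime q" if "q \<in> ?A" for q
  proof -
    have q: "0 < real q" "real q \<le> w" "prime q" using that by (auto simp: primes_upto_def prime_gt_0_nat)
    then have "0 \<le> ln (w / real q)" by simp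
    then show "0 < real q" "real k \<le> ln (w / real q)" "ln (w / real q) < real k + 1" "prime q"
      using nat_floor_eqD[of "ln (w / real q)" k] that q by auto
  qed
  have "(\<Sum>q\<in>?A. ln (real q) / (real q * (1 + ln (w / real q)))) \<le> (\<Sum>q\<in>?A. exp (real k + 1) / w / real (Suc k) * ln (real q))"
  proof (intro sum_mono)
    fix q assume q: "q \<in> ?A"
    have "w / real q \<le> exp (real k + 1)"
      using A[OF q] w by (metis exp_le_cancel_iff exp_ln divide_pos_pos less_imp_le less_le_trans zero_less_one)
    then have "1 / real q \<le> exp (real k + 1) / w" using A[OF q] w by (simp add: field_simps)
    moreover have "1 / (1 + ln (w / real q)) \<le> 1 / real (Suc k)" using A[OF q] by (intro divide_left_mono) auto
    ultimately have "(1 / real q) * (1 / (1 + ln (w / real q))) * ln (real q) \<le> (exp (real k + 1) / w) * (1 / real (Suc k)) * ln (real q)"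
      using A[OF q] w by (intro mult_right_mono mult_mono ln_real_nat_nonneg) auto
    then show "ln (real q) / (real q * (1 + ln (w / real q))) \<le> exp (real k + 1) / w / real (Suc k) * ln (real q)" by simp
  qed
  also have "\<dots> = exp (real k + 1) / w / real (Suc k) * (\<Sum>q\<in>?A. ln (real q))" by (simp add: sum_distrib_left)
  also have "\<dots> \<le> exp (real k + 1) / w / real (Suc k) * theta (w / exp (real k))"
  proof (intro mult_left_mono)
    show "(\<Sum>q\<in>?A. ln (real q)) \<le> theta (w / exp (real k))"
      unfolding theta_def
    proof (intro sum_mono2 subsetI ln_real_nat_nonneg)
      fix q assume q: "q \<in> ?A"
      have "exp (real k) \<le> w / real q"
        using A[OF q] w by (metis exp_le_cancel_iff exp_ln divide_pos_pos less_le_trans zero_less_one)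
      then show "q \<in> primes_upto (w / exp (real k))" using A[OF q] by (simp add: primes_upto_def field_simps)
    qed simp
  qed (use w in simp)
  also have "\<dots> \<le> exp (real k + 1) / w / real (Suc k) * (4 * (w / exp (real k)))"
    using w by (intro mult_left_mono theta_le) auto
  also have "\<dots> = 4 * (exp (real k + 1) / exp (real k)) / real (Suc k)" using w by (simp add: mult_ac)
  also have "exp (real k + 1) / exp (real k) = exp 1" unfolding exp_diff[symmetric] by simp
  finally show "(\<Sum>q\<in>?A. ln (real q) / (real q * (1 + ln (w / real q)))) \<le> 4 * exp 1 / real (Suc k)" .
qed simp

lemma one_plus_ln_pos: "1 \<le> v \<Longrightarrow> 0 < 1 + ln (v::real)"
  by (simp add: add_pos_nonneg)

text \<open>Multiply by \<open>1 + ln w\<close> and split \<open>ln w = ln q + ln (w/q)\<close>.\<close>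
lemma prime_hyperbola_bound:
  assumes w: "1 \<le> w"
  shows "(\<Sum>q\<in>primes_upto w. 1 / (real q * (1 + ln (w / real q)))) \<le> 16 * exp 1 * loglog w / (1 + ln w)"
proof -
  have "(1 + ln w) * (\<Sum>q\<in>primes_upto w. 1 / (real q * (1 + ln (w / real q))))
      = (\<Sum>q\<in>primes_upto w. 1 / real q + ln (real q) / (real q * (1 + ln (w / real q))))"
    unfolding sum_distrib_left
  proof (intro sum.cong refl)
    fix q assume "q \<in> primes_upto w"
    then have q: "0 < real q" "real q \<le> w" by (auto simp: primes_upto_def prime_gt_0_nat)
    have "1 \<le> w / real q" using q by simp
    then have p: "0 < 1 + ln (w / real q)" by (rule one_plus_ln_pos)
    have "ln w = ln (w / real q) + ln (real q)" using q w by (simp add: ln_div)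
    then show "(1 + ln w) * (1 / (real q * (1 + ln (w / real q)))) = 1 / real q + ln (real q) / (real q * (1 + ln (w / real q)))"
      using q p by (simp add: divide_simps)
  qed
  also have "\<dots> \<le> 12 * exp 1 * loglog w + 4 * exp 1 * loglog w"
    unfolding sum.distrib using sum_inverse_primes_le[OF w] sum_log_primes_hyperbola_le[OF w] by (rule add_mono)
  finally show ?thesis using one_plus_ln_pos[OF w] by (simp add: pos_le_divide_eq mult.commute)
qed

text \<open>The step in which one extracted prime costs one factor \<open>loglog v\<close>. It is
  applied three times: to the first moment, to the second moment, and to the sum over the least
  prime.\<close>

lemma sum_primes_bound:
  assumes v: "1 \<le> v" and D: "0 \<le> D"
    and g: "\<And>q. q \<in> primes_upto v \<Longrightarrow> q \<in> A \<Longrightarrow> \<bar>g q\<bar> \<le> D * (v / real q) / (1 + ln (v / real q))"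
  shows "\<bar>\<Sum>q\<in>primes_upto v \<inter> A. g q\<bar> \<le> D * (16 * exp 1) * v * loglog v / (1 + ln v)"
proof -
  have "\<bar>\<Sum>q\<in>primes_upto v \<inter> A. g q\<bar> \<le> (\<Sum>q\<in>primes_upto v \<inter> A. \<bar>g q\<bar>)" by (rule sum_abs)
  also have "\<dots> \<le> (\<Sum>q\<in>primes_upto v \<inter> A. D * v * (1 / (real q * (1 + ln (v / real q)))))"
    using g by (intro sum_mono) auto
  also have "\<dots> \<le> (\<Sum>q\<in>primes_upto v. D * v * (1 / (real q * (1 + ln (v / real q)))))"
  proof (intro sum_mono2)
    fix q assume "q \<in> primes_upto v - primes_upto v \<inter> A"
    then have q: "0 < real q" "real q \<le> v" by (auto simp: primes_upto_def prime_gt_0_nat)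
    then have "1 \<le> v / real q" by simp
    then show "0 \<le> D * v * (1 / (real q * (1 + ln (v / real q))))"
      using one_plus_ln_pos[of "v / real q"] D v by simp
  qed auto
  also have "\<dots> = D * v * (\<Sum>q\<in>primes_upto v. 1 / (real q * (1 + ln (v / real q))))" by (simp add: sum_distrib_left)
  also have "\<dots> \<le> D * v * (16 * exp 1 * loglog v / (1 + ln v))"
    using v D by (intro mult_left_mono prime_hyperbola_bound) auto
  finally show ?thesis by (simp add: mult_ac)
qed

section \<open>Moments of \<open>omega\<close> over rough numbers\<close>

text \<open>For \<open>i = 0\<close> this is the plain sum, including \<open>m = 1\<close>, since
  \<open>0 ^ 0 = 1\<close>.\<close>

definition mu_moment :: "nat \<Rightarrow> nat set \<Rightarrow> real \<Rightarrow> real" where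
  "mu_moment i P v = (\<Sum>m\<in>upto_real v. mu_on P m * real (omega m) ^ i)"

lemma omega_div_prime_factor:
  assumes "squarefree n" "q \<in> prime_factors n"
  shows "omega n = Suc (omega (n div q))" "prime_factors n = insert q (prime_factors (n div q))"
    "q \<notin> prime_factors (n div q)" "0 < n div q"
proof -
  have n: "n > 0" using assms by (auto intro: Nat.gr0I)
  have q: "prime q" "q dvd n" using assms by auto
  then have eq: "n = q * (n div q)" by simp
  show pos: "0 < n div q" using n eq by (metis gr0I mult_0_right)
  have "\<not> q dvd n div q" using squarefree_prime_mult[OF q(1) pos] eq assms by simp
  then show "omega n = Suc (omega (n div q))" "q \<notin> prime_factors (n div q)"
    using omega_prime_mult[OF q(1) pos] eq by auto
  show "prime_factors n = insert q (prime_factors (n div q))"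
    using prime_factors_prime_mult[OF q(1) pos] eq by simp
qed

lemma mu_moment_1: "mu_moment 1 P v = - (\<Sum>q\<in>primes_upto v \<inter> P. mu_moment 0 (P - {q}) (v / real q))"
proof -
  have "mu_moment 1 P v = (\<Sum>n\<in>upto_real v. mu_on P n * (\<Sum>q\<in>prime_factors n. 1))"
    unfolding mu_moment_def omega_def by simp
  also have "\<dots> = - (\<Sum>q\<in>primes_upto v \<inter> P. \<Sum>m\<in>upto_real (v / real q). mu_on (P - {q}) m * 1)"
    by (rule sum_mu_on_prime_factors)
  finally show ?thesis unfolding mu_moment_def by simp
qed

text \<open>One factor \<open>omega n\<close> is spread over the prime factors \<open>q\<close>, the
  other becomes \<open>omega (n div q) + 1\<close>. This is exact for squarefree n, and other n do
  not contribute.\<close>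

lemma mu_moment_2: "mu_moment 2 P v = - (\<Sum>q\<in>primes_upto v \<inter> P. mu_moment 1 (P - {q}) (v / real q) + mu_moment 0 (P - {q}) (v / real q))"
proof -
  have "mu_moment 2 P v = (\<Sum>n\<in>upto_real v. mu_on P n * (\<Sum>q\<in>prime_factors n. real (omega (n div q)) + 1))"
    unfolding mu_moment_def
  proof (intro sum.cong refl)
    fix n
    show "mu_on P n * real (omega n) ^ 2 = mu_on P n * (\<Sum>q\<in>prime_factors n. real (omega (n div q)) + 1)"
    proof (cases "squarefree n")
      case True
      have "(\<Sum>q\<in>prime_factors n. real (omega (n div q)) + 1) = (\<Sum>q\<in>prime_factors n. real (omega n))"
        using omega_div_prime_factor(1)[OF True] by (intro sum.cong refl) simp
      also have "\<dots> = real (omega n) ^ 2" by (simp add: omega_def power2_eq_square)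
      finally show ?thesis by simp
    qed (simp add: mu_on_not_squarefree)
  qed
  also have "\<dots> = - (\<Sum>q\<in>primes_upto v \<inter> P. \<Sum>m\<in>upto_real (v / real q). mu_on (P - {q}) m * (real (omega m) + 1))"
    by (rule sum_mu_on_prime_factors)
  finally show ?thesis unfolding mu_moment_def by (simp add: sum.distrib distrib_left)
qed

lemma rough_primes_remove: "rough_primes p F - {q} = rough_primes p (insert q F)"
  unfolding rough_primes_def by auto

lemma primes_upto_quotient:
  assumes "q \<in> primes_upto v"
  shows "1 \<le> v / real q" "v / real q \<le> v" "0 < real q"
proof -
  have "1 \<le> real q" "real q \<le> v" using assms prime_ge_1_nat by (auto simp: primes_upto_def)
  then show "1 \<le> v / real q" "v / real q \<le> v" "0 < real q" by (auto simp: field_simps) 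
qed

text \<open>The second moment passes through the first, and that through the plain sum, extracting
  one prime each time; so the plain sum is needed with up to two exceptional primes and the first
  moment with one. All three orders are given the worst weight.\<close>

lemma rough_moment_bounds:
  obtains C where "C > 0"
    "\<And>p v. 1 \<le> p \<Longrightarrow> 1 \<le> v \<Longrightarrow> \<bar>mu_moment 0 (rough_primes p {}) v\<bar> \<le> C * (loglog v)\<^sup>2 * v / (1 + ln v)"
    "\<And>p v. 1 \<le> p \<Longrightarrow> 1 \<le> v \<Longrightarrow> \<bar>mu_moment 1 (rough_primes p {}) v\<bar> \<le> C * (loglog v)\<^sup>2 * v / (1 + ln v)"
    "\<And>p v. 1 \<le> p \<Longrightarrow> 1 \<le> v \<Longrightarrow> \<bar>mu_moment 2 (rough_primes p {}) v\<bar> \<le> C * (loglog v)\<^sup>2 * v / (1 + ln v)"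
proof -
  obtain C0 where C0: "C0 > 0" "\<And>p F v. 1 \<le> p \<Longrightarrow> finite F \<Longrightarrow> card F \<le> 2 \<Longrightarrow> 1 \<le> v \<Longrightarrow>
     \<bar>\<Sum>m\<in>upto_real v. mu_on (rough_primes p F) m\<bar> \<le> C0 * v / (1 + ln v)"
    by (rule rough_mertens_bound) blast
  define D where "D = 16 * exp (1::real)"
  have D: "1 \<le> D" unfolding D_def using exp_ge_add_one_self[of "1::real"] by simp
  have m0: "\<bar>mu_moment 0 (rough_primes p F) v\<bar> \<le> C0 * v / (1 + ln v)"
    if "1 \<le> p" "finite F" "card F \<le> 2" "1 \<le> v" for p F v
    using C0(2)[OF that] by (simp add: mu_moment_def)
  have m1: "\<bar>mu_moment 1 (rough_primes p F) v\<bar> \<le> C0 * D * v * loglog v / (1 + ln v)"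
    if p: "1 \<le> p" and F: "finite F" "card F \<le> 1" and v: "1 \<le> v" for p F v
    unfolding mu_moment_1 abs_minus_cancel D_def
  proof (rule sum_primes_bound[OF v])
    fix q assume q: "q \<in> primes_upto v"
    have "card (insert q F) \<le> 2" using F card_insert_le_m1[of 2 F q] by simp
    then show "\<bar>mu_moment 0 (rough_primes p F - {q}) (v / real q)\<bar> \<le> C0 * (v / real q) / (1 + ln (v / real q))"
      unfolding rough_primes_remove using primes_upto_quotient[OF q] F p by (intro m0) auto
  qed (use C0 in auto)
  have m2: "\<bar>mu_moment 2 (rough_primes p {}) v\<bar> \<le> (C0 * D + C0) * loglog v * D * v * loglog v / (1 + ln v)"
    if p: "1 \<le> p" and v: "1 \<le> v" for p v
    unfolding mu_moment_2 abs_minus_cancel D_def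
  proof (rule sum_primes_bound[OF v])
    have L: "1 \<le> loglog v" by (rule loglog_ge_1[OF v])
    then show "0 \<le> (C0 * (16 * exp 1) + C0) * loglog v" using C0 by simp
    fix q assume q: "q \<in> primes_upto v"
    define w where "w = v / real q"
    have w: "1 \<le> w" "w \<le> v" unfolding w_def using primes_upto_quotient[OF q] by auto
    have Lw: "loglog w \<le> loglog v" by (rule loglog_mono[OF w])
    have pos: "0 < 1 + ln w" by (rule one_plus_ln_pos[OF w(1)])
    have "\<bar>mu_moment 1 (rough_primes p {q}) w\<bar> \<le> C0 * D * w * loglog w / (1 + ln w)"
      using p w by (intro m1) auto
    also have "\<dots> \<le> C0 * D * w * loglog v / (1 + ln w)"
      using Lw C0 D w pos by (intro divide_right_mono mult_left_mono) auto
    finally have 1: "\<bar>mu_moment 1 (rough_primes p {q}) w\<bar> \<le> C0 * D * w * loglog v / (1 + ln w)" .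
    have "\<bar>mu_moment 0 (rough_primes p {q}) w\<bar> \<le> C0 * w / (1 + ln w)"
      using p w by (intro m0) auto
    also have "\<dots> = C0 * w * 1 / (1 + ln w)" by simp
    also have "\<dots> \<le> C0 * w * loglog v / (1 + ln w)"
      using L C0(1) w pos by (intro divide_right_mono mult_left_mono) auto
    finally have 0: "\<bar>mu_moment 0 (rough_primes p {q}) w\<bar> \<le> C0 * w * loglog v / (1 + ln w)" .
    have "\<bar>mu_moment 1 (rough_primes p {q}) w + mu_moment 0 (rough_primes p {q}) w\<bar>
        \<le> C0 * D * w * loglog v / (1 + ln w) + C0 * w * loglog v / (1 + ln w)"
      using 0 1 by linarith
    also have "\<dots> = (C0 * D + C0) * loglog v * w / (1 + ln w)"
      unfolding add_divide_distrib[symmetric] by (simp add: algebra_simps)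
    finally show "\<bar>mu_moment 1 (rough_primes p {} - {q}) (v / real q) + mu_moment 0 (rough_primes p {} - {q}) (v / real q)\<bar>
       \<le> (C0 * (16 * exp 1) + C0) * loglog v * (v / real q) / (1 + ln (v / real q))"
      unfolding rough_primes_remove w_def D_def .
  qed
  define C where "C = (C0 * D + C0) * D"
  have CC: "C0 \<le> C" "C0 * D \<le> C"
  proof -
    have a: "C0 \<le> C0 * D" using mult_left_mono[of 1 D C0] D C0(1) by simp
    have b: "C0 * D + C0 \<le> C" unfolding C_def using mult_left_mono[of 1 D "C0 * D + C0"] D C0(1) by simp
    show "C0 \<le> C" "C0 * D \<le> C" using a b C0(1) by linarith+
  qed
  have up: "X \<le> C * (loglog v)\<^sup>2 * v / (1 + ln v)"
    if v: "1 \<le> v" and X: "X \<le> c * l * v / (1 + ln v)" and c: "c \<le> C" "0 \<le> c" and l: "l \<le> (loglog v)\<^sup>2" "0 \<le> l" for X c l v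
  proof -
    have "c * l * v / (1 + ln v) \<le> C * (loglog v)\<^sup>2 * v / (1 + ln v)"
      using one_plus_ln_pos[OF v] v c l by (intro divide_right_mono mult_right_mono mult_mono) auto
    then show ?thesis using X by linarith
  qed
  have L1: "1 \<le> (loglog v)\<^sup>2" "loglog v \<le> (loglog v)\<^sup>2" "0 \<le> loglog v" if "1 \<le> v" for v
  proof -
    have l: "1 \<le> loglog v" by (rule loglog_ge_1[OF that])
    then show "1 \<le> (loglog v)\<^sup>2" "0 \<le> loglog v" by auto
    have "loglog v * 1 \<le> loglog v * loglog v" using l by (intro mult_left_mono) auto
    then show "loglog v \<le> (loglog v)\<^sup>2" by (simp add: power2_eq_square)
  qed
  show ?thesis
  proof (rule that[of C])
    show "C > 0" using CC C0 by linarith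
    fix p :: nat and v :: real assume p: "1 \<le> p" and v: "1 \<le> v"
    show "\<bar>mu_moment 0 (rough_primes p {}) v\<bar> \<le> C * (loglog v)\<^sup>2 * v / (1 + ln v)"
      using m0[OF p, of "{}" v] v CC C0 L1[OF v] by (intro up[of v _ C0 1]) auto
    show "\<bar>mu_moment 1 (rough_primes p {}) v\<bar> \<le> C * (loglog v)\<^sup>2 * v / (1 + ln v)"
      using m1[OF p, of "{}" v] v CC C0 D L1[OF v] by (intro up[of v _ "C0 * D" "loglog v"]) (auto simp: mult_ac)
    show "\<bar>mu_moment 2 (rough_primes p {}) v\<bar> \<le> C * (loglog v)\<^sup>2 * v / (1 + ln v)"
      using m2[OF p v] v unfolding C_def by (simp add: power2_eq_square mult_ac)
  qed
qed

section \<open>Summation over the least prime factor\<close>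

definition lpf_coeff :: "(nat \<Rightarrow> bool) \<Rightarrow> nat \<Rightarrow> real" where
  "lpf_coeff J n = (if 2 \<le> n \<and> J (least_prime_factor n) then real_of_int (moebius_mu n) * real (omega n) ^ 2 else 0)"

text \<open>The sum over \<open>q\<close> has at most one nonzero term, at the least prime factor.
  It is written as a sum over all prime factors to fit the extraction identity; for
  \<open>n = 1\<close> it is empty.\<close>

lemma lpf_coeff_eq:
  assumes n: "0 < n"
  shows "lpf_coeff J n = mu_on UNIV n * (\<Sum>q\<in>prime_factors n.
      (if J q \<and> (\<forall>r\<in>prime_factors (n div q). q < r) then (1 + real (omega (n div q))) ^ 2 else 0))"
proof (cases "squarefree n \<and> 2 \<le> n")
  case False
  then consider "\<not> squarefree n" | "n = 1" using n by linarith
  then show ?thesis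
  proof cases
    case 1
    then show ?thesis by (simp add: lpf_coeff_def moebius_mu_def mu_on_not_squarefree)
  next
    case 2
    then show ?thesis by (simp add: lpf_coeff_def)
  qed
next
  case True
  define p where "p = least_prime_factor n"
  obtain r where "prime r" "r dvd n" using True prime_factor_nat[of n] by auto
  then have "r \<in> prime_factors n" using n by (simp add: in_prime_factors_iff)
  then have ne: "prime_factors n \<noteq> {}" by blast
  have p: "p \<in> prime_factors n" unfolding p_def least_prime_factor_def using ne by (intro Min_in) auto
  have pmin: "p \<le> r" if "r \<in> prime_factors n" for r
    unfolding p_def least_prime_factor_def using that by (intro Min_le) auto
  have "(\<Sum>q\<in>prime_factors n. (if J q \<and> (\<forall>r\<in>prime_factors (n div q). q < r) then (1 + real (omega (n div q))) ^ 2 else 0))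
      = (\<Sum>q\<in>prime_factors n. if q = p then (if J p then real (omega n) ^ 2 else 0) else 0)"
  proof (intro sum.cong refl)
    fix q assume q: "q \<in> prime_factors n"
    have om: "real (omega n) = 1 + real (omega (n div q))" using omega_div_prime_factor(1)[of n q] True q by simp
    have pf: "prime_factors n = insert q (prime_factors (n div q))" "q \<notin> prime_factors (n div q)"
      using omega_div_prime_factor(2,3)[of n q] True q by auto
    have "(\<forall>r\<in>prime_factors (n div q). q < r) \<longleftrightarrow> q = p"
    proof
      assume a: "\<forall>r\<in>prime_factors (n div q). q < r"
      show "q = p"
      proof (rule ccontr)
        assume "q \<noteq> p"
        then have "p \<in> prime_factors (n div q)" using p unfolding pf(1) by simp
        then show False using a pmin[OF q] by fastforce
      qed
    next
      assume qp: "q = p"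
      show "\<forall>r\<in>prime_factors (n div q). q < r"
      proof
        fix r assume r: "r \<in> prime_factors (n div q)"
        then have "p \<le> r" using pmin[of r] unfolding pf(1) by simp
        moreover have "r \<noteq> q" using r pf(2) by auto
        ultimately show "q < r" using qp by simp
      qed
    qed
    then show "(if J q \<and> (\<forall>r\<in>prime_factors (n div q). q < r) then (1 + real (omega (n div q))) ^ 2 else 0)
        = (if q = p then (if J p then real (omega n) ^ 2 else 0) else 0)"
      unfolding om by simp
  qed
  also have "\<dots> = (if J p then real (omega n) ^ 2 else 0)" using p by simp
  finally show ?thesis using True by (simp add: lpf_coeff_def mu_on_def p_def)
qed

text \<open>Fixing the least prime \<open>q\<close> leaves rough numbers with weight
  \<open>(1 + omega m)\<^sup>2\<close>, whose moments carry coefficients 1, 2, 1 and account for the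
  4. The predicate keeps or drops an inner sum as a whole, so absolute values may be summed over
  \<open>q\<close> whatever \<open>J\<close> is.\<close>

lemma sum_lpf_coeff_bound:
  obtains C where "C > 0"
    "\<And>J v. 1 \<le> v \<Longrightarrow> \<bar>\<Sum>n\<in>upto_real v. lpf_coeff J n\<bar> \<le> C * (loglog v) ^ 3 * v / (1 + ln v)"
proof -
  obtain C where C: "C > 0"
    "\<And>p v. 1 \<le> p \<Longrightarrow> 1 \<le> v \<Longrightarrow> \<bar>mu_moment 0 (rough_primes p {}) v\<bar> \<le> C * (loglog v)\<^sup>2 * v / (1 + ln v)"
    "\<And>p v. 1 \<le> p \<Longrightarrow> 1 \<le> v \<Longrightarrow> \<bar>mu_moment 1 (rough_primes p {}) v\<bar> \<le> C * (loglog v)\<^sup>2 * v / (1 + ln v)"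
    "\<And>p v. 1 \<le> p \<Longrightarrow> 1 \<le> v \<Longrightarrow> \<bar>mu_moment 2 (rough_primes p {}) v\<bar> \<le> C * (loglog v)\<^sup>2 * v / (1 + ln v)"
    by (rule rough_moment_bounds) blast
  show ?thesis
  proof (rule that[of "4 * C * (16 * exp 1)"])
    show "4 * C * (16 * exp 1) > 0" using C by simp
    fix J and v :: real assume v: "1 \<le> v"
    define c where "c = (\<lambda>q m. if J q \<and> (\<forall>r\<in>prime_factors m. q < r) then (1 + real (omega m)) ^ 2 else (0::real))"
    have "(\<Sum>n\<in>upto_real v. lpf_coeff J n) = (\<Sum>n\<in>upto_real v. mu_on UNIV n * (\<Sum>q\<in>prime_factors n. c q (n div q)))"
      unfolding c_def by (intro sum.cong refl lpf_coeff_eq) (simp add: upto_real_def)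
    also have "\<dots> = - (\<Sum>q\<in>primes_upto v \<inter> UNIV. \<Sum>m\<in>upto_real (v / real q). mu_on (UNIV - {q}) m * c q m)"
      by (rule sum_mu_on_prime_factors)
    finally have eq: "(\<Sum>n\<in>upto_real v. lpf_coeff J n) = - (\<Sum>q\<in>primes_upto v \<inter> UNIV. \<Sum>m\<in>upto_real (v / real q). mu_on (UNIV - {q}) m * c q m)" .
    have L: "1 \<le> loglog v" by (rule loglog_ge_1[OF v])
    have "\<bar>\<Sum>q\<in>primes_upto v \<inter> UNIV. \<Sum>m\<in>upto_real (v / real q). mu_on (UNIV - {q}) m * c q m\<bar>
       \<le> (4 * C * (loglog v)\<^sup>2) * (16 * exp 1) * v * loglog v / (1 + ln v)"
    proof (rule sum_primes_bound[OF v])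
      show "0 \<le> 4 * C * (loglog v)\<^sup>2" using C by simp
      fix q assume q: "q \<in> primes_upto v"
      define w where "w = v / real q"
      have w: "1 \<le> w" "w \<le> v" unfolding w_def using primes_upto_quotient[OF q] by auto
      have q1: "1 \<le> q" using q prime_ge_1_nat by (auto simp: primes_upto_def)
      let ?R = "rough_primes q {}"
      have "(\<Sum>m\<in>upto_real w. mu_on (UNIV - {q}) m * c q m)
         = (\<Sum>m\<in>upto_real w. if J q then mu_on ?R m * (1 + real (omega m)) ^ 2 else 0)"
      proof (intro sum.cong refl)
        fix m
        have "(\<forall>r\<in>prime_factors m. q < r) \<longleftrightarrow> prime_factors m \<subseteq> ?R"
          unfolding rough_primes_def by auto
        moreover have "?R \<subseteq> UNIV - {q}" unfolding rough_primes_def by auto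
        ultimately show "mu_on (UNIV - {q}) m * c q m = (if J q then mu_on ?R m * (1 + real (omega m)) ^ 2 else 0)"
          unfolding c_def mu_on_def by auto
      qed
      also have "\<dots> = (if J q then mu_moment 0 ?R w + 2 * mu_moment 1 ?R w + mu_moment 2 ?R w else 0)"
        unfolding mu_moment_def by (simp add: sum.distrib[symmetric] sum_distrib_left power2_eq_square algebra_simps)
      finally have e: "(\<Sum>m\<in>upto_real w. mu_on (UNIV - {q}) m * c q m) = (if J q then mu_moment 0 ?R w + 2 * mu_moment 1 ?R w + mu_moment 2 ?R w else 0)" .
      define X where "X = C * (loglog w)\<^sup>2 * w / (1 + ln w)"
      have pos: "0 < 1 + ln w" by (rule one_plus_ln_pos[OF w(1)])
      have "0 \<le> X" unfolding X_def using C w pos by simp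
      then have "\<bar>\<Sum>m\<in>upto_real w. mu_on (UNIV - {q}) m * c q m\<bar> \<le> 4 * X"
        unfolding e using C(2)[OF q1 w(1)] C(3)[OF q1 w(1)] C(4)[OF q1 w(1)] unfolding X_def[symmetric] by auto
      also have "4 * X \<le> 4 * C * (loglog v)\<^sup>2 * w / (1 + ln w)"
      proof -
        have "(loglog w)\<^sup>2 \<le> (loglog v)\<^sup>2" using loglog_mono[OF w] loglog_ge_1[OF w(1)] by (intro power_mono) auto
        then have "C * (loglog w)\<^sup>2 * w / (1 + ln w) \<le> C * (loglog v)\<^sup>2 * w / (1 + ln w)"
          using C w pos by (intro divide_right_mono mult_right_mono mult_left_mono) auto
        then show ?thesis unfolding X_def by simp
      qed
      finally show "\<bar>\<Sum>m\<in>upto_real (v / real q). mu_on (UNIV - {q}) m * c q m\<bar> \<le> 4 * C * (loglog v)\<^sup>2 * (v / real q) / (1 + ln (v / real q))"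
        unfolding w_def .
    qed
    then show "\<bar>\<Sum>n\<in>upto_real v. lpf_coeff J n\<bar> \<le> 4 * C * (16 * exp 1) * (loglog v) ^ 3 * v / (1 + ln v)"
      unfolding eq abs_minus_cancel by (simp add: power2_eq_square power3_eq_cube mult_ac)
  qed
qed

section \<open>Axer's method for the fractional part\<close>

lemma abel_summation:
  fixes A f :: "nat \<Rightarrow> real"
  assumes "M < N"
  shows "(\<Sum>n\<in>{M<..N}. (A n - A (n - 1)) * f n) = A N * f N - A M * f (Suc M) + (\<Sum>n\<in>{M<..<N}. A n * (f n - f (Suc n)))"
proof -
  have "Suc M \<le> N" using assms by simp
  then show ?thesis
  proof (induction N rule: dec_induct)
    case base
    have "{M<..Suc M} = {Suc M}" "{M<..<Suc M} = {}" by auto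
    then show ?case by (simp add: algebra_simps)
  next
    case (step n)
    have "{M<..Suc n} = insert (Suc n) {M<..n}" "{M<..<Suc n} = insert n {M<..<n}" using step by auto
    then show ?case using step.IH by (simp add: algebra_simps)
  qed
qed

text \<open>Each \<open>A n\<close> is replaced by its majorant \<open>E * n\<close>, and the
  identity read backwards for \<open>A n = n\<close> restores the sum of \<open>f\<close>. Only the
  boundary term at \<open>M\<close> has the wrong sign, hence the extra
  \<open>2 * M * f (Suc M)\<close>.\<close>

lemma abel_bound:
  fixes A f :: "nat \<Rightarrow> real"
  assumes MN: "M < N"
    and f0: "\<And>n. M < n \<Longrightarrow> n \<le> N \<Longrightarrow> 0 \<le> f n"
    and dec: "\<And>n. M < n \<Longrightarrow> n < N \<Longrightarrow> f (Suc n) \<le> f n"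
    and A: "\<And>n. M \<le> n \<Longrightarrow> n \<le> N \<Longrightarrow> \<bar>A n\<bar> \<le> E * real n"
  shows "\<bar>\<Sum>n\<in>{M<..N}. (A n - A (n - 1)) * f n\<bar> \<le> E * (2 * real M * f (Suc M) + (\<Sum>n\<in>{M<..N}. f n))"
proof -
  have 1: "\<bar>A N * f N\<bar> \<le> E * real N * f N" unfolding abs_mult using A[of N] f0[of N] MN by (simp add: mult_right_mono)
  have 2: "\<bar>A M * f (Suc M)\<bar> \<le> E * real M * f (Suc M)" unfolding abs_mult using A[of M] f0[of "Suc M"] MN by (simp add: mult_right_mono)
  have 3: "\<bar>\<Sum>n\<in>{M<..<N}. A n * (f n - f (Suc n))\<bar> \<le> (\<Sum>n\<in>{M<..<N}. E * real n * (f n - f (Suc n)))"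
  proof (rule order_trans[OF sum_abs sum_mono])
    fix n assume n: "n \<in> {M<..<N}"
    then show "\<bar>A n * (f n - f (Suc n))\<bar> \<le> E * real n * (f n - f (Suc n))"
      unfolding abs_mult using A[of n] dec[of n] by (simp add: mult_right_mono)
  qed
  have "(\<Sum>n\<in>{M<..N}. f n) = (\<Sum>n\<in>{M<..N}. (real n - real (n - 1)) * f n)"
    by (intro sum.cong refl) auto
  also have "\<dots> = real N * f N - real M * f (Suc M) + (\<Sum>n\<in>{M<..<N}. real n * (f n - f (Suc n)))"
    by (rule abel_summation[OF MN])
  finally have f: "(\<Sum>n\<in>{M<..N}. f n) = real N * f N - real M * f (Suc M) + (\<Sum>n\<in>{M<..<N}. real n * (f n - f (Suc n)))" .
  have "\<bar>\<Sum>n\<in>{M<..N}. (A n - A (n - 1)) * f n\<bar>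
      \<le> E * real N * f N + E * real M * f (Suc M) + (\<Sum>n\<in>{M<..<N}. E * real n * (f n - f (Suc n)))"
    unfolding abel_summation[OF MN] using 1 2 3 by linarith
  also have "(\<Sum>n\<in>{M<..<N}. E * real n * (f n - f (Suc n))) = E * (\<Sum>n\<in>{M<..<N}. real n * (f n - f (Suc n)))"
    by (simp only: sum_distrib_left mult.assoc)
  also have "E * real N * f N + E * real M * f (Suc M) + E * (\<Sum>n\<in>{M<..<N}. real n * (f n - f (Suc n)))
      = E * (2 * real M * f (Suc M) + (\<Sum>n\<in>{M<..N}. f n))"
    unfolding f by (simp only: distrib_left right_diff_distrib)
  finally show ?thesis .
qed

text \<open>A trivial bound for the short initial range: each prime factor contributes at least
  \<open>ln 2 \<ge> 1/2\<close> to \<open>ln n\<close>.\<close>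

lemma abs_lpf_coeff_le:
  assumes n: "0 < n"
  shows "\<bar>lpf_coeff J n\<bar> \<le> 4 * (ln (real n))\<^sup>2"
proof (cases "squarefree n")
  case True
  have "real (omega n) * (1/2) \<le> (\<Sum>q\<in>prime_factors n. ln (real q))"
  proof -
    have "(\<Sum>q\<in>prime_factors n. 1/2) \<le> (\<Sum>q\<in>prime_factors n. ln (real q))"
    proof (intro sum_mono)
      fix q assume "q \<in> prime_factors n"
      then have "2 \<le> q" by (auto simp: in_prime_factors_iff prime_ge_2_nat)
      then have "ln 2 \<le> ln (real q)" by simp
      then show "1/2 \<le> ln (real q)" using ln2_ge_two_thirds by linarith
    qed
    then show ?thesis by (simp add: omega_def)
  qed
  then have "real (omega n) \<le> 2 * ln (real n)" using ln_eq_sum_prime_factors[OF True] by simp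
  then have "real (omega n) ^ 2 \<le> (2 * ln (real n))\<^sup>2" by (intro power_mono) auto
  moreover have "\<bar>lpf_coeff J n\<bar> \<le> 1 * real (omega n) ^ 2"
    unfolding lpf_coeff_def by (auto simp: abs_mult moebius_mu_def power_abs)
  ultimately show ?thesis by (simp add: power_mult_distrib)
qed (simp add: lpf_coeff_def moebius_mu_def)

lemma weighted_moebius_sum_eq:
  "weighted_moebius_sum l j x = (\<Sum>n\<in>upto_real x. lpf_coeff (\<lambda>p. [p = j] (mod l)) n * frac (x / real n))"
  unfolding weighted_moebius_sum_def
  by (rule sum.mono_neutral_cong_left) (auto simp: upto_real_def lpf_coeff_def finite_upto_real[unfolded upto_real_def])

text \<open>Below the cut the trivial bound suffices. Above it the fractional part is split as
  \<open>x / n\<close> minus its floor, and summation by parts costs the sum of \<open>1 / n\<close>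
  over a range whose end points have a ratio of order \<open>(ln x) ^ 3\<close>, that is one factor
  \<open>ln (ln x)\<close>.\<close>

lemma axer_bound:
  assumes C: "C > 0" "\<And>J v. 1 \<le> v \<Longrightarrow> \<bar>\<Sum>n\<in>upto_real v. lpf_coeff J n\<bar> \<le> C * (loglog v) ^ 3 * v / (1 + ln v)"
    and x: "3 \<le> x" "1 \<le> ln (ln x)" "sqrt x \<le> x / (2 * (ln x) ^ 3)" "2 \<le> x / (ln x) ^ 3"
  shows "\<bar>\<Sum>n\<in>upto_real x. lpf_coeff J n * frac (x / real n)\<bar>
      \<le> 4 * (x / ln x) + 12 * C * (x * (loglog x) ^ 3 * (1 + ln (ln x)) / ln x)"
proof -
  have lx: "exp 1 \<le> ln x" 
  proof -
    have "0 < ln x" using x by simp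
    then show ?thesis using x(2) by (simp add: ln_ge_iff)
  qed
  then have lx1: "1 < ln x" using exp_ge_add_one_self[of "1::real"] by linarith
  \<comment> \<open>The exponent 3 balances the trivial bound: \<open>4 * (ln x)\<^sup>2\<close> per
    term over \<open>y\<close> terms gives \<open>4 * x / ln x\<close>.\<close>
  define y where "y = x / (ln x) ^ 3"
  define M where "M = nat \<lfloor>y\<rfloor>"
  define N where "N = nat \<lfloor>x\<rfloor>"
  define A where "A = (\<lambda>k::nat. \<Sum>n\<in>upto_real (real k). lpf_coeff J n)"
  have y: "2 \<le> y" unfolding y_def using x by simp
  have fl: "real (nat \<lfloor>u\<rfloor>) \<le> u \<and> u < real (nat \<lfloor>u\<rfloor>) + 1" if "0 \<le> u" for u :: real
    using that by simp
  have M: "real M \<le> y" "y < real M + 1" unfolding M_def using fl[of y] y by auto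
  have Ms: "y / 2 \<le> real M" using M y by linarith
  have M1: "1 \<le> M" using M y by linarith
  have sM: "sqrt x \<le> real M" using Ms x(3) unfolding y_def by simp
  have N: "real N \<le> x" "x < real N + 1" unfolding N_def using fl[of x] x by auto
  have "ln x ^ 3 \<ge> 2" 
  proof -
    have "2 \<le> ln x" using lx exp_ge_add_one_self[of "1::real"] by linarith
    then have "ln x ^ 1 \<le> ln x ^ 3" by (intro power_increasing) auto
    then show ?thesis using \<open>2 \<le> ln x\<close> by simp
  qed
  then have "y \<le> x / 2" unfolding y_def using x by (intro divide_left_mono) auto
  then have MN: "M < N" using M N x by linarith
  have up: "upto_real x = {1..M} \<union> {M<..N}" "{1..M} \<inter> {M<..N} = {}"
    unfolding upto_real_eq N_def[symmetric] using MN M1 by auto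
  have p1: "\<bar>\<Sum>n\<in>{1..M}. lpf_coeff J n * frac (x / real n)\<bar> \<le> 4 * (x / ln x)"
  proof -
    have "\<bar>\<Sum>n\<in>{1..M}. lpf_coeff J n * frac (x / real n)\<bar> \<le> (\<Sum>n\<in>{1..M}. 4 * (ln x)\<^sup>2)"
    proof (rule order_trans[OF sum_abs sum_mono])
      fix n assume n: "n \<in> {1..M}"
      then have n1: "1 \<le> real n" "real n \<le> x" using MN N by auto
      have "\<bar>lpf_coeff J n\<bar> * \<bar>frac (x / real n)\<bar> \<le> (4 * (ln (real n))\<^sup>2) * 1"
        using n frac_lt_1[of "x / real n"] by (intro mult_mono abs_lpf_coeff_le) (auto simp: less_imp_le)
      also have "\<dots> \<le> 4 * (ln x)\<^sup>2" using n1 by (simp add: power_mono)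
      finally show "\<bar>lpf_coeff J n * frac (x / real n)\<bar> \<le> 4 * (ln x)\<^sup>2" by (simp add: abs_mult)
    qed
    also have "\<dots> = real M * (4 * (ln x)\<^sup>2)" by simp
    also have "\<dots> \<le> y * (4 * (ln x)\<^sup>2)" using M by (intro mult_right_mono) auto
    also have "\<dots> = 4 * (x / ln x)" unfolding y_def using lx1 by (simp add: power2_eq_square power3_eq_cube)
    finally show ?thesis .
  qed
  \<comment> \<open>The factor 2 arises because \<open>sqrt x \<le> M\<close>, so
    \<open>ln k\<close> is at least \<open>ln x / 2\<close> on the whole upper range.\<close>
  define E where "E = 2 * C * (loglog x) ^ 3 / ln x"
  have E0: "0 \<le> E" unfolding E_def using C lx1 x loglog_ge_1[of x] by simp
  have AE: "\<bar>A k\<bar> \<le> E * real k" if k: "M \<le> k" "k \<le> N" for k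
  proof -
    have k1: "1 \<le> real k" "real k \<le> x" "sqrt x \<le> real k" using k M1 N sM by auto
    have "ln (sqrt x) \<le> ln (real k)" using k1 x by (intro ln_mono) auto
    then have l: "ln x / 2 \<le> 1 + ln (real k)" using x by (simp add: ln_sqrt)
    have "(loglog (real k)) ^ 3 \<le> (loglog x) ^ 3" using loglog_mono[OF k1(1,2)] loglog_ge_1[OF k1(1)] by (intro power_mono) auto
    then have "C * (loglog (real k)) ^ 3 * real k / (1 + ln (real k)) \<le> C * (loglog x) ^ 3 * real k / (ln x / 2)"
      using C l lx1 k1 loglog_ge_1[of x] x by (intro frac_le mult_right_mono mult_left_mono) auto
    also have "\<dots> = E * real k" unfolding E_def by simp
    finally show ?thesis using C(2)[OF k1(1), of J] unfolding A_def by linarith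
  qed
  have diff: "lpf_coeff J n = A n - A (n - 1)" if n: "n \<in> {M<..N}" for n
  proof -
    obtain k where k: "n = Suc k" using n by (cases n) auto
    have "upto_real (real n) = insert n (upto_real (real (n - 1)))" "n \<notin> upto_real (real (n - 1))"
      unfolding k upto_real_def by auto
    then show ?thesis unfolding A_def by simp
  qed
  \<comment> \<open>Meant for \<open>x / n\<close> and for its floor, which are both nonnegative and
    nonincreasing in \<open>n\<close>, unlike their difference.\<close>
  have b: "\<bar>\<Sum>n\<in>{M<..N}. (A n - A (n - 1)) * f n\<bar> \<le> E * (3 * x + 3 * x * ln (ln x))"
    if f: "\<And>n. M < n \<Longrightarrow> 0 \<le> f n" "\<And>n. M < n \<Longrightarrow> f n \<le> x / real n" "\<And>n. M < n \<Longrightarrow> f (Suc n) \<le> f n" for f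
  proof -
    have "\<bar>\<Sum>n\<in>{M<..N}. (A n - A (n - 1)) * f n\<bar> \<le> E * (2 * real M * f (Suc M) + (\<Sum>n\<in>{M<..N}. f n))"
      by (rule abel_bound[OF MN]) (use f AE in auto)
    also have "\<dots> \<le> E * (2 * x + (x + 3 * x * ln (ln x)))"
    proof (intro mult_left_mono add_mono E0)
      have "2 * real M * f (Suc M) \<le> 2 * real M * (x / real (Suc M))" by (intro mult_left_mono f) auto
      also have "\<dots> \<le> 2 * x" using x by (simp add: field_simps)
      finally show "2 * real M * f (Suc M) \<le> 2 * x" .
      have "(\<Sum>n\<in>{M<..N}. f n) \<le> (\<Sum>n\<in>{M<..N}. x * (1 / real n))" using f by (intro sum_mono) auto
      also have "\<dots> = x * (\<Sum>n\<in>{M<..N}. 1 / real n)" by (simp add: sum_distrib_left)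
      also have "\<dots> \<le> x * ln (real N / real M)" using x M1 MN by (intro mult_left_mono sum_inverse_le_ln) auto
      also have "\<dots> \<le> x * ln (2 * (ln x) ^ 3)"
      proof (intro mult_left_mono ln_mono)
        have "real N / real M \<le> x / (y / 2)" using N Ms y x by (intro frac_le) auto
        also have "\<dots> = 2 * (ln x) ^ 3" unfolding y_def using x lx1 by simp
        finally show "real N / real M \<le> 2 * (ln x) ^ 3" .
      qed (use x MN M1 in auto)
      also have "ln (2 * (ln x) ^ 3) = ln 2 + 3 * ln (ln x)" using lx1 by (simp add: ln_mult ln_realpow)
      also have "x * (ln 2 + 3 * ln (ln x)) \<le> x * (1 + 3 * ln (ln x))" using x ln_2_less_1 by (intro mult_left_mono) auto
      finally show "(\<Sum>n\<in>{M<..N}. f n) \<le> x + 3 * x * ln (ln x)" by (simp add: algebra_simps)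
    qed
    finally show ?thesis by (simp add: algebra_simps)
  qed
  have "(\<Sum>n\<in>{M<..N}. lpf_coeff J n * frac (x / real n))
     = (\<Sum>n\<in>{M<..N}. (A n - A (n - 1)) * (x / real n)) - (\<Sum>n\<in>{M<..N}. (A n - A (n - 1)) * real_of_int \<lfloor>x / real n\<rfloor>)"
    unfolding sum_subtractf[symmetric] by (intro sum.cong refl) (simp add: diff frac_def right_diff_distrib)
  moreover have "x / real (Suc n) \<le> x / real n" if "M < n" for n
    using that x by (intro divide_left_mono) auto
  then have "\<bar>\<Sum>n\<in>{M<..N}. (A n - A (n - 1)) * (x / real n)\<bar> \<le> E * (3 * x + 3 * x * ln (ln x))"
    and "\<bar>\<Sum>n\<in>{M<..N}. (A n - A (n - 1)) * real_of_int \<lfloor>x / real n\<rfloor>\<bar> \<le> E * (3 * x + 3 * x * ln (ln x))"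
    using x by (intro b; simp add: floor_mono)+
  ultimately have p2: "\<bar>\<Sum>n\<in>{M<..N}. lpf_coeff J n * frac (x / real n)\<bar> \<le> 2 * (E * (3 * x + 3 * x * ln (ln x)))" by linarith
  have "(\<Sum>n\<in>upto_real x. lpf_coeff J n * frac (x / real n))
     = (\<Sum>n\<in>{1..M}. lpf_coeff J n * frac (x / real n)) + (\<Sum>n\<in>{M<..N}. lpf_coeff J n * frac (x / real n))"
    unfolding up(1) by (rule sum.union_disjoint) (use up in auto)
  moreover have "2 * (E * (3 * x + 3 * x * ln (ln x))) = 12 * C * (x * (loglog x) ^ 3 * (1 + ln (ln x)) / ln x)"
    unfolding E_def using lx1 by (simp add: field_simps)
  ultimately show ?thesis using p1 p2 by linarith
qed

text \<open>The principal filter over the admissible residues makes the bound hold for all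
  \<open>j\<close> with one threshold and one constant.\<close>

theorem theorem4p2:
  fixes l :: nat
  assumes "1 \<le> l"
  shows "(\<lambda>(x, j). weighted_moebius_sum l j x)
           \<in> O[at_top \<times>\<^sub>F principal {j. 1 \<le> j \<and> j \<le> l \<and> coprime j l}](\<lambda>(x, j).
                x * ln (ln x) powr (7/2) / sqrt (ln x))"
proof -
  obtain C where C: "C > 0"
    "\<And>J v. 1 \<le> v \<Longrightarrow> \<bar>\<Sum>n\<in>upto_real v. lpf_coeff J n\<bar> \<le> C * (loglog v) ^ 3 * v / (1 + ln v)"
    by (rule sum_lpf_coeff_bound) blast
  let ?g = "\<lambda>x::real. x * ln (ln x) powr (7/2) / sqrt (ln x)"
  let ?h = "\<lambda>x::real. 4 * (x / ln x) + 12 * C * (x * (loglog x) ^ 3 * (1 + ln (ln x)) / ln x)"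
  have 1: "(\<lambda>x::real. x / ln x) \<in> O(?g)" by real_asymp
  \<comment> \<open>Four powers of the iterated logarithm over a full logarithm: the quotient by the
    comparison function has the order of the square root of \<open>ln (ln x) / ln x\<close> and
    tends to 0.\<close>
  have 2: "(\<lambda>x::real. x * (loglog x) ^ 3 * (1 + ln (ln x)) / ln x) \<in> O(?g)"
    unfolding loglog_def by real_asymp
  have "?h \<in> O(?g)"
  proof (rule sum_in_bigo)
    show "(\<lambda>x. 4 * (x / ln x)) \<in> O(?g)"
      by (rule landau_o.big.cmult_in_iff[THEN iffD2, OF _ 1]) simp
    show "(\<lambda>x. 12 * C * (x * (loglog x) ^ 3 * (1 + ln (ln x)) / ln x)) \<in> O(?g)"
      by (rule landau_o.big.cmult_in_iff[THEN iffD2, OF _ 2]) (use C(1) in simp)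
  qed
  then obtain K where K: "eventually (\<lambda>x. norm (?h x) \<le> K * norm (?g x)) at_top"
    by (elim landau_o.bigE)
  have "eventually (\<lambda>x::real. 3 \<le> x \<and> 1 \<le> ln (ln x) \<and> sqrt x \<le> x / (2 * (ln x) ^ 3) \<and> 2 \<le> x / (ln x) ^ 3) at_top"
    by (intro eventually_conj; real_asymp)
  with K have ev: "eventually (\<lambda>x. \<forall>j. norm (weighted_moebius_sum l j x) \<le> K * norm (?g x)) at_top"
  proof eventually_elim
    case (elim x)
    show ?case
    proof
      fix j
      have "\<bar>weighted_moebius_sum l j x\<bar> \<le> ?h x"
        unfolding weighted_moebius_sum_eq by (rule axer_bound[OF C]) (use elim in auto)
      then show "norm (weighted_moebius_sum l j x) \<le> K * norm (?g x)" using elim by simp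
    qed
  qed
  show ?thesis
  proof (rule bigoI[where c = K])
    have "eventually (\<lambda>z. \<forall>j. norm (weighted_moebius_sum l j (fst z)) \<le> K * norm (?g (fst z)))
        (at_top \<times>\<^sub>F principal {j. 1 \<le> j \<and> j \<le> l \<and> coprime j l})"
      using ev filterlim_fst unfolding filterlim_iff by blast
    then show "eventually (\<lambda>z. norm (case z of (x, j) \<Rightarrow> weighted_moebius_sum l j x)
          \<le> K * norm (case z of (x, j) \<Rightarrow> x * ln (ln x) powr (7/2) / sqrt (ln x)))
        (at_top \<times>\<^sub>F principal {j. 1 \<le> j \<and> j \<le> l \<and> coprime j l})"
      by eventually_elim auto
  qed
qed

end
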